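(* Let $F,A\in\mathbb{R}^{m\times n}$, $H\in\mathbb{R}^{p\times n}$, let $Q_0,Q\in\mathbb{R}^{m\times m}$ and $R\in\mathbb{R}^{p\times p}$ be symmetric positive definite, let $\ell\in\mathbb{R}^m$, $0<t_1\in\mathbb{R}$ and $I=[0,t_1]$. The following statements are equivalent: (i) $(F,A,H)$ is $\ell$-impulse observable; (ii) there exists $U\in L^2([0,t_1],\mathbb{R}^p)$ such that $\sigma(U,\ell,t_1)<+\infty$; (iii) there exists a minimax observer $\widehat U$ on $[0,t_1]$ such that $\widehat U=\delta_{t_1}(u^* )$ and $\sigma(\widehat U,\ell,t_1)=J^*_{t_1}$, where $(q^*,u^* )\in\mathscr{D}_\ell([0,t_1])$ is a solution of the dual control problem $$J^*_{t_1}:=J(q^*,u^*,t_1)=\inf_{(q,u)\in\mathscr{D}_\ell(I)}J(q,u,t_1).$$ Moreover, for any $U\in L^2([0,t_1],\mathbb{R}^p)$, $$\sigma(U,\ell,t_1)=\inf_{(q,u)\in\mathscr{D}_\ell(I),\ u=\delta_{t_1}(U)}J(q,u,t_1).$$ In particular, the set $\{(q,u)\in\mathscr{D}_\ell(I)\mid u=\delta_{t_1}(U)\}$ is not empty if and only if $\sigma(U,\ell,t_1)<+\infty$.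
   Context: Notation. $M^+$ is the Moore-Penrose pseudoinverse of a matrix $M$; $\mathcal{I}_m$ is the $m\times m$ identity; the infimum of an empty set is $+\infty$. $L^2_{loc}(J)$ denotes functions on an interval $J$ that are square integrable on every compact subinterval. For $v\in L^2([0,t_1],\mathbb{R}^k)$, $\delta_{t_1}(v)(s)=v(t_1-s)$ a.e. When $x$ (resp. $q$) is such that $Fx$ (resp. $F^\top q$) is absolutely continuous, $Fx(t)$ (resp. $F^\top q(t)$) denotes the value at $t$ of the absolutely continuous function. DAE. For an interval $I=[0,t_1]$, a solution on $I$ of the DAE $\frac{d(Fx)}{dt}=Ax+f$, $y=Hx+\eta$ is a tuple $(x,f,y,\eta)\in L^2_{loc}(I,\mathbb{R}^n)\times L^2_{loc}(I,\mathbb{R}^m)\times L^2_{loc}(I,\mathbb{R}^p)\times L^2_{loc}(I,\mathbb{R}^p)$ such that $Fx$ is absolutely continuous, $Fx(t)=Fx(0)+\int_0^t(Ax(s)+f(s))ds$ for all $t\in I$, and $y(t)=Hx(t)+\eta(t)$ a.e. on $I$. The solution is admissible if for all $\tau\in I$ $$(Fx(0))^\top Q_0Fx(0)+\int_0^{\tau}\big(f^\top(t)Qf(t)+\eta^\top(t)R\eta(t)\big)dt\le 1.$$ The set of admissible solutions on $I$ is $\mathscr{EE}(I)$. Observers. For $U,y\in L^2([0,t_1],\mathbb{R}^p)$ let $\mathcal{O}_U(t_1,y)=\int_0^{t_1}y^\top(t)U(t)dt$ and $$\sigma(U,\ell,t_1):=\sup_{(x,f,y,\eta)\in\mathscr{EE}([0,t_1])}\big(\ell^\top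 Fx(t_1)-\mathcal{O}_U(t_1,y)\big)^2.$$ $\widehat U\in L^2([0,t_1],\mathbb{R}^p)$ is a minimax observer on $[0,t_1]$ if $\sigma(\widehat U,\ell,t_1)=\inf_{U\in L^2([0,t_1],\mathbb{R}^p)}\sigma(U,\ell,t_1)<+\infty$. Dual DAE. For $I=[0,\tau]$, $\tau>0$, a solution on $I$ of the dual DAE $\frac{d(F^\top q)}{dt}=A^\top q-H^\top u$ is a pair $(q,u)\in L^2_{loc}(I,\mathbb{R}^m)\times L^2_{loc}(I,\mathbb{R}^p)$ such that $F^\top q$ is absolutely continuous and $F^\top q(t)=F^\top q(0)+\int_0^t(A^\top q(s)-H^\top u(s))ds$ for all $t\in I$. $\mathscr{D}_\ell(I)$ is the set of all solutions $(q,u)$ on $I$ with $F^\top q(0)=F^\top\ell$. The tuple $(F,A,H)$ is $\ell$-impulse observable if $\mathscr{D}_\ell([0,\tau])\neq\varnothing$ for some $0<\tau\in\mathbb{R}$. Dual cost. For $(q,u)\in\mathscr{D}_\ell([0,t_1])$, $$J(q,u,t_1):=q(t_1)^\top\bar Q_0q(t_1)+\int_0^{t_1}\big(q^\top(t)Q^{-1}q(t)+u^\top(t)R^{-1}u(t)\big)dt,$$ where $\bar Q_0=F\big((F^\top)^+-\mathcal{M}_{opt}\big)^\top Q_0^{-1}\big((F^\top)^+-\mathcal{M}_{opt}\big)F^\top$, $\mathcal{M}_{opt}=P(PQ_0^{-1}P)^+PQ_0^{-1}(F^\top)^+$, $P=\mathcal{I}_m-(F^\top)^+F^\top$. (Since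 $\bar Q_0$ has the form $F(\cdot)F^\top$, the first term depends only on $F^\top q(t_1)$ and is understood in that sense.) *)

theory Defs
  imports "HOL-Analysis.Analysis"
begin

definition sym_pos_def :: "real^'k^'k \<Rightarrow> bool" where
  "sym_pos_def M \<longleftrightarrow> transpose M = M \<and> (\<forall>x. x \<noteq> 0 \<longrightarrow> 0 < x \<bullet> (M *v x))"

text \<open>The Moore-Penrose pseudoinverse, as the unique matrix satisfying the four Penrose equations.\<close>

definition is_pinv :: "real^'n^'m \<Rightarrow> real^'m^'n \<Rightarrow> bool" where
  "is_pinv M X \<longleftrightarrow>
     M ** X ** M = M \<and> X ** M ** X = X \<and>
     transpose (M ** X) = M ** X \<and> transpose (X ** M) = X ** M"

definition pinv :: "real^'n^'m \<Rightarrow> real^'m^'n" where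
  "pinv M = (THE X. is_pinv M X)"

lemma is_pinv_unique:
  fixes M :: "real^'n^'m" and X Y :: "real^'m^'n"
  assumes X: "is_pinv M X" and Y: "is_pinv M Y"
  shows "X = Y"
proof -
  have x: "M ** X ** M = M" "X ** M ** X = X"
      "transpose (M ** X) = M ** X" "transpose (X ** M) = X ** M"
    and y: "M ** Y ** M = M" "Y ** M ** Y = Y"
      "transpose (M ** Y) = M ** Y" "transpose (Y ** M) = Y ** M"
    using X Y by (auto simp: is_pinv_def)
  have "M ** X = (M ** Y) ** (M ** X)"
    using y(1) by (metis matrix_mul_assoc)
  then have "transpose (M ** X) = transpose (M ** X) ** transpose (M ** Y)"
    by (metis matrix_transpose_mul)
  then have "M ** X = (M ** X ** M) ** Y"
    by (simp add: x(3) y(3) matrix_mul_assoc)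
  then have MX: "M ** X = M ** Y"
    by (simp add: x(1))
  have "X ** M = (X ** M) ** (Y ** M)"
    using y(1) by (metis matrix_mul_assoc)
  then have "transpose (X ** M) = transpose (Y ** M) ** transpose (X ** M)"
    by (metis matrix_transpose_mul)
  then have "X ** M = Y ** (M ** X ** M)"
    by (simp add: x(4) y(4) matrix_mul_assoc)
  then have XM: "X ** M = Y ** M"
    by (simp add: x(1))
  have "X = X ** M ** X" by (simp add: x(2))
  also have "\<dots> = Y ** (M ** X)" by (simp add: XM matrix_mul_assoc)
  also have "\<dots> = Y" by (simp add: MX y(2) matrix_mul_assoc)
  finally show ?thesis .
qed

text \<open>Elements of \<open>L\<^sup>2\<close> are represented by functions; only their values almost everywhere on the
  domain matter, and equality in \<open>L\<^sup>2\<close> is written out as equality almost everywhere.\<close>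

definition L2 :: "real set \<Rightarrow> (real \<Rightarrow> 'a::euclidean_space) set" where
  "L2 J = {v. v \<in> borel_measurable (lebesgue_on J) \<and>
              integrable (lebesgue_on J) (\<lambda>t. (norm (v t))\<^sup>2)}"

definition L2_loc :: "real set \<Rightarrow> (real \<Rightarrow> 'a::euclidean_space) set" where
  "L2_loc J = {v. \<forall>a b. {a..b} \<subseteq> J \<longrightarrow> v \<in> L2 {a..b}}"

definition abs_continuous_on :: "real set \<Rightarrow> (real \<Rightarrow> 'a::real_normed_vector) \<Rightarrow> bool" where
  "abs_continuous_on J g \<longleftrightarrow>
     (\<forall>\<epsilon>>0. \<exists>\<delta>>0. \<forall>(N::nat) a b.
        (\<forall>i<N. a i \<le> b i \<and> {a i..b i} \<subseteq> J) \<and>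
        (\<forall>i<N. \<forall>j<N. i \<noteq> j \<longrightarrow> {a i<..<b i} \<inter> {a j<..<b j} = {}) \<and>
        (\<Sum>i<N. b i - a i) < \<delta>
        \<longrightarrow> (\<Sum>i<N. norm (g (b i) - g (a i))) < \<epsilon>)"

text \<open>An element \<open>w\<close> of \<open>L\<^sup>2\<^sub>l\<^sub>o\<^sub>c\<close> is absolutely continuous if it agrees almost everywhere with an
  absolutely continuous function, and its value at a point is then the value of that function, which
  is unique on a nondegenerate interval (see \<open>ac_version_eqI\<close> below).\<close>

definition is_ac_version :: "real set \<Rightarrow> (real \<Rightarrow> 'a::euclidean_space) \<Rightarrow> (real \<Rightarrow> 'a) \<Rightarrow> bool" where
  "is_ac_version J w g \<longleftrightarrow> abs_continuous_on J g \<and> (AE t in lebesgue_on J. w t = g t)"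

definition ac_version :: "real set \<Rightarrow> (real \<Rightarrow> 'a::euclidean_space) \<Rightarrow> real \<Rightarrow> 'a" where
  "ac_version J w = (SOME g. is_ac_version J w g)"

lemma abs_continuous_on_imp_continuous_on:
  assumes "abs_continuous_on {c..d} g"
  shows "continuous_on {c..d} g"
  unfolding continuous_on_iff
proof (intro ballI allI impI)
  fix x \<epsilon> :: real
  assume x: "x \<in> {c..d}" and "\<epsilon> > 0"
  then obtain \<delta> where "\<delta> > 0" and \<delta>: "\<And>(N::nat) a b.
        (\<forall>i<N. a i \<le> b i \<and> {a i..b i} \<subseteq> {c..d}) \<and>
        (\<forall>i<N. \<forall>j<N. i \<noteq> j \<longrightarrow> {a i<..<b i} \<inter> {a j<..<b j} = {}) \<and>
        (\<Sum>i<N. b i - a i) < \<delta>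
        \<longrightarrow> (\<Sum>i<N. norm (g (b i) - g (a i))) < \<epsilon>"
    using assms unfolding abs_continuous_on_def by meson
  have "dist (g y) (g x) < \<epsilon>" if "y \<in> {c..d}" "dist y x < \<delta>" for y
    using \<delta>[of "Suc 0" "\<lambda>_. min x y" "\<lambda>_. max x y"] x that
    by (cases "x \<le> y") (auto simp: dist_norm norm_minus_commute)
  with \<open>\<delta> > 0\<close> show "\<exists>\<delta>>0. \<forall>y\<in>{c..d}. dist y x < \<delta> \<longrightarrow> dist (g y) (g x) < \<epsilon>"
    by blast
qed

lemma ac_version_eqI:
  assumes "c < d" and g: "is_ac_version {c..d} w g" and t: "t \<in> {c..d}"
  shows "ac_version {c..d} w t = g t"
proof -
  define h where "h = ac_version {c..d} w"
  have h: "is_ac_version {c..d} w h"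
    unfolding h_def ac_version_def by (rule someI[where P = "is_ac_version {c..d} w", OF g])
  have "continuous_on {c..d} g" "continuous_on {c..d} h"
    using g h by (simp_all add: is_ac_version_def abs_continuous_on_imp_continuous_on)
  then have cont: "continuous_on {c..d} (\<lambda>t. h t - g t)"
    by (intro continuous_intros)
  have "AE t in lebesgue_on {c..d}. h t - g t = 0"
    using g h by (auto simp: is_ac_version_def)
  then have "AE t in lebesgue. t \<in> {c..d} \<longrightarrow> h t - g t = 0"
    by (simp add: AE_restrict_space_iff)
  then obtain N where N: "N \<in> null_sets lebesgue" "{t. \<not> (t \<in> {c..d} \<longrightarrow> h t - g t = 0)} \<subseteq> N"
    by (auto simp: eventually_ae_filter)
  have "negligible N" using N(1) by (simp add: negligible_iff_null_sets)
  define S where "S = {t \<in> {c..d}. h t - g t = 0}"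
  have "closed S"
    unfolding S_def by (intro continuous_closed_preimage_constant cont) auto
  have "negligible ({c<..<d} - S)"
    by (rule negligible_subset[OF \<open>negligible N\<close>]) (use N(2) in \<open>fastforce simp: S_def\<close>)
  moreover have "open ({c<..<d} - S)" using \<open>closed S\<close> by (simp add: open_Diff)
  ultimately have "{c<..<d} \<subseteq> S" using open_not_negligible by (metis Diff_eq_empty_iff)
  then have "closure {c<..<d} \<subseteq> S" using \<open>closed S\<close> by (rule closure_minimal)
  with t \<open>c < d\<close> have "t \<in> S" by (simp add: subset_iff)
  then show ?thesis by (simp add: S_def h_def)
qed

definition dae_solution ::
  "real^'n^'m \<Rightarrow> real^'n^'m \<Rightarrow> real^'n^'p \<Rightarrow> real \<Rightarrow>
   (real \<Rightarrow> real^'n) \<Rightarrow> (real \<Rightarrow> real^'m) \<Rightarrow> (real \<Rightarrow> real^'p) \<Rightarrow> (real \<Rightarrow> real^'p) \<Rightarrow> bool" where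
  "dae_solution F A H t1 x f y \<eta> \<longleftrightarrow>
     (let I = {0..t1}; Fx = ac_version I (\<lambda>t. F *v x t) in
       x \<in> L2_loc I \<and> f \<in> L2_loc I \<and> y \<in> L2_loc I \<and> \<eta> \<in> L2_loc I \<and>
       (\<exists>g. is_ac_version I (\<lambda>t. F *v x t) g) \<and>
       (\<forall>t\<in>I. Fx t = Fx 0 + (LINT s|lebesgue_on {0..t}. A *v x s + f s)) \<and>
       (AE t in lebesgue_on I. y t = H *v x t + \<eta> t))"

definition EE ::
  "real^'n^'m \<Rightarrow> real^'n^'m \<Rightarrow> real^'n^'p \<Rightarrow> real^'m^'m \<Rightarrow> real^'m^'m \<Rightarrow> real^'p^'p \<Rightarrow> real \<Rightarrow>
   ((real \<Rightarrow> real^'n) \<times> (real \<Rightarrow> real^'m) \<times> (real \<Rightarrow> real^'p) \<times> (real \<Rightarrow> real^'p)) set" where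
  "EE F A H Q0 Q R t1 =
     {(x, f, y, \<eta>). dae_solution F A H t1 x f y \<eta> \<and>
       (let Fx = ac_version {0..t1} (\<lambda>t. F *v x t) in
         \<forall>\<tau>\<in>{0..t1}.
           Fx 0 \<bullet> (Q0 *v Fx 0) +
           (LINT t|lebesgue_on {0..\<tau>}. f t \<bullet> (Q *v f t) + \<eta> t \<bullet> (R *v \<eta> t)) \<le> 1)}"

definition obs :: "(real \<Rightarrow> real^'p) \<Rightarrow> real \<Rightarrow> (real \<Rightarrow> real^'p) \<Rightarrow> real" where
  "obs U t1 y = (LINT t|lebesgue_on {0..t1}. y t \<bullet> U t)"

definition obs_error ::
  "real^'n^'m \<Rightarrow> real^'n^'m \<Rightarrow> real^'n^'p \<Rightarrow> real^'m^'m \<Rightarrow> real^'m^'m \<Rightarrow> real^'p^'p \<Rightarrow>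
   (real \<Rightarrow> real^'p) \<Rightarrow> real^'m \<Rightarrow> real \<Rightarrow> ereal" where
  "obs_error F A H Q0 Q R U l t1 =
     (SUP (x, f, y, \<eta>)\<in>EE F A H Q0 Q R t1.
        ereal ((l \<bullet> ac_version {0..t1} (\<lambda>t. F *v x t) t1 - obs U t1 y)\<^sup>2))"

definition minimax_observer ::
  "real^'n^'m \<Rightarrow> real^'n^'m \<Rightarrow> real^'n^'p \<Rightarrow> real^'m^'m \<Rightarrow> real^'m^'m \<Rightarrow> real^'p^'p \<Rightarrow>
   real^'m \<Rightarrow> real \<Rightarrow> (real \<Rightarrow> real^'p) \<Rightarrow> bool" where
  "minimax_observer F A H Q0 Q R l t1 V \<longleftrightarrow>
     V \<in> L2 {0..t1} \<and>
     obs_error F A H Q0 Q R V l t1 = (INF U\<in>L2 {0..t1}. obs_error F A H Q0 Q R U l t1) \<and>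
     obs_error F A H Q0 Q R V l t1 < \<infinity>"

definition dual_solution ::
  "real^'n^'m \<Rightarrow> real^'n^'m \<Rightarrow> real^'n^'p \<Rightarrow> real \<Rightarrow>
   (real \<Rightarrow> real^'m) \<Rightarrow> (real \<Rightarrow> real^'p) \<Rightarrow> bool" where
  "dual_solution F A H \<tau> q u \<longleftrightarrow>
     (let I = {0..\<tau>}; Fq = ac_version I (\<lambda>t. transpose F *v q t) in
       q \<in> L2_loc I \<and> u \<in> L2_loc I \<and>
       (\<exists>g. is_ac_version I (\<lambda>t. transpose F *v q t) g) \<and>
       (\<forall>t\<in>I. Fq t = Fq 0 +
          (LINT s|lebesgue_on {0..t}. transpose A *v q s - transpose H *v u s)))"

definition dual_set ::
  "real^'n^'m \<Rightarrow> real^'n^'m \<Rightarrow> real^'n^'p \<Rightarrow> real^'m \<Rightarrow> real \<Rightarrow>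
   ((real \<Rightarrow> real^'m) \<times> (real \<Rightarrow> real^'p)) set" where
  "dual_set F A H l \<tau> =
     {(q, u). dual_solution F A H \<tau> q u \<and>
        ac_version {0..\<tau>} (\<lambda>t. transpose F *v q t) 0 = transpose F *v l}"

definition impulse_observable ::
  "real^'n^'m \<Rightarrow> real^'n^'m \<Rightarrow> real^'n^'p \<Rightarrow> real^'m \<Rightarrow> bool" where
  "impulse_observable F A H l \<longleftrightarrow> (\<exists>\<tau>>0. dual_set F A H l \<tau> \<noteq> {})"

definition proj_ker :: "real^'n^'m \<Rightarrow> real^'m^'m" where
  "proj_ker F = mat 1 - pinv (transpose F) ** transpose F"

definition M_opt :: "real^'n^'m \<Rightarrow> real^'m^'m \<Rightarrow> real^'n^'m" where
  "M_opt F Q0 =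
     (let P = proj_ker F in
       P ** pinv (P ** matrix_inv Q0 ** P) ** P ** matrix_inv Q0 ** pinv (transpose F))"

definition Qbar0_core :: "real^'n^'m \<Rightarrow> real^'m^'m \<Rightarrow> real^'n^'n" where
  "Qbar0_core F Q0 =
     (let K = pinv (transpose F) - M_opt F Q0 in transpose K ** matrix_inv Q0 ** K)"

definition Qbar0 :: "real^'n^'m \<Rightarrow> real^'m^'m \<Rightarrow> real^'m^'m" where
  "Qbar0 F Q0 = F ** Qbar0_core F Q0 ** transpose F"

text \<open>A dual solution \<open>q\<close> need not have a well-defined value at the end point, only \<open>F\<^sup>T q\<close> does.
  The terminal cost is therefore evaluated through the following identity, with \<open>F\<^sup>T v\<close> replaced
  by the value of the absolutely continuous version of \<open>F\<^sup>T q\<close>.\<close>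

lemma Qbar0_quadratic_form:
  "v \<bullet> (Qbar0 F Q0 *v v) = (transpose F *v v) \<bullet> (Qbar0_core F Q0 *v (transpose F *v v))"
  unfolding Qbar0_def
  by (simp add: dot_lmul_matrix[symmetric] flip: matrix_vector_mul_assoc)

definition dual_cost ::
  "real^'n^'m \<Rightarrow> real^'m^'m \<Rightarrow> real^'m^'m \<Rightarrow> real^'p^'p \<Rightarrow>
   (real \<Rightarrow> real^'m) \<Rightarrow> (real \<Rightarrow> real^'p) \<Rightarrow> real \<Rightarrow> real" where
  "dual_cost F Q0 Q R q u t1 =
     (let w = ac_version {0..t1} (\<lambda>t. transpose F *v q t) t1 in
       w \<bullet> (Qbar0_core F Q0 *v w) +
       (LINT t|lebesgue_on {0..t1}.
          q t \<bullet> (matrix_inv Q *v q t) + u t \<bullet> (matrix_inv R *v u t)))"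

text \<open>\<open>is_reflection t1 v w\<close> says \<open>w = \<delta>\<^sub>t\<^sub>1(v)\<close> as elements of \<open>L\<^sup>2\<close>.\<close>

definition is_reflection :: "real \<Rightarrow> (real \<Rightarrow> real^'k) \<Rightarrow> (real \<Rightarrow> real^'k) \<Rightarrow> bool" where
  "is_reflection t1 v w \<longleftrightarrow> (AE s in lebesgue_on {0..t1}. w s = v (t1 - s))"

definition dual_optimal ::
  "real^'n^'m \<Rightarrow> real^'n^'m \<Rightarrow> real^'n^'p \<Rightarrow> real^'m^'m \<Rightarrow> real^'m^'m \<Rightarrow> real^'p^'p \<Rightarrow>
   real^'m \<Rightarrow> real \<Rightarrow> (real \<Rightarrow> real^'m) \<Rightarrow> (real \<Rightarrow> real^'p) \<Rightarrow> bool" where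
  "dual_optimal F A H Q0 Q R l t1 q u \<longleftrightarrow>
     (q, u) \<in> dual_set F A H l t1 \<and>
     ereal (dual_cost F Q0 Q R q u t1) =
       (INF (q', u')\<in>dual_set F A H l t1. ereal (dual_cost F Q0 Q R q' u' t1))"

end

theory Submission
  imports Defs
begin

text \<open>
  The dual problem is obtained by testing the state equation with a solution \<open>q\<close> of the dual DAE run
  backwards. With \<open>u = \<delta>\<^sub>t\<^sub>1(U)\<close>, integration by parts (lemma \<open>duality_pairing\<close>) gives, for every
  solution of the DAE,
    \<open>l\<^sup>T F x(t\<^sub>1) - \<integral> y\<^sup>T U = e\<^sup>T F x(0) + \<integral> q(t\<^sub>1 - t)\<^sup>T f(t) dt - \<integral> \<eta>\<^sup>T U\<close>
  whenever \<open>F\<^sup>T e\<close> is the terminal value of \<open>F\<^sup>T q\<close>. The terminal cost is the least value of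
  \<open>e\<^sup>T Q\<^sub>0\<^sup>-\<^sup>1 e\<close> over such \<open>e\<close> (lemma \<open>terminal_minimiser\<close>), and Young's inequality bounds the
  squared error of an admissible solution by \<open>J(q, u, t\<^sub>1)\<close>. This is weak duality.

  For strong duality (lemma \<open>strong_duality\<close>), let \<open>\<sigma>(U, l, t\<^sub>1)\<close> be finite. Then the error is a
  bounded linear functional of the triple \<open>(F x(0), f, \<eta>)\<close> in the Hilbert space whose norm defines
  admissibility, and by the Riesz theorem it is the inner product with some element \<open>z\<close> of squared
  norm at most \<open>\<sigma>(U, l, t\<^sub>1)\<close>. Varying the noise alone shows that its last component gives \<open>U\<close>;
  testing with trajectories whose \<open>x\<close> is a primitive of an arbitrary square integrable function
  shows that the disturbance component gives a dual solution (lemma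
  \<open>dual_solution_of_representation\<close>), and its cost is at most the squared norm of \<open>z\<close>. Thus the
  infimum in the formula for a finite \<open>\<sigma>\<close> is attained. The subspace of triples of actual solutions
  need not be closed for this.

  On the solutions with \<open>y = 0\<close> the error does not depend on \<open>U\<close>. The same argument for this smaller
  space (lemma \<open>optimal_dual_solution\<close>) gives one dual solution whose cost is at most
  \<open>\<sigma>(U, l, t\<^sub>1)\<close> for all \<open>U\<close>; by weak duality it is optimal and its reflected input is a minimax
  observer.

  Impulse observability only provides a dual solution on some interval. Consistency of an initial
  value does not depend on the horizon (lemma \<open>consistent_all_horizons\<close>): the subspaces of consistent
  values decrease with the horizon, so by their dimension they are constant for small horizons, and
  trajectories can then be prolonged step by step.
\<close>

section \<open>Symmetric positive definite forms and the pseudoinverse\<close>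

lemma matrix_diff_mult_distribs:
  fixes A :: "real^'n^'m"
  shows "A ** (B - C) = A ** B - A ** (C :: real^'k^'n)"
    and "(B' - C') ** A = B' ** A - C' ** (A :: real^'n^'m)"
  by (simp_all add: vec_eq_iff matrix_matrix_mult_def algebra_simps sum_subtractf)

lemma transpose_diff: "transpose (A - B) = transpose A - transpose (B :: real^'n^'m)"
  by (simp add: transpose_def vec_eq_iff)

lemma inner_matrix_transpose: "x \<bullet> (M *v y) = (transpose M *v x) \<bullet> (y::real^'n)"
  by (metis dot_lmul_matrix transpose_matrix_vector)

text \<open>\<open>M Y\<close> is the orthogonal projector onto the range of \<open>M\<close>; the columns of \<open>Y\<close> come from the orthogonal
  decomposition of the unit vectors.\<close>

lemma normal_equations_solvable:
  fixes M :: "real^'n^'m"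
  shows "\<exists>Y :: real^'m^'n. transpose M ** M ** Y = transpose M"
proof -
  have "\<exists>x. transpose M *v (v - M *v x) = 0" for v :: "real^'m"
  proof -
    have sub: "subspace (range ((*v) M))"
      by (simp add: linear_subspace_image)
    obtain y z where y: "y \<in> span (range ((*v) M))"
      and z: "\<And>w. w \<in> span (range ((*v) M)) \<Longrightarrow> orthogonal z w" and v: "v = y + z"
      by (rule orthogonal_subspace_decomp_exists[of "range ((*v) M)" v]) blast
    obtain x where x: "y = M *v x" using y span_eq_iff[THEN iffD2, OF sub] by auto
    have "(transpose M *v z) \<bullet> w = 0" for w
    proof -
      have "z \<bullet> (M *v w) = 0" using z[of "M *v w"] by (simp add: orthogonal_def span_base)
      then show ?thesis by (metis dot_lmul_matrix transpose_matrix_vector)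
    qed
    then have "transpose M *v z = 0" by (metis inner_eq_zero_iff)
    then show ?thesis using v x by (intro exI[of _ x]) simp
  qed
  then obtain X where X: "\<And>v. transpose M *v (v - M *v X v) = 0" by metis
  define Y :: "real^'m^'n" where "Y = (\<chi> i j. X (axis j 1) $ i)"
  have col: "Y *v axis j 1 = X (axis j 1)" for j
    by (simp add: Y_def vec_eq_iff matrix_vector_mult_basis column_def)
  have "(transpose M ** M ** Y) *v axis j 1 = transpose M *v axis j 1" for j
    using X[of "axis j 1"]
    by (simp add: col matrix_vector_mult_diff_distrib flip: matrix_vector_mul_assoc)
  then have "transpose M ** M ** Y = transpose M"
    by (simp add: vec_eq_iff matrix_vector_mult_basis column_def)
  then show ?thesis ..
qed

lemma matrix_eq_0_if_gram_0:
  fixes M :: "real^'n^'m" and N :: "real^'k^'n"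
  assumes "transpose M ** M ** N = 0" shows "M ** N = 0"
proof -
  have "(M ** N) *v x = 0" for x
  proof -
    have "(M *v (N *v x)) \<bullet> (M *v (N *v x)) = (N *v x) \<bullet> ((transpose M ** M ** N) *v x)"
      by (simp add: inner_matrix_transpose[of "N *v x" "transpose M"] del: transpose_matrix_vector
          flip: matrix_vector_mul_assoc)
    also have "\<dots> = 0" using assms by simp
    finally show ?thesis by (simp flip: matrix_vector_mul_assoc)
  qed
  then show ?thesis by (simp add: matrix_eq)
qed

lemma exists_orthogonal_projector:
  fixes M :: "real^'n^'m"
  obtains Y where "transpose (M ** Y) = M ** Y" "M ** Y ** M = M"
proof -
  obtain Y where Y: "transpose M ** M ** Y = transpose M" using normal_equations_solvable by blast
  have "transpose (M ** Y) ** (M ** Y) = transpose (M ** Y)"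
    using Y by (metis matrix_mul_assoc matrix_transpose_mul)
  then have sym: "transpose (M ** Y) = M ** Y"
    by (metis matrix_transpose_mul transpose_transpose)
  have "transpose M ** M ** (Y ** M - mat 1) = 0"
    using Y by (simp add: matrix_diff_mult_distribs matrix_mul_assoc)
  then have "M ** (Y ** M - mat 1) = 0" by (rule matrix_eq_0_if_gram_0)
  then have "M ** Y ** M = M" by (simp add: matrix_diff_mult_distribs matrix_mul_assoc)
  with sym that show ?thesis by blast
qed

text \<open>With symmetric \<open>M Y\<close> and \<open>Z M\<close> such that \<open>M Y M = M = M Z M\<close>, the matrix \<open>Z M Y\<close> satisfies the
  Penrose equations.\<close>

lemma is_pinv_pinv:
  fixes M :: "real^'n^'m"
  shows "is_pinv M (pinv M)"
proof -
  obtain Y where Y: "transpose (M ** Y) = M ** Y" "M ** Y ** M = M"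
    using exists_orthogonal_projector .
  obtain Z' where Z': "transpose (transpose M ** Z') = transpose M ** Z'"
      "transpose M ** Z' ** transpose M = transpose M"
    using exists_orthogonal_projector .
  define Z where "Z = transpose Z'"
  have Z: "transpose (Z ** M) = Z ** M" "M ** Z ** M = M"
    using Z' unfolding Z_def by (metis matrix_transpose_mul transpose_transpose matrix_mul_assoc)+
  have a: "M ** (Z ** M ** Y) = M ** Y" using Z by (metis matrix_mul_assoc)
  have b: "Z ** M ** Y ** M = Z ** M" using Y by (metis matrix_mul_assoc)
  have c: "Z ** M ** (Z ** M ** Y) = Z ** M ** Y" using Z(2) by (metis matrix_mul_assoc)
  have "is_pinv M (Z ** M ** Y)"
    unfolding is_pinv_def a b c using Y Z by simp
  then show ?thesis unfolding pinv_def by (metis (mono_tags) theI is_pinv_unique)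
qed

lemma pinv_simps:
  "M ** pinv M ** M = M" "pinv M ** M ** pinv M = pinv M"
  "transpose (M ** pinv M) = M ** pinv M" "transpose (pinv M ** M) = pinv M ** M"
  using is_pinv_pinv[of M] by (auto simp: is_pinv_def)

lemma sym_pos_def_invertible:
  assumes "sym_pos_def M" shows "invertible M"
proof -
  have "x = 0" if "M *v x = 0" for x
    using assms that by (auto simp: sym_pos_def_def)
  then show ?thesis
    using invertible_left_inverse matrix_left_invertible_ker by blast
qed

lemma sym_pos_def_matrix_inv:
  assumes "sym_pos_def M"
  shows "sym_pos_def (matrix_inv M)" "M *v (matrix_inv M *v x) = x" "matrix_inv M *v (M *v x) = x"
proof -
  have inv: "M ** matrix_inv M = mat 1" "matrix_inv M ** M = mat 1"
    using someI_ex[OF sym_pos_def_invertible[OF assms, unfolded invertible_def]]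
    unfolding matrix_inv_def by blast+
  show a: "M *v (matrix_inv M *v x) = x" for x by (simp add: inv matrix_vector_mul_assoc)
  show "matrix_inv M *v (M *v x) = x" by (simp add: inv matrix_vector_mul_assoc)
  have "transpose (matrix_inv M) = matrix_inv M"
    using assms inv unfolding sym_pos_def_def
    by (metis matrix_mul_assoc matrix_mul_lid matrix_mul_rid matrix_transpose_mul transpose_mat)
  moreover have "0 < x \<bullet> (matrix_inv M *v x)" if "x \<noteq> 0" for x
  proof -
    have "matrix_inv M *v x \<noteq> 0" using a[of x] that by auto
    then have "0 < (matrix_inv M *v x) \<bullet> (M *v (matrix_inv M *v x))"
      using assms unfolding sym_pos_def_def by blast
    then show ?thesis by (simp add: a inner_commute)
  qed
  ultimately show "sym_pos_def (matrix_inv M)" by (simp add: sym_pos_def_def)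
qed

lemma sym_pos_def_inner_commute:
  assumes "sym_pos_def M" shows "x \<bullet> (M *v y) = y \<bullet> (M *v x)"
  using assms by (metis inner_commute inner_matrix_transpose sym_pos_def_def)

lemma sym_pos_def_nonneg: "sym_pos_def M \<Longrightarrow> 0 \<le> x \<bullet> (M *v x)"
  by (cases "x = 0") (auto simp: sym_pos_def_def less_imp_le)

lemma sym_pos_def_coercive:
  assumes "sym_pos_def (M :: real^'k^'k)"
  obtains c where "c > 0" "\<And>x. c * (norm x)\<^sup>2 \<le> x \<bullet> (M *v x)"
proof -
  have "continuous_on (sphere 0 1) (\<lambda>x. x \<bullet> (M *v x))"
    by (intro continuous_intros matrix_vector_mult_linear_continuous_on)
  moreover have "sphere (0::real^'k) 1 \<noteq> {}" by simp
  ultimately have "\<exists>z\<in>sphere 0 1. \<forall>y\<in>sphere 0 1. z \<bullet> (M *v z) \<le> y \<bullet> (M *v y)"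
    by (intro continuous_attains_inf compact_sphere)
  then obtain z where z: "z \<in> sphere 0 1"
      "\<And>y. y \<in> sphere 0 1 \<Longrightarrow> z \<bullet> (M *v z) \<le> y \<bullet> (M *v y)" by blast
  have pos: "0 < z \<bullet> (M *v z)"
    using z(1) assms unfolding sym_pos_def_def by (metis norm_zero mem_sphere_0 zero_neq_one)
  have "(z \<bullet> (M *v z)) * (norm x)\<^sup>2 \<le> x \<bullet> (M *v x)" for x
  proof (cases "x = 0")
    case False
    have "z \<bullet> (M *v z) \<le> (x /\<^sub>R norm x) \<bullet> (M *v (x /\<^sub>R norm x))"
      using z(2)[of "x /\<^sub>R norm x"] False by simp
    also have "\<dots> = (x \<bullet> (M *v x)) / (norm x)\<^sup>2"
      by (simp add: matrix_vector_mult_scaleR power2_eq_square divide_simps)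
    finally show ?thesis using False by (simp add: field_simps)
  qed simp
  with pos that show ?thesis by blast
qed

text \<open>Young's inequality for the dual pair of quadratic forms of \<open>M\<close> and its inverse.\<close>

lemma sym_pos_def_young:
  assumes "sym_pos_def M"
  shows "2 * s * (x \<bullet> d) \<le> s\<^sup>2 * (x \<bullet> (M *v x)) + d \<bullet> (matrix_inv M *v d)"
proof -
  define y where "y = s *\<^sub>R x - matrix_inv M *v d"
  have My: "M *v y = s *\<^sub>R (M *v x) - d"
    by (simp add: y_def matrix_vector_mult_diff_distrib matrix_vector_mult_scaleR
        sym_pos_def_matrix_inv(2)[OF assms])
  have "0 \<le> y \<bullet> (M *v y)" using assms by (rule sym_pos_def_nonneg)
  also have "\<dots> = s\<^sup>2 * (x \<bullet> (M *v x)) - s * (x \<bullet> d) - s * ((matrix_inv M *v d) \<bullet> (M *v x))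
      + d \<bullet> (matrix_inv M *v d)"
    unfolding My by (simp add: y_def inner_diff inner_commute power2_eq_square algebra_simps)
  also have "(matrix_inv M *v d) \<bullet> (M *v x) = x \<bullet> d"
    using sym_pos_def_inner_commute[OF assms, of "matrix_inv M *v d" x]
      sym_pos_def_matrix_inv(2)[OF assms] by simp
  finally show ?thesis by simp
qed

text \<open>For \<open>w\<close> in the range of \<open>F\<^sup>T\<close>, the vector \<open>K w\<close> with \<open>K = (F\<^sup>T)\<^sup>+ - M\<^sub>o\<^sub>p\<^sub>t\<close> is a solution \<open>d\<close> of
  \<open>F\<^sup>T d = w\<close>, and it minimises \<open>d\<^sup>T Q\<^sub>0\<^sup>-\<^sup>1 d\<close> among all solutions.\<close>

lemma terminal_minimiser:
  fixes F :: "real^'n^'m" and Q0 :: "real^'m^'m"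
  assumes Q0: "sym_pos_def Q0" and w: "transpose F *v d = w"
  obtains e where "transpose F *v e = w" "w \<bullet> (Qbar0_core F Q0 *v w) = e \<bullet> (matrix_inv Q0 *v e)"
    "e \<bullet> (matrix_inv Q0 *v e) \<le> d \<bullet> (matrix_inv Q0 *v d)"
proof -
  define S where "S = matrix_inv Q0"
  have S: "sym_pos_def S" unfolding S_def using Q0 by (rule sym_pos_def_matrix_inv)
  define P where "P = proj_ker F"
  define B where "B = P ** S ** P"
  define K where "K = pinv (transpose F) - M_opt F Q0"
  define e where "e = K *v w"
  have FP: "transpose F ** P = 0"
    unfolding P_def proj_ker_def by (simp add: matrix_diff_mult_distribs matrix_mul_assoc pinv_simps)
  have Psym: "transpose P = P"
    unfolding P_def proj_ker_def by (simp only: transpose_diff transpose_mat pinv_simps)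
  have Mopt: "M_opt F Q0 = P ** pinv B ** P ** S ** pinv (transpose F)"
    by (simp add: M_opt_def P_def B_def S_def Let_def)
  have FK: "transpose F ** K = transpose F ** pinv (transpose F)"
    unfolding K_def Mopt by (simp add: matrix_diff_mult_distribs matrix_mul_assoc FP)
  have "transpose F *v e = (transpose F ** K ** transpose F) *v d"
    unfolding e_def by (simp only: w matrix_vector_mul_assoc[symmetric])
  also have "\<dots> = w" unfolding FK pinv_simps by (rule w)
  finally have Fe: "transpose F *v e = w" .
  \<comment> \<open>\<open>B B\<^sup>+\<close> fixes \<open>P S\<close>, because the range of \<open>P S P\<close> is that of \<open>P\<close>.\<close>
  define E where "E = mat 1 - B ** pinv B"
  have Esym: "transpose E = E"
    unfolding E_def by (simp only: transpose_diff transpose_mat pinv_simps)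
  have EB: "E ** B = 0" unfolding E_def by (simp add: matrix_diff_mult_distribs pinv_simps)
  have "(P ** E) *v v = 0" for v
  proof (rule ccontr)
    assume "(P ** E) *v v \<noteq> 0"
    then have "0 < ((P ** E) *v v) \<bullet> (S *v ((P ** E) *v v))"
      using S by (auto simp: sym_pos_def_def)
    also have "\<dots> = v \<bullet> ((transpose (P ** E) ** S ** (P ** E)) *v v)"
      by (simp add: inner_matrix_transpose[of v] del: transpose_matrix_vector flip: matrix_vector_mul_assoc)
    also have "transpose (P ** E) ** S ** (P ** E) = E ** B ** E"
      by (simp add: matrix_transpose_mul Psym Esym B_def matrix_mul_assoc)
    finally show False by (simp add: EB)
  qed
  then have "P ** E = 0" by (simp add: matrix_eq)
  then have EP: "E ** P = 0"
    using matrix_transpose_mul[of P E] unfolding Esym Psym by (simp add: transpose_def vec_eq_iff)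
  have "P ** S ** K = E ** P ** S ** pinv (transpose F)"
    unfolding K_def Mopt E_def B_def by (simp add: matrix_diff_mult_distribs matrix_mul_assoc)
  then have PSK: "P ** S ** K = 0" by (simp add: EP)
  have core: "w \<bullet> (Qbar0_core F Q0 *v w) = e \<bullet> (S *v e)"
    unfolding Qbar0_core_def Let_def K_def[symmetric] S_def[symmetric] e_def
    by (simp add: inner_matrix_transpose[of w] del: transpose_matrix_vector flip: matrix_vector_mul_assoc)
  define r where "r = d - e"
  have "transpose F *v r = 0" by (simp add: r_def matrix_vector_mult_diff_distrib Fe w del: transpose_matrix_vector)
  then have Pr: "P *v r = r"
    unfolding P_def proj_ker_def
    by (simp add: matrix_vector_mult_diff_rdistrib del: transpose_matrix_vector flip: matrix_vector_mul_assoc)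
  have "r \<bullet> (S *v e) = r \<bullet> ((P ** S ** K) *v w)"
    by (simp add: inner_matrix_transpose[of r P] Psym Pr e_def del: transpose_matrix_vector flip: matrix_vector_mul_assoc)
  then have 0: "r \<bullet> (S *v e) = 0" by (simp add: PSK)
  have "d \<bullet> (S *v d) = e \<bullet> (S *v e) + r \<bullet> (S *v r)"
    using 0 sym_pos_def_inner_commute[OF S, of r e]
    by (simp add: r_def inner_diff matrix_vector_mult_diff_distrib)
  then have "e \<bullet> (S *v e) \<le> d \<bullet> (S *v d)" using sym_pos_def_nonneg[OF S, of r] by simp
  with Fe core show thesis unfolding S_def by (intro that)
qed

lemma uminus_matrix_vector_mult: "(- M) *v x = - (M *v (x :: real^'n))"
  by (simp add: matrix_vector_mult_def vec_eq_iff sum_negf)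

section \<open>Riesz representation in a complete semi-inner product space\<close>

text \<open>A positive semidefinite form on a carrier set, where \<open>lc a v b w\<close> stands for \<open>a v + b w\<close>. The
  elements are meant to be functions that represent classes modulo null sets, so no vector space
  axioms are required, vectors of length zero may be nonzero, and limits are not unique.\<close>

locale complete_form =
  fixes V :: "'v set" and lc :: "real \<Rightarrow> 'v \<Rightarrow> real \<Rightarrow> 'v \<Rightarrow> 'v" and B :: "'v \<Rightarrow> 'v \<Rightarrow> real"
  assumes lc_closed: "v \<in> V \<Longrightarrow> w \<in> V \<Longrightarrow> lc a v b w \<in> V"
    and B_commute: "v \<in> V \<Longrightarrow> w \<in> V \<Longrightarrow> B v w = B w v"
    and B_lc: "v \<in> V \<Longrightarrow> w \<in> V \<Longrightarrow> u \<in> V \<Longrightarrow> B (lc a v b w) u = a * B v u + b * B w u"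
    and B_nonneg: "v \<in> V \<Longrightarrow> 0 \<le> B v v"
    and complete: "(\<And>n. X n \<in> V) \<Longrightarrow>
      (\<And>e. e > 0 \<Longrightarrow> \<exists>N. \<forall>m\<ge>N. \<forall>n\<ge>N. B (lc 1 (X m) (-1) (X n)) (lc 1 (X m) (-1) (X n)) < e) \<Longrightarrow>
      \<exists>z\<in>V. (\<lambda>n. B (lc 1 (X n) (-1) z) (lc 1 (X n) (-1) z)) \<longlonglongrightarrow> 0"
begin

lemma B_lc_lc:
  assumes "v \<in> V" "w \<in> V"
  shows "B (lc a v b w) (lc a v b w) = a\<^sup>2 * B v v + 2 * a * b * B v w + b\<^sup>2 * B w w"
proof -
  have "B (lc a v b w) (lc a v b w) = a * B v (lc a v b w) + b * B w (lc a v b w)"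
    by (simp add: assms B_lc lc_closed)
  also have "B v (lc a v b w) = a * B v v + b * B v w"
    using B_commute[OF assms(1) lc_closed[OF assms]] B_commute[OF assms(2,1)]
    by (simp add: assms B_lc)
  also have "B w (lc a v b w) = a * B v w + b * B w w"
    using B_commute[OF assms(2) lc_closed[OF assms]] by (simp add: assms B_lc)
  finally show ?thesis by (simp add: power2_eq_square algebra_simps)
qed

lemma B_Cauchy_Schwarz:
  assumes "v \<in> V" "w \<in> V" shows "(B v w)\<^sup>2 \<le> B v v * B w w"
proof -
  have *: "0 \<le> s\<^sup>2 * B v v + 2 * s * t * B v w + t\<^sup>2 * B w w" for s t
    using B_nonneg[OF lc_closed[OF assms]] B_lc_lc[OF assms] by metis
  show ?thesis
  proof (cases "B v v = 0")
    case True
    have "B v w = 0"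
    proof (rule ccontr)
      assume "B v w \<noteq> 0"
      then have "2 * (- (B w w + 1) / (2 * B v w)) * B v w = - (B w w + 1)" by simp
      with *[of "- (B w w + 1) / (2 * B v w)" 1] True show False by simp
    qed
    then show ?thesis by (simp add: True)
  next
    case False
    then have pos: "B v v > 0" using B_nonneg[OF assms(1)] by simp
    from *[of "- B v w / B v v" 1] have "0 \<le> B w w - (B v w)\<^sup>2 / B v v"
      using False by (simp add: field_simps power2_eq_square)
    then show ?thesis using pos by (simp add: field_simps)
  qed
qed

lemma B_tendsto:
  assumes X: "\<And>n. X n \<in> V" "z \<in> V" "w \<in> V"
    and lim: "(\<lambda>n. B (lc 1 (X n) (-1) z) (lc 1 (X n) (-1) z)) \<longlonglongrightarrow> 0"
  shows "(\<lambda>n. B (X n) w) \<longlonglongrightarrow> B z w"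
proof -
  have "(\<lambda>n. (B (X n) w - B z w)\<^sup>2) \<longlonglongrightarrow> 0"
  proof (rule tendsto_sandwich[where f="\<lambda>_. 0"])
    show "(\<lambda>n. B (lc 1 (X n) (-1) z) (lc 1 (X n) (-1) z) * B w w) \<longlonglongrightarrow> 0"
      using tendsto_mult_right[OF lim, of "B w w"] by simp
    have "(B (X n) w - B z w)\<^sup>2 \<le> B (lc 1 (X n) (-1) z) (lc 1 (X n) (-1) z) * B w w" for n
      using B_Cauchy_Schwarz[OF lc_closed[of "X n" z 1 "-1"] X(3)] X by (simp add: B_lc)
    then show "\<forall>\<^sub>F n in sequentially. (B (X n) w - B z w)\<^sup>2
        \<le> B (lc 1 (X n) (-1) z) (lc 1 (X n) (-1) z) * B w w" by simp
  qed auto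
  then have "(\<lambda>n. sqrt ((B (X n) w - B z w)\<^sup>2)) \<longlonglongrightarrow> sqrt 0" by (rule tendsto_real_sqrt)
  then have "(\<lambda>n. B (X n) w - B z w) \<longlonglongrightarrow> 0" by (simp add: tendsto_rabs_zero_iff)
  then show ?thesis by (simp add: LIM_zero_iff)
qed

text \<open>\<open>G\<close> is the graph of a bounded linear functional on a subspace, which need not be closed. A
  minimising sequence of \<open>B v v - 2 c\<close> over \<open>(v, c) \<in> G\<close> is Cauchy, and its limit represents the
  functional. The limit lies in the closure of the subspace, so its squared norm is at most every
  bound of the functional, not only the given one.\<close>

theorem riesz_representation:
  fixes G :: "('v \<times> real) set"
  assumes ne: "G \<noteq> {}" and GV: "\<And>v c. (v, c) \<in> G \<Longrightarrow> v \<in> V"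
    and lin: "\<And>v c w d a b. (v, c) \<in> G \<Longrightarrow> (w, d) \<in> G \<Longrightarrow> (lc a v b w, a * c + b * d) \<in> G"
    and bd: "\<And>v c. (v, c) \<in> G \<Longrightarrow> c\<^sup>2 \<le> C * B v v" and C0: "0 \<le> C"
  shows "\<exists>z\<in>V. (\<forall>v c. (v, c) \<in> G \<longrightarrow> c = B z v) \<and>
    (\<forall>C'\<ge>0. (\<forall>v c. (v, c) \<in> G \<longrightarrow> c\<^sup>2 \<le> C' * B v v) \<longrightarrow> B z z \<le> C')"
proof -
  define E where "E = (\<lambda>(v, c). B v v - 2 * c)"
  have E_bd: "- C \<le> E p" if "p \<in> G" for p
  proof -
    obtain v c where p: "p = (v, c)" by (cases p)
    have "v \<in> V" "c\<^sup>2 \<le> C * B v v" using that GV bd p by auto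
    then have "(2 * c)\<^sup>2 \<le> (B v v + C)\<^sup>2"
      using sum_squares_ge_zero[of "B v v - C" 0] by (simp add: power2_eq_square algebra_simps)
    then have "2 * c \<le> B v v + C"
      by (rule power2_le_imp_le) (simp add: B_nonneg C0 \<open>v \<in> V\<close>)
    then show ?thesis by (simp add: p E_def)
  qed
  define m where "m = Inf (E ` G)"
  have bdd: "bdd_below (E ` G)" using E_bd by (intro bdd_belowI[of _ "-C"]) auto
  have m_le: "m \<le> E p" if "p \<in> G" for p
    unfolding m_def using that bdd by (simp add: cINF_lower)
  have "\<exists>p\<in>G. E p < m + 1 / real (Suc n)" for n
  proof -
    have "Inf (E ` G) < m + 1 / real (Suc n)" unfolding m_def by simp
    then show ?thesis using ne by (simp add: cInf_less_iff[OF _ bdd])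
  qed
  then obtain p where p: "\<And>n. p n \<in> G" "\<And>n. E (p n) < m + 1 / real (Suc n)" by metis
  define x c where "x = (\<lambda>n. fst (p n))" and "c = (\<lambda>n. snd (p n))"
  have xc: "(x n, c n) \<in> G" for n using p(1) by (simp add: x_def c_def)
  have xV: "x n \<in> V" for n using GV[OF xc] .
  have Ex: "B (x n) (x n) - 2 * c n < m + 1 / real (Suc n)" for n
    using p(2)[of n] by (simp add: E_def x_def c_def split_beta)
  \<comment> \<open>Parallelogram identity: the midpoint of two almost minimisers is in the graph.\<close>
  have gap: "B (lc 1 (x i) (-1) (x j)) (lc 1 (x i) (-1) (x j)) \<le> 2 / real (Suc i) + 2 / real (Suc j)" for i j
  proof -
    have "m \<le> E (lc (1/2) (x i) (1/2) (x j), (1/2) * c i + (1/2) * c j)"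
      by (intro m_le lin xc)
    then have "m \<le> (B (x i) (x i) + 2 * B (x i) (x j) + B (x j) (x j)) / 4 - c i - c j"
      by (simp add: E_def B_lc_lc xV power2_eq_square field_simps)
    moreover have "2 / real (Suc i) = 2 * (1 / real (Suc i))" "2 / real (Suc j) = 2 * (1 / real (Suc j))"
      by simp_all
    moreover have "(B (x i) (x i) + 2 * B (x i) (x j) + B (x j) (x j)) / 4
        = B (x i) (x i) / 4 + B (x i) (x j) / 2 + B (x j) (x j) / 4" by (simp add: field_simps)
    moreover have "B (lc 1 (x i) (-1) (x j)) (lc 1 (x i) (-1) (x j))
        = B (x i) (x i) - 2 * B (x i) (x j) + B (x j) (x j)" by (simp add: B_lc_lc xV)
    ultimately show ?thesis using Ex[of i] Ex[of j] by linarith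
  qed
  have "\<exists>z\<in>V. (\<lambda>n. B (lc 1 (x n) (-1) z) (lc 1 (x n) (-1) z)) \<longlonglongrightarrow> 0"
  proof (rule complete)
    fix e :: real assume "e > 0"
    obtain N where N: "4 / e < real N" using reals_Archimedean2 by blast
    have "B (lc 1 (x i) (-1) (x j)) (lc 1 (x i) (-1) (x j)) < e" if "i \<ge> N" "j \<ge> N" for i j
    proof -
      have "2 / real (Suc k) < e / 2" if "k \<ge> N" for k
      proof -
        have "4 / e < real (Suc k)" using N that by simp
        then show ?thesis using \<open>e > 0\<close> by (simp add: field_simps)
      qed
      from this[OF that(1)] this[OF that(2)] gap[of i j] show ?thesis by linarith
    qed
    then show "\<exists>N. \<forall>m\<ge>N. \<forall>n\<ge>N. B (lc 1 (x m) (-1) (x n)) (lc 1 (x m) (-1) (x n)) < e" by blast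
  qed (rule xV)
  then obtain z where z: "z \<in> V" "(\<lambda>n. B (lc 1 (x n) (-1) z) (lc 1 (x n) (-1) z)) \<longlonglongrightarrow> 0" by blast
  note lim = B_tendsto[OF xV z(1) _ z(2)]
  have rep: "d = B z w" if wd: "(w, d) \<in> G" for w d
  proof -
    have wV: "w \<in> V" using GV wd .
    have "0 \<le> 2 * s * (B z w - d) + s\<^sup>2 * B w w" for s
    proof (rule LIMSEQ_le_const)
      have "(\<lambda>n. 1 / real (Suc n)) \<longlonglongrightarrow> 0" using lim_1_over_n LIMSEQ_Suc by blast
      then show "(\<lambda>n. 2 * s * (B (x n) w - d) + s\<^sup>2 * B w w + 1 / real (Suc n))
          \<longlonglongrightarrow> 2 * s * (B z w - d) + s\<^sup>2 * B w w"
        using tendsto_add[OF tendsto_add[OF tendsto_mult[OF tendsto_const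
          tendsto_diff[OF lim[OF wV] tendsto_const]] tendsto_const]] by fastforce
      have "m \<le> E (lc 1 (x n) s w, 1 * c n + s * d)" for n
        by (intro m_le lin xc wd)
      then have "m \<le> B (x n) (x n) + 2 * s * B (x n) w + s\<^sup>2 * B w w - 2 * c n - 2 * s * d" for n
        by (simp add: E_def B_lc_lc xV wV algebra_simps)
      with Ex have "0 \<le> 2 * s * (B (x n) w - d) + s\<^sup>2 * B w w + 1 / real (Suc n)" for n
        by (smt (verit) right_diff_distrib)
      then show "\<exists>N. \<forall>n\<ge>N. 0 \<le> 2 * s * (B (x n) w - d) + s\<^sup>2 * B w w + 1 / real (Suc n)" by blast
    qed
    note var = this
    have b: "B w w \<ge> 0" by (rule B_nonneg[OF wV])
    define k where "k = B z w - d"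
    \<comment> \<open>The quadratic polynomial in \<open>s\<close> is nonnegative; this \<open>s\<close> avoids dividing by \<open>B w w\<close>,
      which may vanish.\<close>
    define r where "r = 1 / (B w w + 1)"
    have r: "r > 0" "r * B w w = 1 - r" using b by (simp_all add: r_def field_simps)
    have "0 \<le> 2 * (- (k * r)) * k + (- (k * r))\<^sup>2 * B w w"
      using var[of "- (k * r)"] unfolding k_def[symmetric] .
    also have "\<dots> = k\<^sup>2 * r * (r * B w w - 2)" by (simp add: power2_eq_square algebra_simps)
    also have "\<dots> = - (k\<^sup>2 * (r * (1 + r)))" unfolding r(2) by (simp add: algebra_simps)
    finally have "k\<^sup>2 * (r * (1 + r)) \<le> 0" by simp
    then have "k = 0" using r(1) by (simp add: mult_le_0_iff)
    then show ?thesis by (simp add: k_def)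
  qed
  have "B z z \<le> C'" if C': "0 \<le> C'" "\<And>v c. (v, c) \<in> G \<Longrightarrow> c\<^sup>2 \<le> C' * B v v" for C'
  proof -
    have c: "c n = B (x n) z" for n using rep[OF xc] B_commute xV z(1) by metis
    have "(\<lambda>n. B (lc 1 (x n) (-1) z) (lc 1 (x n) (-1) z) + 2 * B (x n) z - B z z)
        \<longlonglongrightarrow> 0 + 2 * B z z - B z z"
      by (intro tendsto_intros z(2) lim z(1))
    then have nn: "(\<lambda>n. B (x n) (x n)) \<longlonglongrightarrow> B z z" by (simp add: B_lc_lc xV z(1))
    have "(B z z)\<^sup>2 \<le> C' * B z z"
    proof (rule LIMSEQ_le)
      show "(\<lambda>n. (c n)\<^sup>2) \<longlonglongrightarrow> (B z z)\<^sup>2" unfolding c by (intro tendsto_intros lim z(1))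
      show "(\<lambda>n. C' * B (x n) (x n)) \<longlonglongrightarrow> C' * B z z" by (intro tendsto_intros nn)
      show "\<exists>N. \<forall>n\<ge>N. (c n)\<^sup>2 \<le> C' * B (x n) (x n)" using C'(2)[OF xc] by blast
    qed
    then show ?thesis
      using C'(1) B_nonneg[OF z(1)] by (cases "B z z = 0") (auto simp: power2_eq_square)
  qed
  with z(1) rep show ?thesis by blast
qed

text \<open>A bound on the unit ball extends by scaling. For vectors of length zero all multiples are in the
  unit ball, so the functional vanishes there.\<close>

lemma form_bound_from_unit_ball:
  assumes ve: "(v, e) \<in> G" and GV: "\<And>v c. (v, c) \<in> G \<Longrightarrow> v \<in> V"
    and lin: "\<And>v c w d a b. (v, c) \<in> G \<Longrightarrow> (w, d) \<in> G \<Longrightarrow> (lc a v b w, a * c + b * d) \<in> G"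
    and unit: "\<And>v c. (v, c) \<in> G \<Longrightarrow> B v v \<le> 1 \<Longrightarrow> c\<^sup>2 \<le> C"
  shows "e\<^sup>2 \<le> C * B v v"
proof -
  have vV: "v \<in> V" using GV ve .
  have scaled: "s\<^sup>2 * e\<^sup>2 \<le> C" if "s\<^sup>2 * B v v \<le> 1" for s
    using unit[OF lin[OF ve ve, of s 0]] that by (simp add: B_lc_lc vV power_mult_distrib)
  show ?thesis
  proof (cases "B v v = 0")
    case True
    have "e = 0"
    proof (rule ccontr)
      assume "e \<noteq> 0"
      then have "(sqrt (\<bar>C\<bar> + 1) / e)\<^sup>2 * e\<^sup>2 = \<bar>C\<bar> + 1" by (simp add: power_divide)
      with scaled[of "sqrt (\<bar>C\<bar> + 1) / e"] True show False by simp
    qed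
    with True show ?thesis by simp
  next
    case False
    then have pos: "B v v > 0" using B_nonneg[OF vV] by simp
    then have "(1 / sqrt (B v v))\<^sup>2 * B v v = 1" by (simp add: power_divide)
    then have "(1 / sqrt (B v v))\<^sup>2 * e\<^sup>2 \<le> C" using scaled by simp
    then show ?thesis using pos by (simp add: power_divide field_simps)
  qed
qed

end

section \<open>Square integrable functions on an interval\<close>

lemma AE_lebesgue_on_iff_negligible:
  assumes "J \<in> sets lebesgue"
  shows "(AE t in lebesgue_on J. P t) \<longleftrightarrow> negligible {t \<in> J. \<not> P t}"
proof -
  have "(AE t in lebesgue_on J. P t) \<longleftrightarrow> (AE t in lebesgue. t \<in> J \<longrightarrow> P t)"
    using assms by (simp add: AE_restrict_space_iff)
  also have "\<dots> \<longleftrightarrow> {t \<in> J. \<not> P t} \<in> null_sets lebesgue"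
  proof
    assume "AE t in lebesgue. t \<in> J \<longrightarrow> P t"
    then obtain N where N: "N \<in> null_sets lebesgue" "{t. \<not> (t \<in> J \<longrightarrow> P t)} \<subseteq> N"
      by (auto simp: eventually_ae_filter)
    have "negligible N" using N(1) by (simp add: negligible_iff_null_sets)
    moreover have "{t \<in> J. \<not> P t} \<subseteq> N" using N(2) by auto
    ultimately have "negligible {t \<in> J. \<not> P t}" by (rule negligible_subset)
    then show "{t \<in> J. \<not> P t} \<in> null_sets lebesgue" by (simp add: negligible_iff_null_sets)
  next
    assume "{t \<in> J. \<not> P t} \<in> null_sets lebesgue"
    then show "AE t in lebesgue. t \<in> J \<longrightarrow> P t"
      by (auto simp: eventually_ae_filter intro!: bexI[of _ "{t \<in> J. \<not> P t}"])
  qed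
  finally show ?thesis by (simp add: negligible_iff_null_sets)
qed

lemma AE_lebesgue_on_subset:
  assumes "AE t in lebesgue_on J. P t" "K \<subseteq> J" "J \<in> sets lebesgue" "K \<in> sets lebesgue"
  shows "AE t in lebesgue_on K. P t"
  using assms negligible_subset[of "{t \<in> J. \<not> P t}" "{t \<in> K. \<not> P t}"]
  by (auto simp: AE_lebesgue_on_iff_negligible)

text \<open>Reflections and translations of the line: \<open>t \<mapsto> c + s t\<close> with \<open>s = 1\<close> or \<open>s = -1\<close>.\<close>

lemma AE_lebesgue_on_affine:
  fixes c s :: real
  assumes P: "AE t in lebesgue_on J'. P t" and s: "\<bar>s\<bar> = 1" and J: "\<And>t. c + s * t \<in> J' \<longleftrightarrow> t \<in> J"
    and m: "J \<in> sets lebesgue" "J' \<in> sets lebesgue"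
  shows "AE t in lebesgue_on J. P (c + s * t)"
proof -
  have ss: "s * s = 1" using s by (auto simp: abs_if split: if_splits)
  have N: "negligible {t \<in> J'. \<not> P t}" using P m by (simp add: AE_lebesgue_on_iff_negligible)
  have "negligible ((\<lambda>x. s * (x - c)) ` {t \<in> J'. \<not> P t})"
    by (rule negligible_differentiable_image_negligible[OF _ N])
       (auto intro!: derivative_intros differentiable_at_imp_differentiable_on)
  moreover have "{t \<in> J. \<not> P (c + s * t)} \<subseteq> (\<lambda>x. s * (x - c)) ` {t \<in> J'. \<not> P t}"
  proof
    fix t assume "t \<in> {t \<in> J. \<not> P (c + s * t)}"
    then show "t \<in> (\<lambda>x. s * (x - c)) ` {t \<in> J'. \<not> P t}"
      using J[of t] ss by (intro image_eqI[of _ _ "c + s * t"]) (auto simp: mult.assoc[symmetric])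
  qed
  ultimately show ?thesis using m by (simp add: AE_lebesgue_on_iff_negligible negligible_subset)
qed

lemma integral_lebesgue_on_affine:
  fixes c s :: real and g :: "real \<Rightarrow> 'a::euclidean_space"
  assumes s: "\<bar>s\<bar> = 1" and J: "\<And>t. c + s * t \<in> J' \<longleftrightarrow> t \<in> J"
    and m: "J \<in> sets lebesgue" "J' \<in> sets lebesgue"
  shows "(LINT t|lebesgue_on J. g (c + s * t)) = (LINT t|lebesgue_on J'. g t)"
    and "integrable (lebesgue_on J) (\<lambda>t. g (c + s * t)) \<longleftrightarrow> integrable (lebesgue_on J') g"
    and "g \<in> borel_measurable (lebesgue_on J') \<Longrightarrow> (\<lambda>t. g (c + s * t)) \<in> borel_measurable (lebesgue_on J)"
proof -
  have s0: "s \<noteq> 0" using s by auto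
  define G where "G = (\<lambda>t. if t \<in> J' then g t else 0)"
  have G: "G (c + s * t) = (if t \<in> J then g (c + s * t) else 0)" for t by (simp add: G_def J)
  show "(LINT t|lebesgue_on J. g (c + s * t)) = (LINT t|lebesgue_on J'. g t)"
    using lebesgue_integral_real_affine[OF s0, of G c] unfolding G s
    by (simp add: G_def Lebesgue_Measure.integral_restrict_UNIV[OF m(1)] Lebesgue_Measure.integral_restrict_UNIV[OF m(2)])
  show "integrable (lebesgue_on J) (\<lambda>t. g (c + s * t)) \<longleftrightarrow> integrable (lebesgue_on J') g"
    using lebesgue_integrable_real_affine_iff[OF s0, of G c] unfolding G
    by (simp add: G_def Lebesgue_Measure.integrable_restrict_UNIV[OF m(1)] Lebesgue_Measure.integrable_restrict_UNIV[OF m(2)])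
  assume "g \<in> borel_measurable (lebesgue_on J')"
  then have "G \<in> borel_measurable lebesgue" unfolding G_def by (simp add: borel_measurable_if m)
  then have "(\<lambda>t. G (c + s *\<^sub>R t)) \<in> borel_measurable lebesgue" by (rule borel_measurable_affine[OF _ s0])
  then have "(\<lambda>t. if t \<in> J then g (c + s * t) else 0) \<in> borel_measurable lebesgue"
    unfolding G real_scaleR_def .
  then show "(\<lambda>t. g (c + s * t)) \<in> borel_measurable (lebesgue_on J)" by (rule borel_measurable_if_D)
qed

lemma L2_affine:
  fixes c s :: real
  assumes "v \<in> L2 J'" and s: "\<bar>s\<bar> = 1" and J: "\<And>t. c + s * t \<in> J' \<longleftrightarrow> t \<in> J"
    and m: "J \<in> sets lebesgue" "J' \<in> sets lebesgue"
  shows "(\<lambda>t. v (c + s * t)) \<in> L2 J"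
  using assms(1) integral_lebesgue_on_affine(2)[OF s J m, of "\<lambda>t. (norm (v t))\<^sup>2"]
    integral_lebesgue_on_affine(3)[OF s J m, of v]
  by (simp add: L2_def)

lemma L2_inner_integrable:
  assumes "u \<in> L2 J" "v \<in> L2 J"
  shows "integrable (lebesgue_on J) (\<lambda>t. u t \<bullet> v t)"
proof (rule Bochner_Integration.integrable_bound)
  show "integrable (lebesgue_on J) (\<lambda>t. (norm (u t))\<^sup>2 + (norm (v t))\<^sup>2)"
    using assms by (auto simp: L2_def)
  show "(\<lambda>t. u t \<bullet> v t) \<in> borel_measurable (lebesgue_on J)"
    using assms by (auto simp: L2_def)
  have "\<bar>x \<bullet> y\<bar> \<le> (norm x)\<^sup>2 + (norm y)\<^sup>2" for x y :: 'a
    using Cauchy_Schwarz_ineq2[of x y] sum_squares_bound[of "norm x" "norm y"]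
      mult_nonneg_nonneg[of "norm x" "norm y"] by (simp; linarith)
  then show "AE t in lebesgue_on J. norm (u t \<bullet> v t) \<le> norm ((norm (u t))\<^sup>2 + (norm (v t))\<^sup>2)"
    by simp
qed

lemma L2_lincomb:
  assumes "u \<in> L2 J" "v \<in> L2 J"
  shows "(\<lambda>t. a *\<^sub>R u t + b *\<^sub>R v t) \<in> L2 J"
proof -
  have "(norm (a *\<^sub>R u t + b *\<^sub>R v t))\<^sup>2 = a\<^sup>2 * (norm (u t))\<^sup>2 + 2 * a * b * (u t \<bullet> v t) + b\<^sup>2 * (norm (v t))\<^sup>2" for t
    unfolding power2_norm_eq_inner
    by (simp add: inner_add_left inner_add_right inner_commute[of "v t" "u t"] algebra_simps power2_eq_square)
  then show ?thesis using assms L2_inner_integrable[OF assms] by (auto simp: L2_def)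
qed

lemma L2_add: "u \<in> L2 J \<Longrightarrow> v \<in> L2 J \<Longrightarrow> (\<lambda>t. u t + v t) \<in> L2 J"
  using L2_lincomb[of u J v 1 1] by simp

lemma L2_diff: "u \<in> L2 J \<Longrightarrow> v \<in> L2 J \<Longrightarrow> (\<lambda>t. u t - v t) \<in> L2 J"
  using L2_lincomb[of u J v 1 "-1"] by simp

lemma L2_linear:
  assumes "v \<in> L2 J" "bounded_linear f"
  shows "(\<lambda>t. f (v t)) \<in> L2 J"
proof -
  interpret bounded_linear f by fact
  obtain K where K: "\<And>x. norm (f x) \<le> norm x * K" "K \<ge> 0" using nonneg_bounded by blast
  have m: "(\<lambda>t. f (v t)) \<in> borel_measurable (lebesgue_on J)"
    using assms(1) borel_measurable_continuous_onI[OF linear_continuous_on[OF assms(2), of UNIV]]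
    by (auto simp: L2_def intro: measurable_compose)
  have "integrable (lebesgue_on J) (\<lambda>t. (norm (f (v t)))\<^sup>2)"
  proof (rule Bochner_Integration.integrable_bound)
    show "integrable (lebesgue_on J) (\<lambda>t. K\<^sup>2 * (norm (v t))\<^sup>2)" using assms by (auto simp: L2_def)
    show "AE t in lebesgue_on J. norm ((norm (f (v t)))\<^sup>2) \<le> norm (K\<^sup>2 * (norm (v t))\<^sup>2)"
      using K by (auto intro!: AE_I2 simp: power_mult_distrib[symmetric] power_mono mult.commute)
  qed (use m in measurable)
  with m show ?thesis by (simp add: L2_def)
qed

lemma L2_matrix: "v \<in> L2 J \<Longrightarrow> (\<lambda>t. (M :: real^'n^'m) *v v t) \<in> L2 J"
  by (rule L2_linear) (simp_all add: matrix_vector_mul_bounded_linear)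

lemma L2_integrable:
  fixes v :: "real \<Rightarrow> 'a::euclidean_space"
  assumes "v \<in> L2 {a..b}" shows "integrable (lebesgue_on {a..b}) v"
proof (rule Bochner_Integration.integrable_bound)
  interpret finite_measure "lebesgue_on {a..b}" by (rule finite_measure_lebesgue_on) simp
  show "integrable (lebesgue_on {a..b}) (\<lambda>t. 1 + (norm (v t))\<^sup>2)" using assms by (auto simp: L2_def)
  have "x \<le> 1 + x\<^sup>2" for x :: real
    using zero_le_square[of "x - 1"] zero_le_square[of x]
    unfolding left_diff_distrib right_diff_distrib power2_eq_square by linarith
  then show "AE t in lebesgue_on {a..b}. norm (v t) \<le> norm (1 + (norm (v t))\<^sup>2)" by simp
qed (use assms in \<open>simp add: L2_def\<close>)

lemma L2_subset:
  fixes v :: "real \<Rightarrow> 'a::euclidean_space"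
  assumes "v \<in> L2 {a..b}" "{c..d} \<subseteq> {a..b}" shows "v \<in> L2 {c..d}"
proof -
  have "v \<in> borel_measurable (lebesgue_on {c..d})"
    by (rule measurable_restrict_mono[OF _ assms(2)]) (use assms(1) in \<open>simp add: L2_def\<close>)
  moreover have "integrable (lebesgue_on {c..d}) (\<lambda>t. (norm (v t))\<^sup>2)"
    by (rule integrable_subinterval[OF _ assms(2)]) (use assms(1) in \<open>simp add: L2_def\<close>)
  ultimately show ?thesis by (simp add: L2_def)
qed

lemma L2_loc_eq_L2:
  fixes v :: "real \<Rightarrow> 'a::euclidean_space"
  shows "v \<in> L2_loc {a..b} \<longleftrightarrow> v \<in> L2 {a..b}"
  unfolding L2_loc_def using L2_subset by blast

lemma L2_continuous:
  fixes v :: "real \<Rightarrow> 'a::euclidean_space"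
  assumes "continuous_on {a..b} v" shows "v \<in> L2 {a..b}"
proof -
  have "continuous_on {a..b} (\<lambda>t. (norm (v t))\<^sup>2)" by (intro continuous_intros assms)
  then show ?thesis
    using assms by (simp add: L2_def continuous_imp_measurable_on_sets_lebesgue continuous_imp_integrable_real)
qed

lemma L2_0: "(\<lambda>t. 0) \<in> L2 J"
  by (simp add: L2_def)

lemma L2_extend:
  fixes v :: "real \<Rightarrow> 'a::euclidean_space"
  assumes v: "v \<in> L2 K" and K: "K \<subseteq> J" "K \<in> sets lebesgue" "J \<in> sets lebesgue"
  shows "(\<lambda>t. if t \<in> K then v t else 0) \<in> L2 J"
proof -
  have m: "(\<lambda>t. if t \<in> K then v t else 0) \<in> borel_measurable (lebesgue_on J)"
    using v K by (subst borel_measurable_if_lebesgue_on) (auto simp: L2_def)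
  have "integrable lebesgue (\<lambda>t. if t \<in> K then (norm (v t))\<^sup>2 else 0)"
    using v by (subst Lebesgue_Measure.integrable_restrict_UNIV[OF K(2)]) (simp add: L2_def)
  also have "(\<lambda>t. if t \<in> K then (norm (v t))\<^sup>2 else 0)
      = (\<lambda>t. if t \<in> J then (norm (if t \<in> K then v t else 0))\<^sup>2 else 0)"
    using K(1) by (auto simp: fun_eq_iff)
  finally have "integrable (lebesgue_on J) (\<lambda>t. (norm (if t \<in> K then v t else 0))\<^sup>2)"
    by (subst (asm) Lebesgue_Measure.integrable_restrict_UNIV[OF K(3)])
  with m show ?thesis by (simp add: L2_def)
qed

lemma L2_cong:
  assumes "v \<in> L2 J" "\<And>t. t \<in> J \<Longrightarrow> w t = v t"
  shows "w \<in> L2 J"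
proof -
  have "w \<in> borel_measurable (lebesgue_on J)"
    using assms by (subst measurable_lebesgue_cong[of J w v]) (auto simp: L2_def)
  moreover have "integrable (lebesgue_on J) (\<lambda>t. (norm (w t))\<^sup>2)"
    using assms by (subst Bochner_Integration.integrable_cong[OF refl, of _ _ "\<lambda>t. (norm (v t))\<^sup>2"]) (auto simp: L2_def)
  ultimately show ?thesis by (simp add: L2_def)
qed

lemma L2_shift:
  fixes v :: "real \<Rightarrow> 'a::euclidean_space"
  assumes "v \<in> L2 {0..T}" "0 \<le> a" "a \<le> T"
  shows "(\<lambda>s. v (a + s)) \<in> L2 {0..T - a}"
proof -
  have "(\<lambda>s. v (a + 1 * s)) \<in> L2 {0..T - a}"
    by (rule L2_affine[OF L2_subset[OF assms(1), of a T]]) (use assms in auto)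
  then show ?thesis by simp
qed

text \<open>Concatenation of functions on \<open>[0,a]\<close> and \<open>[0,b]\<close> to a function on \<open>[0,a+b]\<close>,
  with value \<open>v(0)\<close> at \<open>a\<close>, so that \<open>t \<mapsto> concat_at a u v (a + t)\<close> is exactly \<open>v\<close> for \<open>t \<ge> 0\<close>.\<close>

definition concat_at :: "real \<Rightarrow> (real \<Rightarrow> 'a) \<Rightarrow> (real \<Rightarrow> 'a) \<Rightarrow> real \<Rightarrow> 'a" where
  "concat_at a u v t = (if t < a then u t else v (t - a))"

lemma L2_concat_at:
  fixes u v :: "real \<Rightarrow> 'a::euclidean_space"
  assumes u: "u \<in> L2 {0..a}" and v: "v \<in> L2 {0..b}" and ab: "0 \<le> a" "0 \<le> b"
  shows "concat_at a u v \<in> L2 {0..a + b}"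
proof -
  have 1: "(\<lambda>t. if t \<in> {0..a} then u t else 0) \<in> L2 {0..a + b}"
    using u ab by (intro L2_extend) auto
  have "(\<lambda>t. v (- a + 1 * t)) \<in> L2 {a..a + b}"
    by (rule L2_affine[OF v]) auto
  then have "(\<lambda>t. v (t - a)) \<in> L2 {a..a + b}" by simp
  then have 2: "(\<lambda>t. if t \<in> {a..a + b} then v (t - a) else 0) \<in> L2 {0..a + b}"
    using ab by (intro L2_extend) auto
  have "(\<lambda>t. u t) \<in> L2 {a..a}" using L2_continuous[of a a u] by simp
  then have 3: "(\<lambda>t. if t \<in> {a..a} then u t else 0) \<in> L2 {0..a + b}"
    using ab by (intro L2_extend) auto
  show ?thesis
    by (rule L2_cong[OF L2_diff[OF L2_add[OF 1 2] 3]]) (auto simp: concat_at_def)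
qed

lemma L2_const: "(\<lambda>t. c) \<in> L2 {a..b :: real}"
  by (rule L2_continuous[OF continuous_on_const])

lemma reflect_interval: "(T + (-1) * t \<in> {0..T}) = (t \<in> {0..T})" for T t :: real
  by auto

lemma L2_reflect:
  fixes v :: "real \<Rightarrow> 'a::euclidean_space"
  shows "v \<in> L2 {0..T} \<Longrightarrow> (\<lambda>t. v (T - t)) \<in> L2 {0..T}"
  using L2_affine[where v=v and s="-1" and c=T, OF _ _ reflect_interval] by simp

lemma AE_reflect:
  "AE t in lebesgue_on {0..T}. P t \<Longrightarrow> AE t in lebesgue_on {0..T}. P (T - t)" for T :: real
  using AE_lebesgue_on_affine[where P=P and s="-1" and c=T, OF _ _ reflect_interval] by simp

lemma integral_reflect:
  fixes g :: "real \<Rightarrow> 'a::euclidean_space"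
  shows "(LINT t|lebesgue_on {0..T}. g (T - t)) = (LINT t|lebesgue_on {0..T}. g t)"
  using integral_lebesgue_on_affine(1)[where g=g and s="-1" and c=T, OF _ reflect_interval] by simp

text \<open>Completeness of \<open>L\<^sup>2\<close>: an almost everywhere convergent subsequence gives the limit, and Fatou's
  lemma gives the convergence in norm.\<close>

lemma L2_complete:
  fixes X :: "nat \<Rightarrow> real \<Rightarrow> 'a::euclidean_space"
  assumes X: "\<And>n. X n \<in> L2 {a..b}"
    and Cauchy: "\<And>e. e > 0 \<Longrightarrow> \<exists>N. \<forall>m\<ge>N. \<forall>n\<ge>N. (LINT t|lebesgue_on {a..b}. (norm (X m t - X n t))\<^sup>2) < e"
  obtains Z where "Z \<in> L2 {a..b}" "(\<lambda>n. LINT t|lebesgue_on {a..b}. (norm (X n t - Z t))\<^sup>2) \<longlonglongrightarrow> 0"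
proof -
  define M where "M = lebesgue_on {a..b}"
  interpret finite_measure M unfolding M_def by (rule finite_measure_lebesgue_on) simp
  have int2: "integrable M (\<lambda>t. (norm (X m t - X n t))\<^sup>2)" for m n
    using L2_diff[OF X X, of m n] by (simp add: L2_def M_def)
  have [measurable]: "X n \<in> borel_measurable M" for n using X by (simp add: L2_def M_def)
  have int1: "integrable M (X n)" for n unfolding M_def using X by (rule L2_integrable)
  have Cauchy1: "\<exists>N. \<forall>i\<ge>N. \<forall>j\<ge>N. LINT x|M. norm (X i x - X j x) < e" if "e > 0" for e
  proof -
    define k where "k = e / (2 * (measure M (space M) + 1))"
    have k: "k > 0" using that by (simp add: k_def add_nonneg_pos)
    have kM: "k * measure M (space M) \<le> e / 2"
    proof -
      have "k * measure M (space M) \<le> k * (measure M (space M) + 1)" using k by simp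
      also have "\<dots> = e / 2"
      proof -
        have "measure M (space M) + 1 \<noteq> 0" using measure_nonneg[of M "space M"] by linarith
        then show ?thesis unfolding k_def by (metis nonzero_mult_divide_mult_cancel_right2 times_divide_eq_left mult.commute)
      qed
      finally show ?thesis .
    qed
    obtain N where N: "\<And>m n. m \<ge> N \<Longrightarrow> n \<ge> N \<Longrightarrow> (LINT t|M. (norm (X m t - X n t))\<^sup>2) < k * e / 2"
      using Cauchy[of "k * e / 2"] mult_pos_pos[OF k \<open>e > 0\<close>] unfolding M_def by (meson half_gt_zero)
    have "(LINT x|M. norm (X i x - X j x)) < e" if ij: "i \<ge> N" "j \<ge> N" for i j
    proof -
      have "x \<le> k + x\<^sup>2 / k" for x :: real
      proof -
        have "k * x \<le> k * k + x * x"
          using zero_le_square[of "x - k"] zero_le_square[of x] zero_le_square[of k] mult.commute[of x k]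
          unfolding left_diff_distrib right_diff_distrib by linarith
        then show ?thesis using k by (simp add: field_simps power2_eq_square)
      qed
      then have "(LINT x|M. norm (X i x - X j x)) \<le> (LINT x|M. k + (norm (X i x - X j x))\<^sup>2 / k)"
        using int1 int2 by (intro integral_mono) auto
      also have "\<dots> = k * measure M (space M) + (LINT x|M. (norm (X i x - X j x))\<^sup>2) / k"
        using int2 by simp
      also have "\<dots> < e / 2 + (k * e / 2) / k"
        using kM N[OF ij] k by (intro add_le_less_mono divide_strict_right_mono) auto
      finally show ?thesis using k by simp
    qed
    then show ?thesis by blast
  qed
  obtain r where r: "strict_mono r" "AE x in M. Cauchy (\<lambda>i. X (r i) x)"
    using cauchy_L1_AE_cauchy_subseq[OF int1 Cauchy1] by blast
  define Z where "Z = (\<lambda>x. lim (\<lambda>i. X (r i) x))"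
  have [measurable]: "Z \<in> borel_measurable M" unfolding Z_def by measurable
  have conv: "AE x in M. (\<lambda>i. X (r i) x) \<longlonglongrightarrow> Z x"
    using r(2) by eventually_elim (simp add: Z_def Cauchy_convergent convergent_LIMSEQ_iff[symmetric])
  have fatou: "(\<integral>\<^sup>+ t. ennreal ((norm (X n t - Z t))\<^sup>2) \<partial>M) \<le> ennreal e"
    if N: "\<And>m n. m \<ge> N \<Longrightarrow> n \<ge> N \<Longrightarrow> (LINT t|M. (norm (X m t - X n t))\<^sup>2) < e" and n: "n \<ge> N" for N n e
  proof -
    have "(\<integral>\<^sup>+ t. ennreal ((norm (X n t - Z t))\<^sup>2) \<partial>M)
        = (\<integral>\<^sup>+ t. liminf (\<lambda>i. ennreal ((norm (X n t - X (r i) t))\<^sup>2)) \<partial>M)"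
    proof (rule nn_integral_cong_AE)
      show "AE t in M. ennreal ((norm (X n t - Z t))\<^sup>2) = liminf (\<lambda>i. ennreal ((norm (X n t - X (r i) t))\<^sup>2))"
        using conv
      proof eventually_elim
        case (elim t)
        have "(\<lambda>i. ennreal ((norm (X n t - X (r i) t))\<^sup>2)) \<longlonglongrightarrow> ennreal ((norm (X n t - Z t))\<^sup>2)"
          by (intro tendsto_ennrealI tendsto_intros elim)
        then show ?case by (rule lim_imp_Liminf[OF sequentially_bot, symmetric])
      qed
    qed
    also have "\<dots> \<le> liminf (\<lambda>i. \<integral>\<^sup>+ t. ennreal ((norm (X n t - X (r i) t))\<^sup>2) \<partial>M)"
      by (rule nn_integral_liminf) measurable
    also have "\<dots> \<le> liminf (\<lambda>i. ennreal e)"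
    proof (rule Liminf_mono)
      have "(\<integral>\<^sup>+ t. ennreal ((norm (X n t - X (r i) t))\<^sup>2) \<partial>M) \<le> ennreal e" if "i \<ge> N" for i
      proof -
        have "r i \<ge> N" using seq_suble[OF r(1), of i] that by simp
        then show ?thesis using N[OF n, of "r i"] int2 by (simp add: nn_integral_eq_integral ennreal_leI)
      qed
      then show "\<forall>\<^sub>F i in sequentially. (\<integral>\<^sup>+ t. ennreal ((norm (X n t - X (r i) t))\<^sup>2) \<partial>M) \<le> ennreal e"
        by (auto simp: eventually_sequentially)
    qed
    finally show ?thesis by (simp add: Liminf_const)
  qed
  have diffL2: "(\<lambda>t. X n t - Z t) \<in> L2 {a..b} \<and> (LINT t|M. (norm (X n t - Z t))\<^sup>2) \<le> e"
    if N: "\<And>m n. m \<ge> N \<Longrightarrow> n \<ge> N \<Longrightarrow> (LINT t|M. (norm (X m t - X n t))\<^sup>2) < e" and n: "n \<ge> N" and "e > 0" for N n e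
  proof -
    note f = fatou[OF N n]
    have i: "integrable M (\<lambda>t. (norm (X n t - Z t))\<^sup>2)"
      using f by (intro integrableI_bounded) (auto simp: less_top[symmetric] top_unique)
    moreover have "(LINT t|M. (norm (X n t - Z t))\<^sup>2) \<le> e"
      using f \<open>e > 0\<close> i by (simp add: nn_integral_eq_integral)
    ultimately show ?thesis by (simp add: L2_def M_def[symmetric])
  qed
  obtain N where N: "\<And>m n. m \<ge> N \<Longrightarrow> n \<ge> N \<Longrightarrow> (LINT t|M. (norm (X m t - X n t))\<^sup>2) < 1"
    using Cauchy[of 1] unfolding M_def by (meson zero_less_one)
  have "(\<lambda>t. X N t - Z t) \<in> L2 {a..b}" using diffL2[of N 1 N] N by simp
  from L2_diff[OF X[of N] this] have "Z \<in> L2 {a..b}" by simp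
  moreover have "(\<lambda>n. LINT t|M. (norm (X n t - Z t))\<^sup>2) \<longlonglongrightarrow> 0"
  proof (rule LIMSEQ_I)
    fix e :: real assume "e > 0"
    obtain N where N: "\<And>m n. m \<ge> N \<Longrightarrow> n \<ge> N \<Longrightarrow> (LINT t|M. (norm (X m t - X n t))\<^sup>2) < e / 2"
      using Cauchy[of "e / 2"] \<open>e > 0\<close> unfolding M_def by (meson half_gt_zero)
    have "norm ((LINT t|M. (norm (X n t - Z t))\<^sup>2) - 0) < e" if "n \<ge> N" for n
    proof -
      have "0 \<le> (LINT t|M. (norm (X n t - Z t))\<^sup>2)" by simp
      then show ?thesis using diffL2[of N "e/2" n] N that \<open>e > 0\<close> by simp
    qed
    then show "\<exists>no. \<forall>n\<ge>no. norm ((LINT t|M. (norm (X n t - Z t))\<^sup>2) - 0) < e" by blast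
  qed
  ultimately show thesis using that unfolding M_def by blast
qed

lemma weighted_integral_lincomb:
  fixes W :: "real^'k^'k"
  assumes "u \<in> L2 J" "v \<in> L2 J" "w \<in> L2 J"
  shows "(LINT t|lebesgue_on J. (a *\<^sub>R u t + b *\<^sub>R v t) \<bullet> (W *v w t)) =
    a * (LINT t|lebesgue_on J. u t \<bullet> (W *v w t)) + b * (LINT t|lebesgue_on J. v t \<bullet> (W *v w t))"
proof -
  have "integrable (lebesgue_on J) (\<lambda>t. u t \<bullet> (W *v w t))" "integrable (lebesgue_on J) (\<lambda>t. v t \<bullet> (W *v w t))"
    using assms by (auto intro!: L2_inner_integrable L2_matrix)
  then show ?thesis by (simp add: inner_add_left)
qed

text \<open>A positive definite weight gives an equivalent norm.\<close>

lemma L2_weighted_complete: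
  fixes W :: "real^'k^'k" and X :: "nat \<Rightarrow> real \<Rightarrow> real^'k"
  assumes W: "sym_pos_def W" and X: "\<And>n. X n \<in> L2 {a..b}"
    and Cauchy: "\<And>e. e > 0 \<Longrightarrow> \<exists>N. \<forall>m\<ge>N. \<forall>n\<ge>N.
      (LINT t|lebesgue_on {a..b}. (X m t - X n t) \<bullet> (W *v (X m t - X n t))) < e"
  obtains Z where "Z \<in> L2 {a..b}"
    "(\<lambda>n. LINT t|lebesgue_on {a..b}. (X n t - Z t) \<bullet> (W *v (X n t - Z t))) \<longlonglongrightarrow> 0"
proof -
  obtain k where k: "k > 0" "\<And>x. k * (norm x)\<^sup>2 \<le> x \<bullet> (W *v x)" using sym_pos_def_coercive[OF W] by blast
  obtain K where K: "\<And>x. norm (W *v x) \<le> norm x * K"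
    using bounded_linear.bounded[OF matrix_vector_mul_bounded_linear[of W]] by blast
  have W2: "integrable (lebesgue_on {a..b}) (\<lambda>t. v t \<bullet> (W *v v t))"
    and N2: "integrable (lebesgue_on {a..b}) (\<lambda>t. (norm (v t))\<^sup>2)" if "v \<in> L2 {a..b}" for v
    using L2_inner_integrable[OF that L2_matrix[OF that]] that by (auto simp: L2_def)
  have lower: "k * (LINT t|lebesgue_on {a..b}. (norm (v t))\<^sup>2) \<le> (LINT t|lebesgue_on {a..b}. v t \<bullet> (W *v v t))"
    if "v \<in> L2 {a..b}" for v
  proof -
    have "(LINT t|lebesgue_on {a..b}. k * (norm (v t))\<^sup>2) \<le> (LINT t|lebesgue_on {a..b}. v t \<bullet> (W *v v t))"
      using W2[OF that] N2[OF that] k(2) by (intro integral_mono) auto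
    then show ?thesis by simp
  qed
  have upper: "(LINT t|lebesgue_on {a..b}. v t \<bullet> (W *v v t)) \<le> K * (LINT t|lebesgue_on {a..b}. (norm (v t))\<^sup>2)"
    if "v \<in> L2 {a..b}" for v
  proof -
    have "x \<bullet> (W *v x) \<le> K * (norm x)\<^sup>2" for x
    proof -
      have "x \<bullet> (W *v x) \<le> norm x * norm (W *v x)" by (rule norm_cauchy_schwarz)
      also have "\<dots> \<le> norm x * (norm x * K)" by (intro mult_left_mono K) simp
      finally show ?thesis by (simp add: power2_eq_square mult_ac)
    qed
    then have "(LINT t|lebesgue_on {a..b}. v t \<bullet> (W *v v t)) \<le> (LINT t|lebesgue_on {a..b}. K * (norm (v t))\<^sup>2)"
      using W2[OF that] N2[OF that] by (intro integral_mono) auto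
    then show ?thesis by simp
  qed
  have "\<exists>N. \<forall>m\<ge>N. \<forall>n\<ge>N. (LINT t|lebesgue_on {a..b}. (norm (X m t - X n t))\<^sup>2) < e" if "e > 0" for e
  proof -
    obtain N where N: "\<And>m n. m \<ge> N \<Longrightarrow> n \<ge> N \<Longrightarrow>
        (LINT t|lebesgue_on {a..b}. (X m t - X n t) \<bullet> (W *v (X m t - X n t))) < k * e"
      using Cauchy[OF mult_pos_pos[OF k(1) \<open>e > 0\<close>]] by blast
    have "(LINT t|lebesgue_on {a..b}. (norm (X m t - X n t))\<^sup>2) < e" if "m \<ge> N" "n \<ge> N" for m n
    proof -
      have "k * (LINT t|lebesgue_on {a..b}. (norm (X m t - X n t))\<^sup>2) < k * e"
        using lower[OF L2_diff[OF X X], of m n] N[OF that] by linarith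
      then show ?thesis using k(1) by simp
    qed
    then show ?thesis by blast
  qed
  then obtain Z where Z: "Z \<in> L2 {a..b}" "(\<lambda>n. LINT t|lebesgue_on {a..b}. (norm (X n t - Z t))\<^sup>2) \<longlonglongrightarrow> 0"
    using L2_complete[of X a b, OF X] by blast
  have "(\<lambda>n. LINT t|lebesgue_on {a..b}. (X n t - Z t) \<bullet> (W *v (X n t - Z t))) \<longlonglongrightarrow> 0"
  proof (rule tendsto_sandwich[where f = "\<lambda>_. 0"])
    show "(\<lambda>n. K * (LINT t|lebesgue_on {a..b}. (norm (X n t - Z t))\<^sup>2)) \<longlonglongrightarrow> 0"
      using tendsto_mult_left[OF Z(2), of K] by simp
    show "\<forall>\<^sub>F n in sequentially. (LINT t|lebesgue_on {a..b}. (X n t - Z t) \<bullet> (W *v (X n t - Z t)))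
        \<le> K * (LINT t|lebesgue_on {a..b}. (norm (X n t - Z t))\<^sup>2)"
      using upper[OF L2_diff[OF X Z(1)]] by simp
    show "\<forall>\<^sub>F n in sequentially. 0 \<le> (LINT t|lebesgue_on {a..b}. (X n t - Z t) \<bullet> (W *v (X n t - Z t)))"
      using sym_pos_def_nonneg[OF W] by simp
  qed simp
  with Z(1) that show thesis by blast
qed

lemma weighted_complete_vec:
  fixes W :: "real^'k^'k" and x :: "nat \<Rightarrow> real^'k"
  assumes W: "sym_pos_def W"
    and Cauchy: "\<And>e. e > 0 \<Longrightarrow> \<exists>N. \<forall>m\<ge>N. \<forall>n\<ge>N. (x m - x n) \<bullet> (W *v (x m - x n)) < e"
  obtains z where "(\<lambda>n. (x n - z) \<bullet> (W *v (x n - z))) \<longlonglongrightarrow> 0"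
proof -
  obtain k where k: "k > 0" "\<And>x. k * (norm x)\<^sup>2 \<le> x \<bullet> (W *v x)" using sym_pos_def_coercive[OF W] by blast
  have "Cauchy x"
  proof (rule CauchyI)
    fix e :: real assume "e > 0"
    then have "k * e\<^sup>2 > 0" using k(1) by simp
    then obtain N where N: "\<And>m n. m \<ge> N \<Longrightarrow> n \<ge> N \<Longrightarrow> (x m - x n) \<bullet> (W *v (x m - x n)) < k * e\<^sup>2"
      using Cauchy by blast
    have "norm (x m - x n) < e" if "m \<ge> N" "n \<ge> N" for m n
    proof -
      have "k * (norm (x m - x n))\<^sup>2 < k * e\<^sup>2" using k(2)[of "x m - x n"] N[OF that] by linarith
      then have "(norm (x m - x n))\<^sup>2 < e\<^sup>2" using k(1) by simp
      then show ?thesis using \<open>e > 0\<close> by (simp add: power_less_imp_less_base)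
    qed
    then show "\<exists>M. \<forall>m\<ge>M. \<forall>n\<ge>M. norm (x m - x n) < e" by blast
  qed
  then obtain z where z: "x \<longlonglongrightarrow> z" using Cauchy_convergent convergent_def by blast
  have "(\<lambda>n. (x n - z) \<bullet> (W *v (x n - z))) \<longlonglongrightarrow> (z - z) \<bullet> (W *v (z - z))"
    by (intro tendsto_intros z bounded_linear.tendsto[OF matrix_vector_mul_bounded_linear])
  then show thesis using that by simp
qed

lemma weighted_integral_commute:
  fixes W :: "real^'k^'k"
  assumes "sym_pos_def W"
  shows "(LINT t|M. u t \<bullet> (W *v v t)) = (LINT t|M. v t \<bullet> (W *v u t))"
  by (simp only: sym_pos_def_inner_commute[OF assms, of "u _"])

section \<open>Primitives and absolute continuity\<close>

text \<open>The primitive vanishing at \<open>0\<close>.\<close>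

definition prim :: "(real \<Rightarrow> 'a::euclidean_space) \<Rightarrow> real \<Rightarrow> 'a" where
  "prim h t = (LINT s|lebesgue_on {0..t}. h s)"

lemma prim_0 [simp]: "prim h 0 = 0"
  unfolding prim_def by (rule integral_eq_zero_null_sets) simp

lemma prim_eq_restrict:
  assumes "t \<le> T"
  shows "prim h t = (LINT s|lebesgue_on {0..T}. (if s \<le> t then h s else 0))"
proof -
  have "{..t} \<inter> {0..T} = {0..t}" using assms by auto
  then show ?thesis
    using Lebesgue_Measure.integral_restrict_Int[of "{..t}" "{0..T}" h]
    by (simp add: prim_def min_absorb1[OF assms])
qed

lemma integrable_restrict_if:
  fixes h :: "real \<Rightarrow> 'a::euclidean_space"
  assumes "integrable (lebesgue_on J) h" "S \<in> sets lebesgue"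
  shows "integrable (lebesgue_on J) (\<lambda>s. if s \<in> S then h s else 0)"
proof -
  have "S \<inter> J \<in> sets (lebesgue_on J)" using assms(2) by (auto simp: sets_restrict_space)
  from integrable_mult_indicator[OF this assms(1)]
  have "integrable (lebesgue_on J) (\<lambda>s. indicator (S \<inter> J) s *\<^sub>R h s)" .
  then show ?thesis
    by (rule Bochner_Integration.integrable_cong[THEN iffD1, rotated -1]) (auto simp: indicator_def)
qed

lemma prim_lincomb:
  assumes "h \<in> L2 {0..T}" "k \<in> L2 {0..T}" "t \<le> T"
  shows "prim (\<lambda>s. a *\<^sub>R h s + b *\<^sub>R k s) t = a *\<^sub>R prim h t + b *\<^sub>R prim k t"
proof -
  have "h \<in> L2 {0..t}" "k \<in> L2 {0..t}" using assms by (auto intro: L2_subset)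
  then show ?thesis unfolding prim_def by (simp add: L2_integrable)
qed

lemma prim_linear:
  assumes "h \<in> L2 {0..T}" "t \<le> T" "bounded_linear f"
  shows "prim (\<lambda>s. f (h s)) t = f (prim h t)"
proof -
  have "h \<in> L2 {0..t}" using assms by (auto intro: L2_subset)
  then show ?thesis unfolding prim_def by (simp add: L2_integrable integral_bounded_linear[OF assms(3)])
qed

lemma prim_matrix:
  assumes "h \<in> L2 {0..T}" "t \<le> T"
  shows "prim (\<lambda>s. (M :: real^'n^'m) *v h s) t = M *v prim h t"
  using assms by (rule prim_linear) (simp add: matrix_vector_mul_bounded_linear)

lemma prim_diff_eq:
  assumes "h \<in> L2 {0..T}" "a \<le> b" "b \<le> T"
  shows "prim h b - prim h a = (LINT s|lebesgue_on {0..T}. (if s \<in> {a<..b} then h s else 0))"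
proof -
  have i: "integrable (lebesgue_on {0..T}) (\<lambda>s. if s \<le> t then h s else 0)" for t
    using integrable_restrict_if[OF L2_integrable[OF assms(1)], of "{..t}"] by simp
  have "prim h b - prim h a = (LINT s|lebesgue_on {0..T}. (if s \<le> b then h s else 0) - (if s \<le> a then h s else 0))"
    using assms by (simp add: prim_eq_restrict[where T=T] i)
  also have "\<dots> = (LINT s|lebesgue_on {0..T}. (if s \<in> {a<..b} then h s else 0))"
    using assms(2) by (intro Bochner_Integration.integral_cong) auto
  finally show ?thesis .
qed

lemma prim_shift:
  assumes "h \<in> L2 {0..T}" "0 \<le> a" "0 \<le> t" "a + t \<le> T"
  shows "prim h (a + t) = prim h a + prim (\<lambda>s. h (a + s)) t"
proof -
  have "prim h (a + t) - prim h a = (LINT s|lebesgue_on {0..T}. (if s \<in> {a<..a+t} then h s else 0))"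
    using assms by (intro prim_diff_eq) auto
  also have "\<dots> = (LINT s|lebesgue_on {0..T}. (if s \<in> {a..a+t} then h s else 0))"
  proof (rule integral_cong_AE)
    have i: "(\<lambda>s. if s \<in> S then h s else 0) \<in> borel_measurable (lebesgue_on {0..T})" if "S \<in> sets lebesgue" for S
      using integrable_restrict_if[OF L2_integrable[OF assms(1)] that] by simp
    show "(\<lambda>s. if s \<in> {a<..a+t} then h s else 0) \<in> borel_measurable (lebesgue_on {0..T})"
      "(\<lambda>s. if s \<in> {a..a+t} then h s else 0) \<in> borel_measurable (lebesgue_on {0..T})" by (intro i; simp)+
    have "negligible {s \<in> {0..T}. \<not> ((if s \<in> {a<..a+t} then h s else 0) = (if s \<in> {a..a+t} then h s else 0))}"
      by (rule negligible_subset[of "{a}"]) auto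
    then show "AE s in lebesgue_on {0..T}. (if s \<in> {a<..a+t} then h s else 0) = (if s \<in> {a..a+t} then h s else 0)"
      by (subst AE_lebesgue_on_iff_negligible) auto
  qed
  also have "\<dots> = (LINT s|lebesgue_on {a..a+t}. h s)"
  proof -
    have "{a..a+t} \<inter> {0..T} = {a..a+t}" using assms by auto
    then show ?thesis by (simp only: Lebesgue_Measure.integral_restrict_Int sets_completionI_sets lmeasurable_interval fmeasurableD)
  qed
  also have "\<dots> = prim (\<lambda>s. h (a + s)) t"
    unfolding prim_def
    using integral_lebesgue_on_affine(1)[of 1 a "{a..a+t}" "{0..t}" h] by simp
  finally show ?thesis by (simp add: algebra_simps)
qed

lemma abs_continuous_on_prim:
  assumes h: "h \<in> L2 {0..T}"
  shows "abs_continuous_on {0..T} (\<lambda>t. c + prim h t)"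
  unfolding abs_continuous_on_def
proof (intro allI impI)
  fix \<epsilon> :: real assume "\<epsilon> > 0"
  define M where "M = lebesgue_on {0..T}"
  define I where "I = (LINT s|M. (norm (h s))\<^sup>2)"
  have I: "I \<ge> 0" by (simp add: I_def)
  have int2: "integrable M (\<lambda>s. (norm (h s))\<^sup>2)" and int1: "integrable M h"
    using h L2_integrable[OF h] by (auto simp: L2_def M_def)
  \<comment> \<open>\<open>\<bar>h\<bar> \<le> K + \<bar>h\<bar>\<^sup>2 / K\<close>, with \<open>K\<close> so large that the second term contributes less than \<open>\<epsilon> / 2\<close>.\<close>
  define K where "K = 2 * (I + 1) / \<epsilon>"
  have K: "K > 0" using \<open>\<epsilon> > 0\<close> I by (simp add: K_def)
  have IK: "I / K < \<epsilon> / 2"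
  proof -
    have "I < I + 1" by simp
    also have "I + 1 = K * (\<epsilon> / 2)" using \<open>\<epsilon> > 0\<close> by (simp add: K_def)
    finally show ?thesis using K by (simp add: field_simps)
  qed
  have bound: "x \<le> K + x\<^sup>2 / K" for x :: real
  proof -
    have "K * x \<le> K * K + x * x"
      using zero_le_square[of "x - K"] zero_le_square[of x] zero_le_square[of K] mult.commute[of x K]
      unfolding left_diff_distrib right_diff_distrib by linarith
    then show ?thesis using K by (simp add: field_simps power2_eq_square)
  qed
  have "(\<Sum>i<N. norm ((c + prim h (b i)) - (c + prim h (a i)))) < \<epsilon>"
    if ab: "\<And>i. i < N \<Longrightarrow> a i \<le> b i \<and> {a i..b i} \<subseteq> {0..T}"
      and dis: "\<And>i j. i < N \<Longrightarrow> j < N \<Longrightarrow> i \<noteq> j \<Longrightarrow> {a i<..<b i} \<inter> {a j<..<b j} = {}"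
      and len: "(\<Sum>i<N. b i - a i) < \<epsilon> / (2 * K)" for N :: nat and a b
  proof -
    have ab': "0 \<le> a i" "a i \<le> b i" "b i \<le> T" if "i < N" for i using ab[OF that] by auto
    have dis': "disjoint_family_on (\<lambda>i. {a i<..b i}) {..<N}"
      unfolding disjoint_family_on_def
    proof (intro ballI impI)
      fix i j assume ij: "i \<in> {..<N}" "j \<in> {..<N}" "i \<noteq> j"
      show "{a i<..b i} \<inter> {a j<..b j} = {}"
      proof (rule ccontr)
        assume "{a i<..b i} \<inter> {a j<..b j} \<noteq> {}"
        then obtain s where "s \<in> {a i<..b i} \<inter> {a j<..b j}" by blast
        then have s: "a i < s" "s \<le> b i" "a j < s" "s \<le> b j" by auto
        then have "(max (a i) (a j) + s) / 2 \<in> {a i<..<b i} \<inter> {a j<..<b j}" by (auto simp: max_def)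
        then show False using dis ij by blast
      qed
    qed
    define U where "U = (\<Union>i<N. {a i<..b i})"
    define g where "g = (\<lambda>s. K + (norm (h s))\<^sup>2 / K)"
    have gint: "integrable M (\<lambda>s. if s \<in> S then (norm (h s))\<^sup>2 / K else 0)" if "S \<in> sets lebesgue" for S
      using int2 that unfolding M_def by (intro integrable_restrict_if) auto
    have "norm (prim h (b i) - prim h (a i)) \<le> K * (b i - a i) + (LINT s|M. (if s \<in> {a i<..b i} then (norm (h s))\<^sup>2 / K else 0))"
      if "i < N" for i
    proof -
      have ci: "integrable M (\<lambda>s. if s \<in> {a i<..b i} then K else 0)"
        using finite_measure.integrable_const[OF finite_measure_lebesgue_on, of "{0..T}" K]
        unfolding M_def by (intro integrable_restrict_if) auto
      have "norm (prim h (b i) - prim h (a i)) \<le> (LINT s|M. norm (if s \<in> {a i<..b i} then h s else 0))"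
        unfolding prim_diff_eq[OF h ab'(2,3)[OF that]] M_def by (rule integral_norm_bound)
      also have "\<dots> \<le> (LINT s|M. (if s \<in> {a i<..b i} then K else 0) + (if s \<in> {a i<..b i} then (norm (h s))\<^sup>2 / K else 0))"
      proof (rule integral_mono)
        show "integrable M (\<lambda>s. norm (if s \<in> {a i<..b i} then h s else 0))"
          using int1 unfolding M_def by (intro integrable_norm integrable_restrict_if) auto
        show "integrable M (\<lambda>s. (if s \<in> {a i<..b i} then K else 0) + (if s \<in> {a i<..b i} then (norm (h s))\<^sup>2 / K else 0))"
          by (intro Bochner_Integration.integrable_add ci gint) simp
      qed (use bound in auto)
      also have "\<dots> = (LINT s|M. (if s \<in> {a i<..b i} then K else 0)) + (LINT s|M. (if s \<in> {a i<..b i} then (norm (h s))\<^sup>2 / K else 0))"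
        by (intro Bochner_Integration.integral_add ci gint) simp
      also have "(LINT s|M. (if s \<in> {a i<..b i} then K else 0)) = K * (b i - a i)"
      proof -
        have "{a i<..b i} \<inter> {0..T} = {a i<..b i}" using ab'[OF that] by auto
        then have "(LINT s|M. (if s \<in> {a i<..b i} then K else 0)) = (LINT s|lebesgue_on {a i<..b i}. K)"
          unfolding M_def by (subst Lebesgue_Measure.integral_restrict_Int) auto
        also have "\<dots> = K * (b i - a i)" using ab'[OF that] by (simp add: measure_restrict_space)
        finally show ?thesis .
      qed
      finally show ?thesis .
    qed
    then have "(\<Sum>i<N. norm ((c + prim h (b i)) - (c + prim h (a i))))
        \<le> (\<Sum>i<N. K * (b i - a i) + (LINT s|M. (if s \<in> {a i<..b i} then (norm (h s))\<^sup>2 / K else 0)))"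
      by (intro sum_mono) simp
    also have "\<dots> = K * (\<Sum>i<N. b i - a i) + (\<Sum>i<N. LINT s|M. (if s \<in> {a i<..b i} then (norm (h s))\<^sup>2 / K else 0))"
      by (simp add: sum.distrib sum_distrib_left)
    also have "(\<Sum>i<N. LINT s|M. (if s \<in> {a i<..b i} then (norm (h s))\<^sup>2 / K else 0))
        = (LINT s|M. (\<Sum>i<N. (if s \<in> {a i<..b i} then (norm (h s))\<^sup>2 / K else 0)))"
      by (intro Bochner_Integration.integral_sum[symmetric] gint) simp
    also have "\<dots> \<le> (LINT s|M. (norm (h s))\<^sup>2 / K)"
    proof (rule integral_mono)
      show "integrable M (\<lambda>s. (\<Sum>i<N. (if s \<in> {a i<..b i} then (norm (h s))\<^sup>2 / K else 0)))"
        by (intro Bochner_Integration.integrable_sum gint) simp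
      fix s
      have "(\<Sum>i<N. (if s \<in> {a i<..b i} then (norm (h s))\<^sup>2 / K else 0))
          = (\<Sum>i<N. indicator {a i<..b i} s) * ((norm (h s))\<^sup>2 / K)"
        unfolding sum_distrib_right by (intro sum.cong refl) (simp add: indicator_def)
      also have "(\<Sum>i<N. indicator {a i<..b i} s :: real) = indicator U s"
        unfolding U_def using dis' by (simp add: indicator_UN_disjoint)
      also have "indicator U s * ((norm (h s))\<^sup>2 / K) \<le> (norm (h s))\<^sup>2 / K"
        using K by (simp add: indicator_def)
      finally show "(\<Sum>i<N. (if s \<in> {a i<..b i} then (norm (h s))\<^sup>2 / K else 0)) \<le> (norm (h s))\<^sup>2 / K" .
    qed (use int2 in simp)
    also have "\<dots> = I / K" by (simp add: I_def)
    finally have "(\<Sum>i<N. norm ((c + prim h (b i)) - (c + prim h (a i)))) \<le> K * (\<Sum>i<N. b i - a i) + I / K"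
      by simp
    also have "\<dots> < \<epsilon> / 2 + \<epsilon> / 2"
    proof (rule add_strict_mono[OF _ IK])
      have "K * (\<Sum>i<N. b i - a i) < K * (\<epsilon> / (2 * K))" using len K by (rule mult_strict_left_mono)
      then show "K * (\<Sum>i<N. b i - a i) < \<epsilon> / 2" using K by simp
    qed
    finally show ?thesis by simp
  qed
  then have "\<forall>(N::nat) a b. (\<forall>i<N. a i \<le> b i \<and> {a i..b i} \<subseteq> {0..T}) \<and>
        (\<forall>i<N. \<forall>j<N. i \<noteq> j \<longrightarrow> {a i<..<b i} \<inter> {a j<..<b j} = {}) \<and>
        (\<Sum>i<N. b i - a i) < \<epsilon> / (2 * K)
        \<longrightarrow> (\<Sum>i<N. norm (c + prim h (b i) - (c + prim h (a i)))) < \<epsilon>"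
    by blast
  moreover have "\<epsilon> / (2 * K) > 0" using K \<open>\<epsilon> > 0\<close> by simp
  ultimately show "\<exists>\<delta>>0. \<forall>(N::nat) a b. (\<forall>i<N. a i \<le> b i \<and> {a i..b i} \<subseteq> {0..T}) \<and>
        (\<forall>i<N. \<forall>j<N. i \<noteq> j \<longrightarrow> {a i<..<b i} \<inter> {a j<..<b j} = {}) \<and>
        (\<Sum>i<N. b i - a i) < \<delta>
        \<longrightarrow> (\<Sum>i<N. norm (c + prim h (b i) - (c + prim h (a i)))) < \<epsilon>" by blast
qed

lemma prim_continuous: "h \<in> L2 {0..T} \<Longrightarrow> continuous_on {0..T} (prim h)"
  using abs_continuous_on_imp_continuous_on[OF abs_continuous_on_prim[of h T 0]] by simp

lemma prim_L2: "h \<in> L2 {0..T} \<Longrightarrow> (\<lambda>t. c + prim h t) \<in> L2 {0..T}"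
  by (rule L2_continuous[OF continuous_on_add[OF continuous_on_const prim_continuous]])

lemma ac_version_prim:
  assumes "h \<in> L2 {0..T}" "0 < T" "AE t in lebesgue_on {0..T}. w t = c + prim h t"
  shows "is_ac_version {0..T} w (\<lambda>t. c + prim h t)"
    and "t \<in> {0..T} \<Longrightarrow> ac_version {0..T} w t = c + prim h t"
proof -
  show 1: "is_ac_version {0..T} w (\<lambda>t. c + prim h t)"
    using assms by (simp add: is_ac_version_def abs_continuous_on_prim)
  show "ac_version {0..T} w t = c + prim h t" if "t \<in> {0..T}"
    using ac_version_eqI[OF assms(2) 1 that] .
qed

text \<open>The solution condition of both the primal and the dual DAE, with the absolutely continuous version
  eliminated; \<open>c\<close> is its initial value.\<close>

lemma ac_solution_iff:
  assumes "h \<in> L2 {0..T}" "0 < T"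
  shows "(\<exists>g. is_ac_version {0..T} w g) \<and>
      (\<forall>t\<in>{0..T}. ac_version {0..T} w t = ac_version {0..T} w 0 + prim h t) \<longleftrightarrow>
    (\<exists>c. AE t in lebesgue_on {0..T}. w t = c + prim h t)" (is "?L \<longleftrightarrow> ?R")
proof
  assume ?L
  then obtain g where g: "is_ac_version {0..T} w g" by blast
  have ae: "AE t in lebesgue_on {0..T}. w t = g t" using g by (simp add: is_ac_version_def)
  have key: "g t = ac_version {0..T} w 0 + prim h t" if "t \<in> {0..T}" for t
  proof -
    have "ac_version {0..T} w t = ac_version {0..T} w 0 + prim h t" using \<open>?L\<close> that by blast
    then show ?thesis unfolding ac_version_eqI[OF assms(2) g that] .
  qed
  have "AE t in lebesgue_on {0..T}. w t = ac_version {0..T} w 0 + prim h t"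
    by (rule lebesgue_on_mono[OF ae]) (simp only: key)
  then show ?R ..
next
  assume ?R
  then obtain c where c: "AE t in lebesgue_on {0..T}. w t = c + prim h t" ..
  have "ac_version {0..T} w t = c + prim h t" if "t \<in> {0..T}" for t
    using assms c that by (rule ac_version_prim(2))
  moreover from this[of 0] have "ac_version {0..T} w 0 = c" using assms(2) by simp
  ultimately have "\<forall>t\<in>{0..T}. ac_version {0..T} w t = ac_version {0..T} w 0 + prim h t" by simp
  then show ?L using ac_version_prim(1)[OF assms c] by blast
qed

lemma prim_cong:
  assumes "h \<in> L2 {0..t}" "k \<in> L2 {0..t}" "\<And>s. 0 < s \<Longrightarrow> s < t \<Longrightarrow> h s = k s"
  shows "prim h t = prim k t"
  unfolding prim_def
proof (rule integral_cong_AE)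
  have "{s \<in> {0..t}. \<not> h s = k s} \<subseteq> {0, t}"
    using assms(3) by (auto simp: less_le)
  then have "negligible {s \<in> {0..t}. \<not> h s = k s}"
    by (rule negligible_subset[rotated]) simp
  then show "AE s in lebesgue_on {0..t}. h s = k s" by (subst AE_lebesgue_on_iff_negligible) auto
qed (use assms in \<open>auto simp: L2_def\<close>)

lemma sigma_finite_lebesgue: "sigma_finite_measure (lebesgue :: 'a::euclidean_space measure)"
proof
  obtain A :: "'a set set" where A: "countable A" "A \<subseteq> sets lborel" "\<Union> A = space lborel"
      "\<forall>a\<in>A. emeasure lborel a \<noteq> \<infinity>"
    using lborel.sigma_finite_countable by blast
  have "emeasure lebesgue a \<noteq> \<infinity>" if "a \<in> A" for a
    using A(2,4) that by (auto simp: subset_iff)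
  with A show "\<exists>A::'a set set. countable A \<and> A \<subseteq> sets lebesgue \<and> \<Union> A = space lebesgue
      \<and> (\<forall>a\<in>A. emeasure lebesgue a \<noteq> \<infinity>)"
    by (intro exI[of _ A]) auto
qed

text \<open>The sets over which \<open>h\<close> has integral zero contain the half lines and form a Dynkin system, hence
  they include all Borel sets, and all Lebesgue sets up to null sets.\<close>

lemma prim_eq_0_imp_AE_0:
  fixes h :: "real \<Rightarrow> 'a::euclidean_space"
  assumes h: "h \<in> L2 {0..T}" and 0: "\<And>t. t \<in> {0..T} \<Longrightarrow> prim h t = 0"
  shows "AE t in lebesgue_on {0..T}. h t = 0"
proof -
  define H where "H = (\<lambda>s. if s \<in> {0..T} then h s else 0)"
  have int: "integrable lebesgue H"
    unfolding H_def by (rule Lebesgue_Measure.integrable_restrict_UNIV[THEN iffD2, OF _ L2_integrable[OF h]]) simp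
  have sint: "set_integrable lebesgue A H" if "A \<in> sets lebesgue" for A
    unfolding set_integrable_def using that int by (rule integrable_mult_indicator)
  have prim0: "prim h t = 0" if "t \<le> T" for t
    using 0[of t] that by (cases "0 \<le> t") (auto simp: prim_def)
  have basic: "set_lebesgue_integral lebesgue {..a} H = 0" for a
  proof -
    have "set_lebesgue_integral lebesgue {..a} H = (LINT s|lebesgue. (if s \<in> {0..min a T} then h s else 0))"
      unfolding set_lebesgue_integral_def H_def
      by (intro Bochner_Integration.integral_cong) (auto simp: indicator_def)
    also have "\<dots> = prim h (min a T)"
      unfolding prim_def by (rule Lebesgue_Measure.integral_restrict_UNIV) simp
    finally show ?thesis by (simp add: prim0)
  qed
  have UNIV0: "set_lebesgue_integral lebesgue UNIV H = 0"
  proof -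
    have "set_lebesgue_integral lebesgue UNIV H = set_lebesgue_integral lebesgue {..T} H"
      unfolding set_lebesgue_integral_def H_def
      by (intro Bochner_Integration.integral_cong) (auto simp: indicator_def)
    then show ?thesis by (simp add: basic)
  qed
  have borel: "set_lebesgue_integral lebesgue A H = 0" if "A \<in> sets borel" for A :: "real set"
  proof -
    have stable: "Int_stable (range (\<lambda>a::real. {..a}))" by (auto simp: Int_stable_def)
    have sb: "sets borel = sigma_sets UNIV (range (\<lambda>a::real. {..a}))"
      unfolding borel_eq_atMost by (rule sets_measure_of) auto
    have cl: "range (\<lambda>a::real. {..a}) \<subseteq> Pow UNIV" by simp
    have "A \<in> sigma_sets UNIV (range (\<lambda>a::real. {..a}))" using that sb by simp
    with stable cl show ?thesis
    proof (induction rule: sigma_sets_induct_disjoint)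
      case (basic A)
      then show ?case using \<open>\<And>a. set_lebesgue_integral lebesgue {..a} H = 0\<close> by auto
    next
      case empty
      show ?case by (simp add: set_lebesgue_integral_def)
    next
      case (compl A)
      have "A \<in> sets lebesgue" using compl(1) sb by auto
      have "set_lebesgue_integral lebesgue (UNIV - A) H
          = set_lebesgue_integral lebesgue UNIV H - set_lebesgue_integral lebesgue A H"
      proof -
        have e: "indicat_real (UNIV - A) s *\<^sub>R H s = H s - indicat_real A s *\<^sub>R H s" for s
          by (simp add: indicator_def)
        show ?thesis
          unfolding set_lebesgue_integral_def e
          using sint[OF \<open>A \<in> sets lebesgue\<close>] int by (simp add: set_integrable_def)
      qed
      then show ?case using compl(2) UNIV0 by simp
    next
      case (union A)
      have "A i \<in> sets borel" for i unfolding sb using union(2) by (rule range_subsetD)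
      then have A: "A i \<in> sets lebesgue" for i by simp
      have "set_lebesgue_integral lebesgue (\<Union>i. A i) H = (\<Sum>i. set_lebesgue_integral lebesgue (A i) H)"
        using union(1) A by (intro lebesgue_integral_countable_add sint sets.countable_UN)
          (auto simp: disjoint_family_on_def)
      then show ?case by (simp add: union(3))
    qed
  qed
  have "AE s in lebesgue. H s = 0"
  proof (rule sigma_finite_measure.density_zero[OF sigma_finite_lebesgue int])
    fix A :: "real set" assume A: "A \<in> sets lebesgue"
    obtain S N N' where SN: "A = S \<union> N" "N \<subseteq> N'" "N' \<in> null_sets lborel" "S \<in> sets lborel"
      using A by (rule sets_completionE)
    have "set_lebesgue_integral lebesgue A H = set_lebesgue_integral lebesgue S H"
    proof (rule set_integral_cong_set)
      show "set_borel_measurable lebesgue S H" "set_borel_measurable lebesgue A H"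
        unfolding set_borel_measurable_def
        using sint[of S] sint[OF A] SN(4) unfolding set_integrable_def by auto
      have "AE x in lborel. x \<notin> N'" using SN(3) by (rule AE_not_in)
      then have "AE x in lebesgue. x \<notin> N'" by (rule AE_completion)
      then show "AE x in lebesgue. (x \<in> S) = (x \<in> A)"
        by eventually_elim (use SN in auto)
    qed
    then show "set_lebesgue_integral lebesgue A H = 0" using borel[of S] SN(4) by simp
  qed
  then have "AE s in lebesgue. s \<in> {0..T} \<longrightarrow> h s = 0" by eventually_elim (auto simp: H_def)
  then show ?thesis by (simp add: AE_restrict_space_iff)
qed

text \<open>Integration by parts for primitives, in the convolution form obtained from Fubini's theorem
  on the triangle \<open>s + r \<le> T\<close>.\<close>

lemma integral_inner_prim_swap:
  fixes a b :: "real \<Rightarrow> 'a::euclidean_space"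
  assumes a: "a \<in> L2 {0..T}" and b: "b \<in> L2 {0..T}"
  shows "(LINT s|lebesgue_on {0..T}. a s \<bullet> prim b (T - s)) = (LINT r|lebesgue_on {0..T}. b r \<bullet> prim a (T - r))"
proof -
  define M where "M = lebesgue_on {0..T}"
  interpret finite_measure M unfolding M_def by (rule finite_measure_lebesgue_on) simp
  interpret pair_sigma_finite M M ..
  have [measurable]: "a \<in> borel_measurable M" "b \<in> borel_measurable M"
    using a b by (auto simp: L2_def M_def)
  have [measurable]: "(\<lambda>x. x) \<in> borel_measurable M"
    unfolding M_def using id_borel_measurable_lebesgue_on by (simp add: id_def)
  have inta: "integrable M a" and intb: "integrable M b" using a b by (auto simp: L2_integrable M_def)
  define f where "f = (\<lambda>s r. if s + r \<le> T then a s \<bullet> b r else 0)"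
  have fm: "case_prod f \<in> borel_measurable (M \<Otimes>\<^sub>M M)" unfolding f_def by measurable
  have gi: "integrable (M \<Otimes>\<^sub>M M) (\<lambda>(s, r). norm (a s) * norm (b r))"
  proof (rule Fubini_integrable)
    show "integrable M (\<lambda>s. \<integral> r. norm (case (s, r) of (s, r) \<Rightarrow> norm (a s) * norm (b r)) \<partial>M)"
      using inta by (simp add: integrable_mult_left)
    show "AE s in M. integrable M (\<lambda>r. case (s, r) of (s, r) \<Rightarrow> norm (a s) * norm (b r))"
      using intb by simp
  qed measurable
  have fi: "integrable (M \<Otimes>\<^sub>M M) (case_prod f)"
    by (rule Bochner_Integration.integrable_bound[OF gi fm])
       (auto simp: f_def abs_mult Cauchy_Schwarz_ineq2)
  have inner: "(\<integral>r. (if s + r \<le> T then v \<bullet> h r else 0) \<partial>M) = v \<bullet> prim h (T - s)"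
    if h: "h \<in> L2 {0..T}" and s: "s \<in> {0..T}" for h s and v :: 'a
  proof -
    have "integrable M (\<lambda>r. if r \<in> {..T - s} then h r else 0)"
      unfolding M_def using L2_integrable[OF h] by (rule integrable_restrict_if) simp
    then have "v \<bullet> (\<integral>r. (if r \<in> {..T - s} then h r else 0) \<partial>M) = (\<integral>r. v \<bullet> (if r \<in> {..T - s} then h r else 0) \<partial>M)"
      by simp
    also have "\<dots> = (\<integral>r. (if s + r \<le> T then v \<bullet> h r else 0) \<partial>M)"
      by (intro Bochner_Integration.integral_cong) auto
    finally show ?thesis using s by (simp add: prim_eq_restrict[of "T - s" T] M_def)
  qed
  have "(\<integral>s. a s \<bullet> prim b (T - s) \<partial>M) = (\<integral>s. (\<integral>r. f s r \<partial>M) \<partial>M)"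
  proof (intro Bochner_Integration.integral_cong refl)
    fix s assume "s \<in> space M"
    then have "s \<in> {0..T}" by (simp add: M_def)
    then show "a s \<bullet> prim b (T - s) = (\<integral>r. f s r \<partial>M)"
      using inner[OF b, of s "a s"] unfolding f_def by simp
  qed
  also have "\<dots> = (\<integral>r. (\<integral>s. f s r \<partial>M) \<partial>M)" using Fubini_integral[OF fi] by simp
  also have "\<dots> = (\<integral>r. b r \<bullet> prim a (T - r) \<partial>M)"
  proof (intro Bochner_Integration.integral_cong refl)
    fix r assume "r \<in> space M"
    then have "r \<in> {0..T}" by (simp add: M_def)
    then show "(\<integral>s. f s r \<partial>M) = b r \<bullet> prim a (T - r)"
    proof -
      have "(\<lambda>s. f s r) = (\<lambda>s. if r + s \<le> T then b r \<bullet> a s else 0)"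
        unfolding f_def using inner_commute[of "b r"] add.commute[of r] by (simp add: fun_eq_iff)
      then show ?thesis using inner[OF a \<open>r \<in> {0..T}\<close>, of "b r"] by simp
    qed
  qed
  finally show ?thesis by (simp add: M_def)
qed

section \<open>Trajectories and consistent initial values\<close>

text \<open>Trajectories of \<open>d(Ex)/dt = Ax + g\<close> on \<open>[0,T]\<close>, where \<open>c\<close> is the initial value of \<open>Ex\<close>. The
  absolutely continuous version of \<open>Ex\<close> is given explicitly as \<open>c + prim (A x + g)\<close>.\<close>

definition dae_traj ::
  "real^'n^'m \<Rightarrow> real^'n^'m \<Rightarrow> real \<Rightarrow> real^'m \<Rightarrow> (real \<Rightarrow> real^'n) \<Rightarrow> (real \<Rightarrow> real^'m) \<Rightarrow> bool" where
  "dae_traj E A T c x g \<longleftrightarrow> x \<in> L2 {0..T} \<and> g \<in> L2 {0..T} \<and>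
     (AE t in lebesgue_on {0..T}. E *v x t = c + prim (\<lambda>s. A *v x s + g s) t)"

lemma dae_trajD:
  assumes "dae_traj E A T c x g"
  shows "x \<in> L2 {0..T}" "g \<in> L2 {0..T}" "(\<lambda>s. A *v x s + g s) \<in> L2 {0..T}"
    "AE t in lebesgue_on {0..T}. E *v x t = c + prim (\<lambda>s. A *v x s + g s) t"
  using assms by (auto simp: dae_traj_def L2_add L2_matrix)

lemma dae_traj_lincomb:
  assumes 1: "dae_traj E A T c x g" and 2: "dae_traj E A T d y k"
  shows "dae_traj E A T (a *\<^sub>R c + b *\<^sub>R d) (\<lambda>t. a *\<^sub>R x t + b *\<^sub>R y t) (\<lambda>t. a *\<^sub>R g t + b *\<^sub>R k t)"
proof -
  have eq: "prim (\<lambda>s. A *v (a *\<^sub>R x s + b *\<^sub>R y s) + (a *\<^sub>R g s + b *\<^sub>R k s)) t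
      = a *\<^sub>R prim (\<lambda>s. A *v x s + g s) t + b *\<^sub>R prim (\<lambda>s. A *v y s + k s) t" if "t \<le> T" for t
  proof -
    have "(\<lambda>s. A *v (a *\<^sub>R x s + b *\<^sub>R y s) + (a *\<^sub>R g s + b *\<^sub>R k s))
        = (\<lambda>s. a *\<^sub>R (A *v x s + g s) + b *\<^sub>R (A *v y s + k s))"
      by (simp add: fun_eq_iff matrix_vector_right_distrib matrix_vector_mult_scaleR scaleR_add_right)
    then show ?thesis using prim_lincomb[OF dae_trajD(3)[OF 1] dae_trajD(3)[OF 2] that] by simp
  qed
  have "AE t in lebesgue_on {0..T}. E *v x t = c + prim (\<lambda>s. A *v x s + g s) t \<and>
      E *v y t = d + prim (\<lambda>s. A *v y s + k s) t"
    using dae_trajD(4)[OF 1] dae_trajD(4)[OF 2] by (rule AE_conjI)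
  then have "AE t in lebesgue_on {0..T}. E *v (a *\<^sub>R x t + b *\<^sub>R y t) = (a *\<^sub>R c + b *\<^sub>R d) +
      prim (\<lambda>s. A *v (a *\<^sub>R x s + b *\<^sub>R y s) + (a *\<^sub>R g s + b *\<^sub>R k s)) t"
    by (rule lebesgue_on_mono)
       (subst eq, auto simp: matrix_vector_right_distrib matrix_vector_mult_scaleR scaleR_add_right)
  then show ?thesis using dae_trajD(1,2)[OF 1] dae_trajD(1,2)[OF 2] by (simp add: dae_traj_def L2_lincomb)
qed

lemma dae_traj_restrict:
  assumes 1: "dae_traj E A T c x g" and "T' \<le> T"
  shows "dae_traj E A T' c x g"
proof -
  have sub: "{0..T'} \<subseteq> {0..T}" using assms(2) by auto
  show ?thesis
    unfolding dae_traj_def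
    using L2_subset[OF dae_trajD(1)[OF 1] sub] L2_subset[OF dae_trajD(2)[OF 1] sub]
      AE_lebesgue_on_subset[OF dae_trajD(4)[OF 1] sub] by simp
qed

lemma dae_traj_shift:
  assumes 1: "dae_traj E A T c x g" and a: "0 \<le> a" "a \<le> T"
  shows "dae_traj E A (T - a) (c + prim (\<lambda>s. A *v x s + g s) a) (\<lambda>s. x (a + s)) (\<lambda>s. g (a + s))"
proof -
  have "{a..T} \<subseteq> {0..T}" using a by auto
  then have "AE t in lebesgue_on {a..T}. E *v x t = c + prim (\<lambda>s. A *v x s + g s) t"
    by (rule AE_lebesgue_on_subset[OF dae_trajD(4)[OF 1]]) auto
  then have ae: "AE t in lebesgue_on {0..T - a}. E *v x (a + 1 * t) = c + prim (\<lambda>s. A *v x s + g s) (a + 1 * t)"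
    by (rule AE_lebesgue_on_affine) auto
  have "AE t in lebesgue_on {0..T - a}. E *v x (a + t) =
      (c + prim (\<lambda>s. A *v x s + g s) a) + prim (\<lambda>s. A *v x (a + s) + g (a + s)) t"
    by (rule lebesgue_on_mono[OF ae]) (use prim_shift[OF dae_trajD(3)[OF 1] a(1)] in simp)
  then show ?thesis
    using L2_shift[OF dae_trajD(1)[OF 1] a] L2_shift[OF dae_trajD(2)[OF 1] a] by (simp add: dae_traj_def)
qed

lemma dae_traj_concat:
  assumes 1: "dae_traj E A a c x g" and 2: "dae_traj E A b (c + prim (\<lambda>s. A *v x s + g s) a) y k"
    and ab: "0 \<le> a" "0 \<le> b"
  shows "dae_traj E A (a + b) c (concat_at a x y) (concat_at a g k)"
proof -
  define h h' where "h = (\<lambda>s. A *v x s + g s)" and "h' = (\<lambda>s. A *v y s + k s)"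
  define z where "z = concat_at a x y"
  define H where "H = concat_at a h h'"
  have H: "(\<lambda>s. A *v concat_at a x y s + concat_at a g k s) = H"
    by (auto simp: fun_eq_iff H_def h_def h'_def concat_at_def)
  have hL: "h \<in> L2 {0..a}" "h' \<in> L2 {0..b}"
    using dae_trajD(3)[OF 1] dae_trajD(3)[OF 2] by (auto simp: h_def h'_def)
  have HL: "H \<in> L2 {0..a + b}" unfolding H_def by (rule L2_concat_at[OF hL ab])
  have p1: "prim H t = prim h t" if "t \<le> a" for t
  proof (rule prim_cong)
    show "H \<in> L2 {0..t}" by (rule L2_subset[OF HL]) (use that ab in auto)
    show "h \<in> L2 {0..t}" by (rule L2_subset[OF hL(1)]) (use that in auto)
  qed (use that in \<open>auto simp: H_def concat_at_def\<close>)
  have p2: "prim H (a + t) = prim h a + prim h' t" if "0 \<le> t" "t \<le> b" for t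
  proof -
    have "prim H (a + t) = prim H a + prim (\<lambda>s. H (a + s)) t"
      using that ab by (intro prim_shift[OF HL]) auto
    also have "prim (\<lambda>s. H (a + s)) t = prim h' t"
      unfolding prim_def by (intro Bochner_Integration.integral_cong) (auto simp: H_def concat_at_def)
    finally show ?thesis by (simp add: p1)
  qed
  have n1: "negligible {t \<in> {0..a}. \<not> E *v x t = c + prim h t}"
    using dae_trajD(4)[OF 1] by (subst (asm) AE_lebesgue_on_iff_negligible) (auto simp: h_def)
  have "AE t in lebesgue_on {a..a + b}. E *v y (- a + 1 * t) = (c + prim h a) + prim h' (- a + 1 * t)"
    using dae_trajD(4)[OF 2] unfolding h_def h'_def by (rule AE_lebesgue_on_affine) auto
  then have n2: "negligible {t \<in> {a..a + b}. \<not> E *v y (- a + 1 * t) = (c + prim h a) + prim h' (- a + 1 * t)}"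
    by (subst (asm) AE_lebesgue_on_iff_negligible) auto
  have "{t \<in> {0..a + b}. \<not> E *v z t = c + prim H t} \<subseteq> {t \<in> {0..a}. \<not> E *v x t = c + prim h t}
      \<union> {t \<in> {a..a + b}. \<not> E *v y (- a + 1 * t) = (c + prim h a) + prim h' (- a + 1 * t)}"
  proof
    fix t assume t: "t \<in> {t \<in> {0..a + b}. \<not> E *v z t = c + prim H t}"
    show "t \<in> {t \<in> {0..a}. \<not> E *v x t = c + prim h t}
      \<union> {t \<in> {a..a + b}. \<not> E *v y (- a + 1 * t) = (c + prim h a) + prim h' (- a + 1 * t)}"
    proof (cases "t < a")
      case True
      then show ?thesis using t p1[of t] by (auto simp: z_def concat_at_def)
    next
      case False
      then have "prim H t = prim h a + prim h' (t - a)" using p2[of "t - a"] t by simp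
      then show ?thesis using t False by (auto simp: z_def concat_at_def add.assoc)
    qed
  qed
  then have "AE t in lebesgue_on {0..a + b}. E *v z t = c + prim H t"
    using negligible_subset[OF negligible_Un[OF n1 n2]] by (subst AE_lebesgue_on_iff_negligible) simp_all
  then show ?thesis
    using L2_concat_at[OF dae_trajD(1)[OF 1] dae_trajD(1)[OF 2] ab]
      L2_concat_at[OF dae_trajD(2)[OF 1] dae_trajD(2)[OF 2] ab]
    by (simp add: dae_traj_def H z_def)
qed

text \<open>The initial values from which \<open>d(Ex)/dt = Ax + Bu\<close> has a trajectory on \<open>[0,T]\<close>.\<close>

definition consistent :: "real^'n^'m \<Rightarrow> real^'n^'m \<Rightarrow> real^'p^'m \<Rightarrow> real \<Rightarrow> (real^'m) set" where
  "consistent E A B T = {c. \<exists>x u. u \<in> L2 {0..T} \<and> dae_traj E A T c x (\<lambda>s. B *v u s)}"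

lemma subspace_consistent: "subspace (consistent E A B T)"
proof -
  have lin: "a *\<^sub>R c + b *\<^sub>R d \<in> consistent E A B T"
    if "c \<in> consistent E A B T" "d \<in> consistent E A B T" for a b c d
  proof -
    obtain x u y v where *: "u \<in> L2 {0..T}" "dae_traj E A T c x (\<lambda>s. B *v u s)"
        "v \<in> L2 {0..T}" "dae_traj E A T d y (\<lambda>s. B *v v s)"
      using \<open>c \<in> _\<close> \<open>d \<in> _\<close> unfolding consistent_def by blast
    have eq: "(\<lambda>t. a *\<^sub>R (B *v u t) + b *\<^sub>R (B *v v t)) = (\<lambda>t. B *v (a *\<^sub>R u t + b *\<^sub>R v t))"
      by (simp add: fun_eq_iff matrix_vector_right_distrib matrix_vector_mult_scaleR)
    show ?thesis
      using dae_traj_lincomb[OF *(2,4), of a b] L2_lincomb[OF *(1,3), of a b]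
      unfolding consistent_def eq by blast
  qed
  have "dae_traj E A T 0 (\<lambda>t. 0) (\<lambda>s. B *v 0)" by (simp add: dae_traj_def L2_0 prim_def)
  then have 0: "0 \<in> consistent E A B T" unfolding consistent_def using L2_0[of "{0..T}"] by blast
  show ?thesis
  proof (rule subspaceI)
    show "0 \<in> consistent E A B T" by (rule 0)
    show "x + y \<in> consistent E A B T" if "x \<in> consistent E A B T" "y \<in> consistent E A B T" for x y
      using lin[OF that, of 1 1] by simp
    show "k *\<^sub>R x \<in> consistent E A B T" if "x \<in> consistent E A B T" for k x
      using lin[OF that that, of k 0] by simp
  qed
qed

lemma consistent_antimono: "T' \<le> T \<Longrightarrow> consistent E A B T \<subseteq> consistent E A B T'"
proof
  fix c assume "T' \<le> T" "c \<in> consistent E A B T"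
  then obtain x u where "u \<in> L2 {0..T}" "dae_traj E A T c x (\<lambda>s. B *v u s)"
    unfolding consistent_def by blast
  moreover have "{0..T'} \<subseteq> {0..T}" using \<open>T' \<le> T\<close> by auto
  ultimately have "u \<in> L2 {0..T'}" "dae_traj E A T' c x (\<lambda>s. B *v u s)"
    using L2_subset dae_traj_restrict[OF _ \<open>T' \<le> T\<close>] by blast+
  then show "c \<in> consistent E A B T'" unfolding consistent_def by blast
qed

text \<open>Consistency does not depend on the horizon. The subspaces of consistent values decrease in the
  horizon, so they are constant on some interval \<open>(0,\<tau>\<^sub>0]\<close>, where their dimension is maximal. A
  trajectory on \<open>[0,\<tau>\<^sub>0]\<close> is at time \<open>\<tau>\<^sub>0 / 2\<close> in a value consistent on \<open>[0,\<tau>\<^sub>0 / 2]\<close>, hence on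
  \<open>[0,\<tau>\<^sub>0]\<close>, and so it can be prolonged repeatedly.\<close>

lemma consistent_all_horizons:
  fixes E :: "real^'n^'m"
  assumes c: "c \<in> consistent E A B \<sigma>" and "0 < \<sigma>"
  shows "c \<in> consistent E A B T"
proof -
  let ?V = "consistent E A B"
  have "\<exists>\<tau>>0. \<forall>\<sigma>. 0 < \<sigma> \<longrightarrow> dim (?V \<sigma>) \<le> dim (?V \<tau>)"
  proof (rule Lattices_Big.ex_has_greatest_nat[where P = "\<lambda>\<tau>. 0 < \<tau>"])
    show "(0::real) < 1" by simp
    show "\<forall>\<tau>. 0 < \<tau> \<longrightarrow> dim (?V \<tau>) < Suc (DIM(real^'m))"
      using dim_subset_UNIV less_Suc_eq_le by blast
  qed
  then obtain \<tau> where \<tau>: "\<tau> > 0" "\<And>\<sigma>. 0 < \<sigma> \<Longrightarrow> dim (?V \<sigma>) \<le> dim (?V \<tau>)" by blast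
  have eq: "?V s = ?V \<tau>" if "0 < s" "s \<le> \<tau>" for s
    using subspace_dim_equal[OF subspace_consistent subspace_consistent consistent_antimono[OF that(2)] \<tau>(2)[OF that(1)]]
    by simp
  have step: "?V \<tau> \<subseteq> ?V (\<tau> / 2 + S)" if S: "?V \<tau> \<subseteq> ?V S" "0 \<le> S" for S
  proof
    fix d assume "d \<in> ?V \<tau>"
    then obtain x u where xu: "u \<in> L2 {0..\<tau>}" "dae_traj E A \<tau> d x (\<lambda>s. B *v u s)"
      unfolding consistent_def by blast
    let ?d' = "d + prim (\<lambda>s. A *v x s + B *v u s) (\<tau> / 2)"
    have "?d' \<in> ?V (\<tau> - \<tau> / 2)"
      unfolding consistent_def
      using dae_traj_shift[OF xu(2), of "\<tau> / 2"] L2_shift[OF xu(1), of "\<tau> / 2"] \<tau>(1) by force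
    then have "?d' \<in> ?V S" using eq[of "\<tau> - \<tau> / 2"] \<tau>(1) S by auto
    then obtain y v where yv: "v \<in> L2 {0..S}" "dae_traj E A S ?d' y (\<lambda>s. B *v v s)"
      unfolding consistent_def by blast
    have xu': "u \<in> L2 {0..\<tau>/2}" "dae_traj E A (\<tau>/2) d x (\<lambda>s. B *v u s)"
      using xu \<tau>(1) by (auto intro: L2_subset dae_traj_restrict)
    have "concat_at (\<tau>/2) (\<lambda>s. B *v u s) (\<lambda>s. B *v v s) = (\<lambda>s. B *v concat_at (\<tau>/2) u v s)"
      by (auto simp: concat_at_def)
    then show "d \<in> ?V (\<tau> / 2 + S)"
      unfolding consistent_def
      using dae_traj_concat[OF xu'(2) yv(2)] L2_concat_at[OF xu'(1) yv(1)] \<tau>(1) S(2) by auto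
  qed
  have "?V \<tau> \<subseteq> ?V (real (Suc k) * (\<tau> / 2))" for k
  proof (induction k)
    case 0
    show ?case using eq[of "\<tau> / 2"] \<tau>(1) by simp
  next
    case (Suc k)
    have "real (Suc (Suc k)) * (\<tau> / 2) = \<tau> / 2 + real (Suc k) * (\<tau> / 2)" by (simp add: field_simps)
    moreover have "0 \<le> real (Suc k) * (\<tau> / 2)" using \<tau>(1) by simp
    ultimately show ?case using step[OF Suc] by metis
  qed
  moreover obtain k where "T / (\<tau> / 2) < real k" using reals_Archimedean2 by blast
  then have "T \<le> real (Suc k) * (\<tau> / 2)" using \<tau>(1) by (simp add: field_simps)
  ultimately have "?V \<tau> \<subseteq> ?V T" using consistent_antimono by blast
  moreover have "c \<in> ?V (min \<sigma> \<tau>)" using c consistent_antimono[of "min \<sigma> \<tau>" \<sigma>] by auto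
  ultimately show ?thesis using eq[of "min \<sigma> \<tau>"] \<tau>(1) \<open>0 < \<sigma>\<close> by auto
qed

section \<open>The duality pairing\<close>

lemma dae_traj_ac_version:
  assumes "dae_traj E A T c x g" "0 < T"
  shows "is_ac_version {0..T} (\<lambda>t. E *v x t) (\<lambda>t. c + prim (\<lambda>s. A *v x s + g s) t)"
    and "t \<in> {0..T} \<Longrightarrow> ac_version {0..T} (\<lambda>t. E *v x t) t = c + prim (\<lambda>s. A *v x s + g s) t"
  using ac_version_prim[OF dae_trajD(3)[OF assms(1)] assms(2) dae_trajD(4)[OF assms(1)]] by auto

lemma dae_traj_iff:
  assumes "0 < T" "x \<in> L2 {0..T}" "g \<in> L2 {0..T}"
  shows "(\<exists>w. is_ac_version {0..T} (\<lambda>t. E *v x t) w) \<and>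
     (\<forall>t\<in>{0..T}. ac_version {0..T} (\<lambda>t. E *v x t) t = ac_version {0..T} (\<lambda>t. E *v x t) 0 +
        (LINT s|lebesgue_on {0..t}. A *v x s + g s)) \<longleftrightarrow> (\<exists>c. dae_traj E A T c x g)"
proof -
  have "(\<lambda>s. A *v x s + g s) \<in> L2 {0..T}" using assms by (intro L2_add L2_matrix)
  from ac_solution_iff[OF this assms(1), of "\<lambda>t. E *v x t"] show ?thesis
    using assms by (simp add: dae_traj_def prim_def)
qed

lemma dual_set_iff:
  assumes "0 < T"
  shows "(q, u) \<in> dual_set F A H l T \<longleftrightarrow> u \<in> L2 {0..T} \<and>
    dae_traj (transpose F) (transpose A) T (transpose F *v l) q (\<lambda>s. (- transpose H) *v u s)"
    (is "?L \<longleftrightarrow> ?R")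
proof -
  define S where "S \<longleftrightarrow> (\<exists>w. is_ac_version {0..T} (\<lambda>t. transpose F *v q t) w) \<and>
     (\<forall>t\<in>{0..T}. ac_version {0..T} (\<lambda>t. transpose F *v q t) t = ac_version {0..T} (\<lambda>t. transpose F *v q t) 0 +
        (LINT s|lebesgue_on {0..t}. transpose A *v q s + (- transpose H) *v u s))"
  have eq: "transpose A *v a - transpose H *v b = transpose A *v a + (- transpose H) *v b" for a b
    by (simp only: uminus_matrix_vector_mult diff_conv_add_uminus)
  have L: "?L \<longleftrightarrow> q \<in> L2 {0..T} \<and> u \<in> L2 {0..T} \<and> S \<and>
      ac_version {0..T} (\<lambda>t. transpose F *v q t) 0 = transpose F *v l"
    unfolding dual_set_def dual_solution_def Let_def L2_loc_eq_L2 eq S_def mem_Collect_eq prod.case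
    by (simp only: conj_assoc)
  have S: "S \<longleftrightarrow> (\<exists>c. dae_traj (transpose F) (transpose A) T c q (\<lambda>s. (- transpose H) *v u s))"
    if "q \<in> L2 {0..T}" "u \<in> L2 {0..T}"
    unfolding S_def by (rule dae_traj_iff[OF assms that(1) L2_matrix[OF that(2)]])
  have ac: "ac_version {0..T} (\<lambda>t. transpose F *v q t) 0 = c"
    if "dae_traj (transpose F) (transpose A) T c q (\<lambda>s. (- transpose H) *v u s)" for c
    using dae_traj_ac_version(2)[OF that assms, of 0] assms by simp
  show ?thesis
  proof
    assume ?L
    then show ?R using L S ac by metis
  next
    assume R: ?R
    then have "q \<in> L2 {0..T}" by (blast dest: dae_trajD(1))
    with R show ?L using L S ac by blast
  qed
qed

text \<open>The differentiated part of a trajectory stays in the range of \<open>E\<close>, and so does its derivative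
  almost everywhere.\<close>

lemma dae_traj_range:
  fixes E :: "real^'n^'m" and G :: "real^'m^'n"
  assumes tr: "dae_traj E A T c x g" and "0 < T" and G: "E ** G ** E = E"
  defines "h \<equiv> \<lambda>s. A *v x s + g s"
  shows "t \<in> {0..T} \<Longrightarrow> E *v (G *v (c + prim h t)) = c + prim h t"
    and "AE s in lebesgue_on {0..T}. E *v (G *v h s) = h s"
proof -
  have hL: "h \<in> L2 {0..T}" using dae_trajD(3)[OF tr] by (simp add: h_def)
  define k where "k = (\<lambda>s. (E ** G) *v h s)"
  have kL: "k \<in> L2 {0..T}" unfolding k_def by (rule L2_matrix[OF hL])
  have pk: "prim k t = (E ** G) *v prim h t" if "t \<le> T" for t
    unfolding k_def by (rule prim_matrix[OF hL that])
  have ae: "AE t in lebesgue_on {0..T}. E *v x t = c + prim h t"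
    using dae_trajD(4)[OF tr] by (simp add: h_def)
  have ae': "AE t in lebesgue_on {0..T}. E *v x t = (E ** G) *v c + prim k t"
  proof (rule lebesgue_on_mono[OF ae])
    fix t assume "E *v x t = c + prim h t" "t \<in> {0..T}"
    then have "(E ** G) *v (E *v x t) = (E ** G) *v c + prim k t"
      by (simp add: pk matrix_vector_right_distrib)
    then show "E *v x t = (E ** G) *v c + prim k t" by (simp only: matrix_vector_mul_assoc G)
  qed
  have eq: "c + prim h t = (E ** G) *v (c + prim h t)" if t: "t \<in> {0..T}" for t
    using ac_version_prim(2)[OF hL \<open>0 < T\<close> ae t] ac_version_prim(2)[OF kL \<open>0 < T\<close> ae' t] pk[of t] t
    by (simp add: matrix_vector_right_distrib)
  show "E *v (G *v (c + prim h t)) = c + prim h t" if "t \<in> {0..T}"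
    using eq[OF that] by (simp only: matrix_vector_mul_assoc)
  have c: "(E ** G) *v c = c" using eq[of 0] \<open>0 < T\<close> by simp
  have "AE s in lebesgue_on {0..T}. k s - h s = 0"
  proof (rule prim_eq_0_imp_AE_0)
    show "(\<lambda>s. k s - h s) \<in> L2 {0..T}" by (rule L2_diff[OF kL hL])
    fix t assume t: "t \<in> {0..T}"
    have "prim (\<lambda>s. k s - h s) t = prim k t - prim h t"
      using prim_lincomb[OF kL hL, of t 1 "-1"] t by simp
    also have "\<dots> = 0" using pk[of t] eq[OF t] t c by (simp add: matrix_vector_right_distrib)
    finally show "prim (\<lambda>s. k s - h s) t = 0" .
  qed
  then show "AE s in lebesgue_on {0..T}. E *v (G *v h s) = h s"
    by (rule lebesgue_on_mono) (simp only: k_def matrix_vector_mul_assoc right_minus_eq)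
qed

text \<open>The duality pairing. Formally it is integration by parts for \<open>q(T - t)\<^sup>T F x(t)\<close>; as only \<open>Fx\<close> and
  \<open>F\<^sup>T q\<close> are absolutely continuous, it is carried out for \<open>(F\<^sup>T q)(T - t)\<^sup>T G (F x)(t)\<close> with a
  generalised inverse \<open>G\<close> of \<open>F\<close>.\<close>

lemma duality_pairing:
  fixes F A :: "real^'n^'m" and H :: "real^'n^'p"
  assumes "0 < T" and p: "dae_traj F A T c x f"
    and u: "u \<in> L2 {0..T}"
    and d: "dae_traj (transpose F) (transpose A) T (transpose F *v l) q (\<lambda>s. (- transpose H) *v u s)"
    and e: "transpose F *v e = transpose F *v l + prim (\<lambda>s. transpose A *v q s + (- transpose H) *v u s) T"
  shows "l \<bullet> (c + prim (\<lambda>s. A *v x s + f s) T) = c \<bullet> e +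
      (LINT t|lebesgue_on {0..T}. f t \<bullet> q (T - t)) + (LINT t|lebesgue_on {0..T}. (H *v x t) \<bullet> u (T - t))"
proof -
  define M where "M = lebesgue_on {0..T}"
  define h where "h = (\<lambda>s. A *v x s + f s)"
  define k where "k = (\<lambda>s. transpose A *v q s + (- transpose H) *v u s)"
  define X where "X = (\<lambda>t. c + prim h t)"
  define Z where "Z = (\<lambda>t. transpose F *v l + prim k t)"
  define G where "G = pinv F"
  have G: "F ** G ** F = F" unfolding G_def by (rule pinv_simps)
  have Gt: "transpose F ** transpose G ** transpose F = transpose F"
    using G by (metis matrix_transpose_mul matrix_mul_assoc)
  have xL: "x \<in> L2 {0..T}" and fL: "f \<in> L2 {0..T}" and hL: "h \<in> L2 {0..T}"
    using dae_trajD[OF p] by (auto simp: h_def)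
  have qL: "q \<in> L2 {0..T}" and kL: "k \<in> L2 {0..T}" using dae_trajD[OF d] by (simp_all only: k_def)
  have XL: "X \<in> L2 {0..T}" and ZL: "Z \<in> L2 {0..T}" unfolding X_def Z_def by (intro prim_L2 hL kL)+
  have GhL: "(\<lambda>s. G *v h s) \<in> L2 {0..T}" by (rule L2_matrix[OF hL])
  have aeX: "AE t in M. F *v x t = X t" and aeZ: "AE t in M. transpose F *v q t = Z t"
    unfolding M_def X_def Z_def h_def k_def by (rule dae_trajD(4)[OF p], rule dae_trajD(4)[OF d])
  have X: "F *v (G *v X t) = X t" if "t \<in> {0..T}" for t
    using dae_traj_range(1)[OF p \<open>0 < T\<close> G that] by (simp add: X_def h_def)
  have aeh: "AE s in M. F *v (G *v h s) = h s"
    unfolding M_def h_def by (rule dae_traj_range(2)[OF p \<open>0 < T\<close> G])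
  have aek: "AE s in M. transpose F *v (transpose G *v k s) = k s"
    unfolding M_def k_def by (rule dae_traj_range(2)[OF d \<open>0 < T\<close> Gt])
  have c: "F *v (G *v c) = c" using X[of 0] \<open>0 < T\<close> by (simp add: X_def)
  have prh: "F *v (G *v prim h T) = prim h T"
    using X[of T] c \<open>0 < T\<close> by (simp add: X_def matrix_vector_right_distrib)
  have intL: "integrable M (\<lambda>t. a t \<bullet> b t)" if "a \<in> L2 {0..T}" "b \<in> L2 {0..T}"
    for a b :: "real \<Rightarrow> 'a::euclidean_space"
    unfolding M_def using that by (rule L2_inner_integrable)
  have meas: "(\<lambda>t. a t \<bullet> b t) \<in> borel_measurable M" if "a \<in> L2 {0..T}" "b \<in> L2 {0..T}"
    for a b :: "real \<Rightarrow> 'a::euclidean_space"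
    using intL[OF that] by simp
  have "(LINT s|M. (G *v h s) \<bullet> prim k (T - s)) = (LINT r|M. k r \<bullet> prim (\<lambda>s. G *v h s) (T - r))"
    unfolding M_def by (rule integral_inner_prim_swap[OF GhL kL])
  also have "\<dots> = (LINT r|M. k r \<bullet> (G *v X (T - r)) - k r \<bullet> (G *v c))"
    by (intro Bochner_Integration.integral_cong)
       (auto simp: M_def X_def prim_matrix[OF hL] matrix_vector_right_distrib inner_add_right)
  also have "\<dots> = (LINT r|M. k r \<bullet> (G *v X (T - r))) - (LINT r|M. k r \<bullet> (G *v c))"
    by (rule Bochner_Integration.integral_diff[OF intL[OF kL L2_matrix[OF L2_reflect[OF XL]]] intL[OF kL L2_const]])
  also have "(LINT r|M. k r \<bullet> (G *v c)) = prim k T \<bullet> (G *v c)"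
    using L2_integrable[OF kL] by (simp add: M_def prim_def)
  also have "prim k T \<bullet> (G *v c) = e \<bullet> c - l \<bullet> c"
  proof -
    have "prim k T = transpose F *v e - transpose F *v l" using e by (simp only: k_def add_diff_cancel_left')
    then show ?thesis
      using inner_matrix_transpose[of e F "G *v c"] inner_matrix_transpose[of l F "G *v c"]
      by (simp only: c inner_diff_left)
  qed
  also have "(LINT r|M. k r \<bullet> (G *v X (T - r))) = (LINT r|M. k r \<bullet> x (T - r))"
  proof (rule integral_cong_AE)
    have "AE r in M. F *v x (T - r) = X (T - r)" using AE_reflect aeX unfolding M_def by blast
    with aek show "AE r in M. k r \<bullet> (G *v X (T - r)) = k r \<bullet> x (T - r)"
    proof eventually_elim
      case (elim r)
      have "k r \<bullet> (G *v X (T - r)) = (transpose F *v (transpose G *v k r)) \<bullet> (G *v (F *v x (T - r)))"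
        by (simp only: elim)
      also have "\<dots> = (transpose G *v k r) \<bullet> ((F ** G ** F) *v x (T - r))"
        by (simp only: inner_matrix_transpose[of _ F, symmetric] matrix_vector_mul_assoc[symmetric])
      also have "\<dots> = (transpose F *v (transpose G *v k r)) \<bullet> x (T - r)"
        by (simp only: G inner_matrix_transpose[of _ F])
      finally show ?case by (simp only: elim)
    qed
  qed (rule meas[OF kL L2_matrix[OF L2_reflect[OF XL]]], rule meas[OF kL L2_reflect[OF xL]])
  also have "(LINT r|M. k r \<bullet> x (T - r)) = (LINT r|M. k (T - r) \<bullet> x r)"
    unfolding M_def using integral_reflect[where T=T and g="\<lambda>r. k (T - r) \<bullet> x r"] by simp
  also have "\<dots> = (LINT r|M. (A *v x r) \<bullet> q (T - r) - (H *v x r) \<bullet> u (T - r))"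
  proof (intro Bochner_Integration.integral_cong refl)
    fix r
    show "k (T - r) \<bullet> x r = (A *v x r) \<bullet> q (T - r) - (H *v x r) \<bullet> u (T - r)"
      using inner_matrix_transpose[of "q (T - r)" A "x r"] inner_matrix_transpose[of "u (T - r)" H "x r"]
      by (simp only: k_def uminus_matrix_vector_mult inner_add_left inner_minus_left inner_commute[of _ "q (T - r)"]
          inner_commute[of _ "u (T - r)"])
  qed
  also have "\<dots> = (LINT r|M. (A *v x r) \<bullet> q (T - r)) - (LINT r|M. (H *v x r) \<bullet> u (T - r))"
    by (rule Bochner_Integration.integral_diff[OF intL[OF L2_matrix[OF xL] L2_reflect[OF qL]]
        intL[OF L2_matrix[OF xL] L2_reflect[OF u]]])
  finally have R: "(LINT s|M. (G *v h s) \<bullet> prim k (T - s)) =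
      (LINT r|M. (A *v x r) \<bullet> q (T - r)) - (LINT r|M. (H *v x r) \<bullet> u (T - r)) - (e \<bullet> c - l \<bullet> c)" .
  have "(LINT s|M. (G *v h s) \<bullet> prim k (T - s)) = (LINT s|M. (G *v h s) \<bullet> Z (T - s) - (G *v h s) \<bullet> (transpose F *v l))"
    by (intro Bochner_Integration.integral_cong refl) (simp only: Z_def inner_add_right add_diff_cancel_left')
  also have "\<dots> = (LINT s|M. (G *v h s) \<bullet> Z (T - s)) - (LINT s|M. (G *v h s) \<bullet> (transpose F *v l))"
    by (rule Bochner_Integration.integral_diff[OF intL[OF GhL L2_reflect[OF ZL]] intL[OF GhL L2_const]])
  also have "(LINT s|M. (G *v h s) \<bullet> (transpose F *v l)) = l \<bullet> prim h T"
  proof -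
    have "(LINT s|M. (G *v h s) \<bullet> (transpose F *v l)) = prim (\<lambda>s. G *v h s) T \<bullet> (transpose F *v l)"
      using L2_integrable[OF GhL] unfolding M_def prim_def by (rule integral_inner_left)
    also have "\<dots> = (transpose F *v l) \<bullet> (G *v prim h T)"
      by (simp only: prim_matrix[OF hL order_refl] inner_commute)
    also have "\<dots> = l \<bullet> prim h T" by (simp only: inner_matrix_transpose[symmetric] prh)
    finally show ?thesis .
  qed
  also have "(LINT s|M. (G *v h s) \<bullet> Z (T - s)) = (LINT s|M. h s \<bullet> q (T - s))"
  proof (rule integral_cong_AE)
    have "AE r in M. transpose F *v q (T - r) = Z (T - r)" using AE_reflect aeZ unfolding M_def by blast
    with aeh show "AE s in M. (G *v h s) \<bullet> Z (T - s) = h s \<bullet> q (T - s)"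
    proof eventually_elim
      case (elim s)
      have "(transpose F *v q (T - s)) \<bullet> (G *v h s) = q (T - s) \<bullet> h s"
        using inner_matrix_transpose[of "q (T - s)" F "G *v h s"] by (simp only: elim(1))
      then show ?case using inner_commute by (metis elim(2))
    qed
  qed (rule meas[OF GhL L2_reflect[OF ZL]], rule meas[OF hL L2_reflect[OF qL]])
  also have "\<dots> = (LINT s|M. (A *v x s) \<bullet> q (T - s) + f s \<bullet> q (T - s))"
    by (simp only: h_def inner_add_left)
  also have "\<dots> = (LINT s|M. (A *v x s) \<bullet> q (T - s)) + (LINT s|M. f s \<bullet> q (T - s))"
    by (rule Bochner_Integration.integral_add[OF intL[OF L2_matrix[OF xL] L2_reflect[OF qL]]
        intL[OF fL L2_reflect[OF qL]]])
  finally show ?thesis using R by (simp add: M_def h_def inner_add_right inner_commute[of e c])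
qed

section \<open>The space of initial values, disturbances and noises\<close>

text \<open>Triples of the initial value \<open>F x(0)\<close>, the disturbance \<open>f\<close> and the measurement noise \<open>\<eta>\<close>.\<close>

type_synonym ('m, 'p) triple = "(real^'m) \<times> (real \<Rightarrow> real^'m) \<times> (real \<Rightarrow> real^'p)"

text \<open>The triples with square integrable disturbance and noise; they need not belong to a solution.\<close>

definition triples :: "real \<Rightarrow> ('m::finite, 'p::finite) triple set" where
  "triples T = {(c, f, \<eta>). f \<in> L2 {0..T} \<and> \<eta> \<in> L2 {0..T}}"

text \<open>The linear combination \<open>a v + b w\<close>, formed pointwise.\<close>

definition triple_lc :: "real \<Rightarrow> ('m::finite, 'p::finite) triple \<Rightarrow> real \<Rightarrow> ('m, 'p) triple \<Rightarrow> ('m, 'p) triple" where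
  "triple_lc a v b w = (case (v, w) of ((c, f, \<eta>), (c', f', \<eta>')) \<Rightarrow>
     (a *\<^sub>R c + b *\<^sub>R c', \<lambda>t. a *\<^sub>R f t + b *\<^sub>R f' t, \<lambda>t. a *\<^sub>R \<eta> t + b *\<^sub>R \<eta>' t))"

text \<open>The inner product with weights \<open>Q\<^sub>0\<close>, \<open>Q\<close> and \<open>R\<close>. A solution is admissible on \<open>[0,T]\<close> if its triple
  lies in the unit ball.\<close>

definition triple_form ::
  "real^'m^'m \<Rightarrow> real^'m^'m \<Rightarrow> real^'p^'p \<Rightarrow> real \<Rightarrow> ('m::finite, 'p::finite) triple \<Rightarrow> ('m, 'p) triple \<Rightarrow> real" where
  "triple_form Q0 Q R T v w = (case (v, w) of ((c, f, \<eta>), (c', f', \<eta>')) \<Rightarrow>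
     c \<bullet> (Q0 *v c') + (LINT t|lebesgue_on {0..T}. f t \<bullet> (Q *v f' t))
       + (LINT t|lebesgue_on {0..T}. \<eta> t \<bullet> (R *v \<eta>' t)))"

lemma triple_form_diag:
  assumes "f \<in> L2 {0..T}" "\<eta> \<in> L2 {0..T}"
  shows "triple_form Q0 Q R T (c, f, \<eta>) (c, f, \<eta>) = c \<bullet> (Q0 *v c) +
    (LINT t|lebesgue_on {0..T}. f t \<bullet> (Q *v f t) + \<eta> t \<bullet> (R *v \<eta> t))"
  using assms by (simp add: triple_form_def L2_inner_integrable L2_matrix)

lemma complete_form_triples:
  fixes Q0 Q :: "real^'m^'m" and R :: "real^'p^'p"
  assumes Q0: "sym_pos_def Q0" and Q: "sym_pos_def Q" and R: "sym_pos_def R"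
  shows "complete_form (triples T) triple_lc (triple_form Q0 Q R T)"
proof
  fix v w :: "('m, 'p) triple" and a b
  assume v: "v \<in> triples T" and w: "w \<in> triples T"
  obtain c f \<eta> c' f' \<eta>' where vw: "v = (c, f, \<eta>)" "w = (c', f', \<eta>')" by (cases v, cases w)
  note L = v[unfolded vw triples_def] w[unfolded vw triples_def]
  show "triple_lc a v b w \<in> triples T"
    using L by (simp add: vw triple_lc_def triples_def L2_lincomb)
  show "triple_form Q0 Q R T v w = triple_form Q0 Q R T w v"
    using sym_pos_def_inner_commute[OF Q0, of c c'] weighted_integral_commute[OF Q, of _ f f']
      weighted_integral_commute[OF R, of _ \<eta> \<eta>'] by (simp add: vw triple_form_def)
  show "triple_form Q0 Q R T (triple_lc a v b w) u = a * triple_form Q0 Q R T v u + b * triple_form Q0 Q R T w u"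
    if u: "u \<in> triples T" for u
  proof -
    obtain d g \<theta> where u': "u = (d, g, \<theta>)" by (cases u)
    have "g \<in> L2 {0..T}" "\<theta> \<in> L2 {0..T}" using u by (auto simp: u' triples_def)
    with L show ?thesis
      by (simp add: vw u' triple_lc_def triple_form_def weighted_integral_lincomb del: inner_add_left)
         (simp add: inner_add_left algebra_simps)
  qed
next
  fix v :: "('m, 'p) triple"
  assume v: "v \<in> triples T"
  obtain c f \<eta> where v': "v = (c, f, \<eta>)" by (cases v)
  show "0 \<le> triple_form Q0 Q R T v v"
    unfolding v' triple_form_def using sym_pos_def_nonneg[OF Q0] sym_pos_def_nonneg[OF Q] sym_pos_def_nonneg[OF R]
    by (auto intro!: add_nonneg_nonneg)
next
  fix X :: "nat \<Rightarrow> ('m, 'p) triple"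
  assume X: "\<And>n. X n \<in> triples T" and C: "\<And>e. e > 0 \<Longrightarrow> \<exists>N. \<forall>m\<ge>N. \<forall>n\<ge>N.
    triple_form Q0 Q R T (triple_lc 1 (X m) (-1) (X n)) (triple_lc 1 (X m) (-1) (X n)) < e"
  define c f \<eta> where "c = (\<lambda>n. fst (X n))" and "f = (\<lambda>n. fst (snd (X n)))" and "\<eta> = (\<lambda>n. snd (snd (X n)))"
  have Xeq: "X n = (c n, f n, \<eta> n)" for n by (simp add: c_def f_def \<eta>_def)
  have fL: "f n \<in> L2 {0..T}" and \<eta>L: "\<eta> n \<in> L2 {0..T}" for n
    using X[of n] by (auto simp: Xeq triples_def)
  have split: "triple_form Q0 Q R T (triple_lc 1 (X n) (-1) (z, g, \<theta>)) (triple_lc 1 (X n) (-1) (z, g, \<theta>)) =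
      (c n - z) \<bullet> (Q0 *v (c n - z)) + (LINT t|lebesgue_on {0..T}. (f n t - g t) \<bullet> (Q *v (f n t - g t)))
      + (LINT t|lebesgue_on {0..T}. (\<eta> n t - \<theta> t) \<bullet> (R *v (\<eta> n t - \<theta> t)))" for n z g \<theta>
    by (simp add: Xeq triple_lc_def triple_form_def)
  have nn: "0 \<le> (c n - z) \<bullet> (Q0 *v (c n - z))"
    "0 \<le> (LINT t|lebesgue_on {0..T}. (f n t - g t) \<bullet> (Q *v (f n t - g t)))"
    "0 \<le> (LINT t|lebesgue_on {0..T}. (\<eta> n t - \<theta> t) \<bullet> (R *v (\<eta> n t - \<theta> t)))" for n z g \<theta>
    using sym_pos_def_nonneg[OF Q0] sym_pos_def_nonneg[OF Q] sym_pos_def_nonneg[OF R] by auto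
  have C': "\<exists>N. \<forall>m\<ge>N. \<forall>n\<ge>N. (c m - c n) \<bullet> (Q0 *v (c m - c n)) < e \<and>
      (LINT t|lebesgue_on {0..T}. (f m t - f n t) \<bullet> (Q *v (f m t - f n t))) < e \<and>
      (LINT t|lebesgue_on {0..T}. (\<eta> m t - \<eta> n t) \<bullet> (R *v (\<eta> m t - \<eta> n t))) < e" if e: "e > 0" for e
  proof -
    obtain N where N: "\<And>m n. m \<ge> N \<Longrightarrow> n \<ge> N \<Longrightarrow>
        triple_form Q0 Q R T (triple_lc 1 (X m) (-1) (X n)) (triple_lc 1 (X m) (-1) (X n)) < e"
      using C[OF e] by blast
    show ?thesis
    proof (intro exI allI impI)
      fix m n assume mn: "m \<ge> N" "n \<ge> N"
      show "(c m - c n) \<bullet> (Q0 *v (c m - c n)) < e \<and>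
        (LINT t|lebesgue_on {0..T}. (f m t - f n t) \<bullet> (Q *v (f m t - f n t))) < e \<and>
        (LINT t|lebesgue_on {0..T}. (\<eta> m t - \<eta> n t) \<bullet> (R *v (\<eta> m t - \<eta> n t))) < e"
        using N[OF mn] nn(1)[of m "c n"] nn(2)[of m "f n"] nn(3)[of m "\<eta> n"] split[of m "c n" "f n" "\<eta> n"] unfolding Xeq[of n, symmetric]
        by linarith
    qed
  qed
  obtain z where z: "(\<lambda>n. (c n - z) \<bullet> (Q0 *v (c n - z))) \<longlonglongrightarrow> 0"
    by (rule weighted_complete_vec[OF Q0, of c]) (use C' in meson)+
  obtain g where g: "g \<in> L2 {0..T}"
      "(\<lambda>n. LINT t|lebesgue_on {0..T}. (f n t - g t) \<bullet> (Q *v (f n t - g t))) \<longlonglongrightarrow> 0"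
    by (rule L2_weighted_complete[OF Q, of f 0 T]) (use fL C' in meson)+
  obtain \<theta> where \<theta>: "\<theta> \<in> L2 {0..T}"
      "(\<lambda>n. LINT t|lebesgue_on {0..T}. (\<eta> n t - \<theta> t) \<bullet> (R *v (\<eta> n t - \<theta> t))) \<longlonglongrightarrow> 0"
    by (rule L2_weighted_complete[OF R, of \<eta> 0 T]) (use \<eta>L C' in meson)+
  have "(\<lambda>n. triple_form Q0 Q R T (triple_lc 1 (X n) (-1) (z, g, \<theta>)) (triple_lc 1 (X n) (-1) (z, g, \<theta>))) \<longlonglongrightarrow> 0"
    unfolding split using tendsto_add[OF tendsto_add[OF z g(2)] \<theta>(2)] by simp
  then show "\<exists>z\<in>triples T. (\<lambda>n. triple_form Q0 Q R T (triple_lc 1 (X n) (-1) z) (triple_lc 1 (X n) (-1) z)) \<longlonglongrightarrow> 0"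
    using g(1) \<theta>(1) by (intro bexI[of _ "(z, g, \<theta>)"]) (auto simp: triples_def)
qed

section \<open>Weak duality and representing dual solutions\<close>

text \<open>The integrand of the admissibility condition is nonnegative, so the condition at the end point
  implies the others.\<close>

lemma EE_iff:
  fixes F A :: "real^'n^'m" and H :: "real^'n^'p"
  assumes Q: "sym_pos_def Q" and R: "sym_pos_def R" and "0 < T"
  shows "(x, f, y, \<eta>) \<in> EE F A H Q0 Q R T \<longleftrightarrow> (\<exists>c. dae_traj F A T c x f \<and> y \<in> L2 {0..T} \<and> \<eta> \<in> L2 {0..T} \<and>
    (AE t in lebesgue_on {0..T}. y t = H *v x t + \<eta> t) \<and>
    triple_form Q0 Q R T (c, f, \<eta>) (c, f, \<eta>) \<le> 1)" (is "?L \<longleftrightarrow> ?R")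
proof -
  let ?ac = "ac_version {0..T} (\<lambda>t. F *v x t)"
  let ?g = "\<lambda>t. f t \<bullet> (Q *v f t) + \<eta> t \<bullet> (R *v \<eta> t)"
  define S where "S \<longleftrightarrow> (\<exists>w. is_ac_version {0..T} (\<lambda>t. F *v x t) w) \<and>
     (\<forall>t\<in>{0..T}. ?ac t = ?ac 0 + (LINT s|lebesgue_on {0..t}. A *v x s + f s))"
  have L: "?L \<longleftrightarrow> x \<in> L2 {0..T} \<and> f \<in> L2 {0..T} \<and> y \<in> L2 {0..T} \<and> \<eta> \<in> L2 {0..T} \<and> S \<and>
      (AE t in lebesgue_on {0..T}. y t = H *v x t + \<eta> t) \<and>
      (\<forall>\<tau>\<in>{0..T}. ?ac 0 \<bullet> (Q0 *v ?ac 0) + (LINT t|lebesgue_on {0..\<tau>}. ?g t) \<le> 1)"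
    unfolding EE_def dae_solution_def Let_def L2_loc_eq_L2 S_def mem_Collect_eq prod.case
    by (simp only: conj_assoc)
  have S: "S \<longleftrightarrow> (\<exists>c. dae_traj F A T c x f)" if "x \<in> L2 {0..T}" "f \<in> L2 {0..T}"
    unfolding S_def by (rule dae_traj_iff[OF \<open>0 < T\<close> that])
  have ac: "?ac 0 = c" if "dae_traj F A T c x f" for c
    using dae_traj_ac_version(2)[OF that \<open>0 < T\<close>, of 0] \<open>0 < T\<close> by simp
  have E: "(\<forall>\<tau>\<in>{0..T}. c \<bullet> (Q0 *v c) + (LINT t|lebesgue_on {0..\<tau>}. ?g t) \<le> 1) \<longleftrightarrow>
      triple_form Q0 Q R T (c, f, \<eta>) (c, f, \<eta>) \<le> 1" if fL: "f \<in> L2 {0..T}" and \<eta>L: "\<eta> \<in> L2 {0..T}" for c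
  proof -
    have int: "integrable (lebesgue_on {0..T}) ?g"
      using fL \<eta>L by (intro Bochner_Integration.integrable_add L2_inner_integrable L2_matrix)
    have nn: "0 \<le> ?g t" for t using sym_pos_def_nonneg[OF Q] sym_pos_def_nonneg[OF R] by (simp add: add_nonneg_nonneg)
    have mono: "(LINT t|lebesgue_on {0..\<tau>}. ?g t) \<le> (LINT t|lebesgue_on {0..T}. ?g t)" if "\<tau> \<in> {0..T}" for \<tau>
      by (rule integral_mono_lebesgue_on_AE[OF int]) (use that nn in auto)
    have "(\<forall>\<tau>\<in>{0..T}. c \<bullet> (Q0 *v c) + (LINT t|lebesgue_on {0..\<tau>}. ?g t) \<le> 1) \<longleftrightarrow>
      c \<bullet> (Q0 *v c) + (LINT t|lebesgue_on {0..T}. ?g t) \<le> 1"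
    proof
      assume "\<forall>\<tau>\<in>{0..T}. c \<bullet> (Q0 *v c) + (LINT t|lebesgue_on {0..\<tau>}. ?g t) \<le> 1"
      then show "c \<bullet> (Q0 *v c) + (LINT t|lebesgue_on {0..T}. ?g t) \<le> 1" using \<open>0 < T\<close> by (rule_tac bspec) auto
    next
      assume "c \<bullet> (Q0 *v c) + (LINT t|lebesgue_on {0..T}. ?g t) \<le> 1"
      then show "\<forall>\<tau>\<in>{0..T}. c \<bullet> (Q0 *v c) + (LINT t|lebesgue_on {0..\<tau>}. ?g t) \<le> 1"
        using mono by (meson add_left_mono order_trans)
    qed
    then show ?thesis unfolding triple_form_diag[OF fL \<eta>L] .
  qed
  show ?thesis
  proof
    assume L': ?L
    then have xf: "x \<in> L2 {0..T}" "f \<in> L2 {0..T}" "\<eta> \<in> L2 {0..T}" and S using L by blast+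
    then obtain c where c: "dae_traj F A T c x f" using S by blast
    have "\<forall>\<tau>\<in>{0..T}. c \<bullet> (Q0 *v c) + (LINT t|lebesgue_on {0..\<tau>}. ?g t) \<le> 1"
      using L' L unfolding ac[OF c] by blast
    then have "triple_form Q0 Q R T (c, f, \<eta>) (c, f, \<eta>) \<le> 1" unfolding E[OF xf(2,3)] .
    then show ?R using c L L' by blast
  next
    assume ?R
    then obtain c where c: "dae_traj F A T c x f" and r: "y \<in> L2 {0..T}" "\<eta> \<in> L2 {0..T}"
      "AE t in lebesgue_on {0..T}. y t = H *v x t + \<eta> t" "triple_form Q0 Q R T (c, f, \<eta>) (c, f, \<eta>) \<le> 1" by blast
    have xf: "x \<in> L2 {0..T}" "f \<in> L2 {0..T}" using dae_trajD(1,2)[OF c] .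
    have "\<forall>\<tau>\<in>{0..T}. ?ac 0 \<bullet> (Q0 *v ?ac 0) + (LINT t|lebesgue_on {0..\<tau>}. ?g t) \<le> 1"
      unfolding ac[OF c] E[OF xf(2) r(2)] by (rule r(4))
    then show ?L using L S[OF xf] xf r c by blast
  qed
qed

lemma integral_young:
  fixes W :: "real^'k^'k"
  assumes W: "sym_pos_def W" and f: "f \<in> L2 J" and g: "g \<in> L2 J"
  shows "2 * s * (LINT t|lebesgue_on J. f t \<bullet> g t) \<le>
    s\<^sup>2 * (LINT t|lebesgue_on J. f t \<bullet> (W *v f t)) + (LINT t|lebesgue_on J. g t \<bullet> (matrix_inv W *v g t))"
proof -
  have i: "integrable (lebesgue_on J) (\<lambda>t. f t \<bullet> g t)" "integrable (lebesgue_on J) (\<lambda>t. f t \<bullet> (W *v f t))"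
    "integrable (lebesgue_on J) (\<lambda>t. g t \<bullet> (matrix_inv W *v g t))"
    using f g by (auto intro!: L2_inner_integrable L2_matrix)
  have "(LINT t|lebesgue_on J. 2 * s * (f t \<bullet> g t)) \<le>
      (LINT t|lebesgue_on J. s\<^sup>2 * (f t \<bullet> (W *v f t)) + g t \<bullet> (matrix_inv W *v g t))"
    using i by (intro integral_mono Bochner_Integration.integrable_add integrable_mult_right sym_pos_def_young[OF W])
  then show ?thesis using i by simp
qed

text \<open>Weak duality: every dual solution for \<open>U\<close> bounds the squared estimation error.\<close>

lemma weak_duality:
  fixes F A :: "real^'n^'m" and H :: "real^'n^'p"
  assumes Q0: "sym_pos_def Q0" and Q: "sym_pos_def Q" and R: "sym_pos_def R" and T: "0 < T"
    and U: "U \<in> L2 {0..T}" and qu: "(q, u) \<in> dual_set F A H l T" and refl: "is_reflection T U u"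
    and xf: "(x, f, y, \<eta>) \<in> EE F A H Q0 Q R T"
  shows "(l \<bullet> ac_version {0..T} (\<lambda>t. F *v x t) T - obs U T y)\<^sup>2 \<le> dual_cost F Q0 Q R q u T"
proof -
  obtain c where c: "dae_traj F A T c x f" and yL: "y \<in> L2 {0..T}" and \<eta>L: "\<eta> \<in> L2 {0..T}"
    and ae: "AE t in lebesgue_on {0..T}. y t = H *v x t + \<eta> t"
    and unit: "triple_form Q0 Q R T (c, f, \<eta>) (c, f, \<eta>) \<le> 1"
    using xf unfolding EE_iff[OF Q R T] by blast
  have uL: "u \<in> L2 {0..T}"
    and d: "dae_traj (transpose F) (transpose A) T (transpose F *v l) q (\<lambda>s. (- transpose H) *v u s)"
    using qu unfolding dual_set_iff[OF T] by blast+
  have xL: "x \<in> L2 {0..T}" and fL: "f \<in> L2 {0..T}" and qL: "q \<in> L2 {0..T}"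
    using dae_trajD(1,2)[OF c] dae_trajD(1)[OF d] by blast+
  define w where "w = transpose F *v l + prim (\<lambda>s. transpose A *v q s + (- transpose H) *v u s) T"
  have acq: "ac_version {0..T} (\<lambda>t. transpose F *v q t) T = w"
    using dae_traj_ac_version(2)[OF d T, of T] T by (simp only: w_def atLeastAtMost_iff order_refl less_imp_le)
  have "transpose F *v (pinv (transpose F) *v w) = w"
    unfolding w_def by (rule dae_traj_range(1)[OF d T pinv_simps(1)]) (use T in simp)
  then obtain e where e: "transpose F *v e = w" "w \<bullet> (Qbar0_core F Q0 *v w) = e \<bullet> (matrix_inv Q0 *v e)"
    using terminal_minimiser[OF Q0] by metis
  let ?q = "\<lambda>t. q (T - t)" and ?u = "\<lambda>t. u (T - t)"
  have q'L: "?q \<in> L2 {0..T}" and u'L: "?u \<in> L2 {0..T}" using L2_reflect qL uL by blast+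
  define I where "I = (LINT t|lebesgue_on {0..T}. (H *v x t) \<bullet> ?u t)"
  have obs: "obs U T y = I + (LINT t|lebesgue_on {0..T}. \<eta> t \<bullet> ?u t)"
  proof -
    have "AE t in lebesgue_on {0..T}. u (T - t) = U (T - (T - t))"
      using refl unfolding is_reflection_def by (rule AE_reflect)
    with ae have "AE t in lebesgue_on {0..T}. y t \<bullet> U t = (H *v x t) \<bullet> ?u t + \<eta> t \<bullet> ?u t"
      by eventually_elim (simp add: inner_add_left)
    then have "obs U T y = (LINT t|lebesgue_on {0..T}. (H *v x t) \<bullet> ?u t + \<eta> t \<bullet> ?u t)"
      unfolding obs_def
      by (rule integral_cong_AE[rotated 2])
         (intro borel_measurable_integrable Bochner_Integration.integrable_add L2_inner_integrable yL U L2_matrix[OF xL] u'L \<eta>L)+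
    also have "\<dots> = I + (LINT t|lebesgue_on {0..T}. \<eta> t \<bullet> ?u t)"
      unfolding I_def
      by (intro Bochner_Integration.integral_add L2_inner_integrable L2_matrix[OF xL] u'L \<eta>L)
    finally show ?thesis .
  qed
  \<comment> \<open>The error itself is the factor in Young's inequality.\<close>
  define s where "s = l \<bullet> ac_version {0..T} (\<lambda>t. F *v x t) T - obs U T y"
  have acx: "ac_version {0..T} (\<lambda>t. F *v x t) T = c + prim (\<lambda>s. A *v x s + f s) T"
    using dae_traj_ac_version(2)[OF c T, of T] T by simp
  have s: "s = c \<bullet> e + (LINT t|lebesgue_on {0..T}. f t \<bullet> ?q t) - (LINT t|lebesgue_on {0..T}. \<eta> t \<bullet> ?u t)"
    unfolding s_def acx obs using duality_pairing[OF T c uL d e(1)[unfolded w_def]] by (simp add: I_def)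
  have 1: "2 * s * (c \<bullet> e) \<le> s\<^sup>2 * (c \<bullet> (Q0 *v c)) + e \<bullet> (matrix_inv Q0 *v e)"
    by (rule sym_pos_def_young[OF Q0])
  have 2: "2 * s * (LINT t|lebesgue_on {0..T}. f t \<bullet> ?q t) \<le> s\<^sup>2 * (LINT t|lebesgue_on {0..T}. f t \<bullet> (Q *v f t))
      + (LINT t|lebesgue_on {0..T}. ?q t \<bullet> (matrix_inv Q *v ?q t))"
    by (rule integral_young[OF Q fL q'L])
  have 3: "2 * (- s) * (LINT t|lebesgue_on {0..T}. \<eta> t \<bullet> ?u t) \<le> (- s)\<^sup>2 * (LINT t|lebesgue_on {0..T}. \<eta> t \<bullet> (R *v \<eta> t))
      + (LINT t|lebesgue_on {0..T}. ?u t \<bullet> (matrix_inv R *v ?u t))"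
    by (rule integral_young[OF R \<eta>L u'L])
  have cost: "dual_cost F Q0 Q R q u T = e \<bullet> (matrix_inv Q0 *v e)
      + (LINT t|lebesgue_on {0..T}. ?q t \<bullet> (matrix_inv Q *v ?q t)) + (LINT t|lebesgue_on {0..T}. ?u t \<bullet> (matrix_inv R *v ?u t))"
  proof -
    have "(LINT t|lebesgue_on {0..T}. q t \<bullet> (matrix_inv Q *v q t) + u t \<bullet> (matrix_inv R *v u t)) =
        (LINT t|lebesgue_on {0..T}. q t \<bullet> (matrix_inv Q *v q t)) + (LINT t|lebesgue_on {0..T}. u t \<bullet> (matrix_inv R *v u t))"
      by (intro Bochner_Integration.integral_add L2_inner_integrable L2_matrix qL uL)
    then show ?thesis
      unfolding dual_cost_def Let_def acq e(2)
      using integral_reflect[where T=T and g="\<lambda>t. q t \<bullet> (matrix_inv Q *v q t)"]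
        integral_reflect[where T=T and g="\<lambda>t. u t \<bullet> (matrix_inv R *v u t)"] by simp
  qed
  have "2 * s * s \<le> s\<^sup>2 * triple_form Q0 Q R T (c, f, \<eta>) (c, f, \<eta>) + dual_cost F Q0 Q R q u T"
  proof -
    have "2 * s * s = 2 * s * (c \<bullet> e) + 2 * s * (LINT t|lebesgue_on {0..T}. f t \<bullet> ?q t)
        + 2 * (- s) * (LINT t|lebesgue_on {0..T}. \<eta> t \<bullet> ?u t)"
      by (subst (2) s) (simp add: algebra_simps)
    also have "\<dots> \<le> s\<^sup>2 * triple_form Q0 Q R T (c, f, \<eta>) (c, f, \<eta>) + dual_cost F Q0 Q R q u T"
      using 1 2 3 unfolding cost triple_form_def prod.case power2_minus distrib_left by linarith
    finally show ?thesis .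
  qed
  also have "s\<^sup>2 * triple_form Q0 Q R T (c, f, \<eta>) (c, f, \<eta>) \<le> s\<^sup>2 * 1"
    using unit by (intro mult_left_mono) auto
  finally show ?thesis unfolding s_def[symmetric] by (simp add: power2_eq_square)
qed

text \<open>A representation of \<open>l\<^sup>T F x(T) - \<integral> (H x)\<^sup>T U\<close> by the initial value and the disturbance
  gives a dual solution. The test trajectories have \<open>x\<close> itself absolutely continuous, with an arbitrary
  square integrable derivative.\<close>

lemma dual_solution_of_representation:
  fixes F A :: "real^'n^'m" and H :: "real^'n^'p"
  assumes T: "0 < T" and qL: "qt \<in> L2 {0..T}" and UL: "U \<in> L2 {0..T}"
    and rep: "\<And>c x f. dae_traj F A T c x f \<Longrightarrow>
      l \<bullet> (c + prim (\<lambda>s. A *v x s + f s) T) - (LINT t|lebesgue_on {0..T}. (H *v x t) \<bullet> U t) =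
      d \<bullet> c + (LINT t|lebesgue_on {0..T}. qt t \<bullet> f t)"
  defines "q \<equiv> \<lambda>t. qt (T - t)" and "u \<equiv> \<lambda>t. U (T - t)"
  shows "(q, u) \<in> dual_set F A H l T"
    and "ac_version {0..T} (\<lambda>t. transpose F *v q t) T = transpose F *v d"
proof -
  define M where "M = lebesgue_on {0..T}"
  define k where "k = (\<lambda>s. transpose A *v q s + (- transpose H) *v u s)"
  define p where "p = (\<lambda>s. k (T - s))"
  have qL': "q \<in> L2 {0..T}" and uL: "u \<in> L2 {0..T}" unfolding q_def u_def using L2_reflect qL UL by blast+
  have kL: "k \<in> L2 {0..T}" unfolding k_def by (rule L2_add[OF L2_matrix[OF qL'] L2_matrix[OF uL]])
  have pL: "p \<in> L2 {0..T}" unfolding p_def by (rule L2_reflect[OF kL])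
  have p: "p t = transpose A *v qt t + (- transpose H) *v U t" for t by (simp add: p_def k_def q_def u_def)
  have pk: "prim p T = prim k T" unfolding p_def prim_def by (rule integral_reflect)
  have intL: "integrable M (\<lambda>t. a t \<bullet> b t)" if "a \<in> L2 {0..T}" "b \<in> L2 {0..T}"
    for a b :: "real \<Rightarrow> 'a::euclidean_space"
    unfolding M_def using that by (rule L2_inner_integrable)
  have test: "(transpose F *v l) \<bullet> (a + prim \<xi> T) + (LINT t|M. (a + prim \<xi> t) \<bullet> p t) =
      (transpose F *v d) \<bullet> a + (LINT t|M. (transpose F *v qt t) \<bullet> \<xi> t)" if \<xi>: "\<xi> \<in> L2 {0..T}" for a \<xi>
  proof -
    define x where "x = (\<lambda>t. a + prim \<xi> t)"
    define f where "f = (\<lambda>t. F *v \<xi> t - A *v x t)"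
    have xL: "x \<in> L2 {0..T}" unfolding x_def by (rule prim_L2[OF \<xi>])
    have fL: "f \<in> L2 {0..T}" unfolding f_def by (rule L2_diff[OF L2_matrix[OF \<xi>] L2_matrix[OF xL]])
    have Axf: "(\<lambda>s. A *v x s + f s) = (\<lambda>s. F *v \<xi> s)" by (simp add: f_def)
    have "F *v x t = F *v a + prim (\<lambda>s. A *v x s + f s) t" if "t \<in> {0..T}" for t
      using prim_matrix[OF \<xi>, of t F] that unfolding Axf by (simp add: x_def matrix_vector_right_distrib)
    then have "dae_traj F A T (F *v a) x f"
      unfolding dae_traj_def using xL fL by auto
    from rep[OF this] have "l \<bullet> (F *v a + F *v prim \<xi> T) - (LINT t|M. (H *v x t) \<bullet> U t) =
        d \<bullet> (F *v a) + (LINT t|M. qt t \<bullet> f t)"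
      unfolding Axf prim_matrix[OF \<xi> order_refl] M_def .
    moreover have "l \<bullet> (F *v a + F *v prim \<xi> T) = (transpose F *v l) \<bullet> (a + prim \<xi> T)"
      by (simp only: inner_matrix_transpose[symmetric] matrix_vector_right_distrib)
    moreover have "d \<bullet> (F *v a) = (transpose F *v d) \<bullet> a" by (rule inner_matrix_transpose)
    moreover have "(LINT t|M. qt t \<bullet> f t) = (LINT t|M. (transpose F *v qt t) \<bullet> \<xi> t) - (LINT t|M. qt t \<bullet> (A *v x t))"
    proof -
      have "qt t \<bullet> f t = (transpose F *v qt t) \<bullet> \<xi> t - qt t \<bullet> (A *v x t)" for t
        by (simp only: f_def inner_diff_right inner_matrix_transpose[of _ F])
      then show ?thesis
        using Bochner_Integration.integral_diff[OF intL[OF L2_matrix[OF qL, of "transpose F"] \<xi>] intL[OF qL L2_matrix[OF xL]]] by simp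
    qed
    moreover have "(LINT t|M. x t \<bullet> p t) = (LINT t|M. qt t \<bullet> (A *v x t)) - (LINT t|M. (H *v x t) \<bullet> U t)"
    proof -
      have "x t \<bullet> p t = qt t \<bullet> (A *v x t) - (H *v x t) \<bullet> U t" for t
        using inner_matrix_transpose[of "qt t" A "x t"] inner_matrix_transpose[of "U t" H "x t"]
        by (simp only: p uminus_matrix_vector_mult inner_add_right inner_minus_right inner_commute[of "x t"] inner_commute[of _ "U t"])
      then show ?thesis
        using Bochner_Integration.integral_diff[OF intL[OF qL L2_matrix[OF xL]] intL[OF L2_matrix[OF xL] UL]] by simp
    qed
    ultimately show ?thesis unfolding x_def by linarith
  qed
  have end_value: "transpose F *v l + prim k T = transpose F *v d"
  proof -
    \<comment> \<open>Constant test functions give the end value.\<close>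
  define g where "g = transpose F *v l + prim k T - transpose F *v d"
    have "(LINT t|M. g \<bullet> p t) = g \<bullet> prim k T"
      using L2_integrable[OF pL] pk by (simp add: M_def prim_def)
    then have "(transpose F *v l) \<bullet> g + g \<bullet> prim k T = (transpose F *v d) \<bullet> g"
      using test[OF L2_0, of g] by (simp add: prim_def del: transpose_matrix_vector)
    then have "g \<bullet> g = 0" by (simp add: g_def inner_simps inner_commute del: transpose_matrix_vector)
    then show ?thesis by (simp only: g_def inner_eq_zero_iff right_minus_eq)
  qed
  \<comment> \<open>The residual of the dual equation, reflected; it is also its own test function.\<close>
  define g where "g = (\<lambda>s. transpose F *v l + prim k (T - s) - transpose F *v qt s)"
  have prL: "(\<lambda>s. transpose F *v l + prim k (T - s)) \<in> L2 {0..T}"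
    using L2_reflect[OF prim_L2[OF kL, of "transpose F *v l"]] .
  have gL: "g \<in> L2 {0..T}" unfolding g_def by (rule L2_diff[OF prL L2_matrix[OF qL]])
  have "(LINT t|M. g t \<bullet> g t) = 0"
  proof -
    have a: "(LINT t|M. prim g t \<bullet> p t) = (LINT s|M. g s \<bullet> prim k (T - s))"
    proof -
      have "(LINT t|M. prim g t \<bullet> p t) = (LINT t|M. prim g (T - t) \<bullet> k t)"
        using integral_reflect[where T=T and g="\<lambda>t. prim g t \<bullet> p t"] by (simp add: M_def p_def)
      also have "\<dots> = (LINT s|M. g s \<bullet> prim k (T - s))"
        unfolding M_def using integral_inner_prim_swap[OF gL kL] by (simp add: inner_commute)
      finally show ?thesis .
    qed
    have b: "(LINT s|M. g s \<bullet> (transpose F *v l)) = (transpose F *v l) \<bullet> prim g T"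
      using L2_integrable[OF gL] by (simp add: M_def prim_def inner_commute del: transpose_matrix_vector)
    have prkL: "(\<lambda>s. prim k (T - s)) \<in> L2 {0..T}"
      using L2_reflect[OF prim_L2[OF kL, of 0]] by simp
    have "(LINT t|M. g t \<bullet> g t) = (LINT t|M. g t \<bullet> (transpose F *v l) + g t \<bullet> prim k (T - t) - g t \<bullet> (transpose F *v qt t))"
      by (intro Bochner_Integration.integral_cong refl) (simp only: g_def inner_add_right inner_diff_right)
    also have "\<dots> = (LINT t|M. g t \<bullet> (transpose F *v l)) + (LINT t|M. g t \<bullet> prim k (T - t)) - (LINT t|M. g t \<bullet> (transpose F *v qt t))"
      by (simp only: Bochner_Integration.integral_diff Bochner_Integration.integral_add Bochner_Integration.integrable_add
          intL[OF gL L2_const] intL[OF gL prkL] intL[OF gL L2_matrix[OF qL]])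
    also have "\<dots> = 0"
      using test[OF gL, of 0] a b by (simp add: inner_commute del: transpose_matrix_vector)
    finally show ?thesis .
  qed
  then have "AE t in M. g t \<bullet> g t = 0"
    using integral_nonneg_eq_0_iff_AE[OF intL[OF gL gL]] by simp
  then have "AE t in lebesgue_on {0..T}. g (T - t) \<bullet> g (T - t) = 0"
    unfolding M_def by (rule AE_reflect)
  then have "AE t in lebesgue_on {0..T}. transpose F *v q t = transpose F *v l + prim k t"
    by (rule lebesgue_on_mono) (simp add: g_def q_def del: transpose_matrix_vector)
  then have tr: "dae_traj (transpose F) (transpose A) T (transpose F *v l) q (\<lambda>s. (- transpose H) *v u s)"
    unfolding dae_traj_def k_def using qL' L2_matrix[OF uL] by blast
  then show "(q, u) \<in> dual_set F A H l T" unfolding dual_set_iff[OF T] using uL by blast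
  have "ac_version {0..T} (\<lambda>t. transpose F *v q t) T = transpose F *v l + prim k T"
    unfolding k_def by (rule dae_traj_ac_version(2)[OF tr T]) (use T in simp)
  then show "ac_version {0..T} (\<lambda>t. transpose F *v q t) T = transpose F *v d"
    by (simp only: end_value)
qed

text \<open>The element \<open>(d, g, \<theta>)\<close> represents the functional in the form of the admissibility condition. The
  inequality is due to the terminal cost, for which \<open>Q\<^sub>0 d\<close> is a solution of \<open>F\<^sup>T e = F\<^sup>T q(T)\<close>, though
  not necessarily the cheapest one.\<close>

lemma dual_cost_of_representation:
  fixes F A :: "real^'n^'m" and H :: "real^'n^'p"
  assumes Q0: "sym_pos_def Q0" and Q: "sym_pos_def Q" and R: "sym_pos_def R" and T: "0 < T"
    and z: "(d, g, \<theta>) \<in> triples T" and UL: "U \<in> L2 {0..T}"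
    and U: "AE t in lebesgue_on {0..T}. U t = - (R *v \<theta> t)"
    and rep: "\<And>c x f. dae_traj F A T c x f \<Longrightarrow>
      l \<bullet> (c + prim (\<lambda>s. A *v x s + f s) T) - (LINT t|lebesgue_on {0..T}. (H *v x t) \<bullet> U t) =
      d \<bullet> (Q0 *v c) + (LINT t|lebesgue_on {0..T}. g t \<bullet> (Q *v f t))"
  obtains q u where "(q, u) \<in> dual_set F A H l T" "is_reflection T U u"
    "dual_cost F Q0 Q R q u T \<le> triple_form Q0 Q R T (d, g, \<theta>) (d, g, \<theta>)"
proof -
  have gL: "g \<in> L2 {0..T}" and \<theta>L: "\<theta> \<in> L2 {0..T}" using z by (auto simp: triples_def)
  define q where "q = (\<lambda>t. Q *v g (T - t))"
  define u where "u = (\<lambda>t. U (T - t))"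
  have rep': "l \<bullet> (c + prim (\<lambda>s. A *v x s + f s) T) - (LINT t|lebesgue_on {0..T}. (H *v x t) \<bullet> U t) =
      (Q0 *v d) \<bullet> c + (LINT t|lebesgue_on {0..T}. (Q *v g t) \<bullet> f t)" if "dae_traj F A T c x f" for c x f
    using rep[OF that] sym_pos_def_inner_commute[OF Q0, of d c] sym_pos_def_inner_commute[OF Q, of "g _" "f _"]
    by (simp add: inner_commute)
  note dual = dual_solution_of_representation[OF T L2_matrix[OF gL] UL rep']
  have qu: "(q, u) \<in> dual_set F A H l T" using dual(1) by (simp only: q_def u_def)
  have qL: "q \<in> L2 {0..T}" unfolding q_def using L2_reflect[OF L2_matrix[OF gL]] .
  have uL: "u \<in> L2 {0..T}" unfolding u_def by (rule L2_reflect[OF UL])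
  define w where "w = transpose F *v (Q0 *v d)"
  have acq: "ac_version {0..T} (\<lambda>t. transpose F *v q t) T = w"
    using dual(2) by (simp only: q_def w_def)
  obtain e where "w \<bullet> (Qbar0_core F Q0 *v w) = e \<bullet> (matrix_inv Q0 *v e)"
    "e \<bullet> (matrix_inv Q0 *v e) \<le> (Q0 *v d) \<bullet> (matrix_inv Q0 *v (Q0 *v d))"
    using terminal_minimiser[OF Q0 w_def[symmetric]] by metis
  then have 0: "w \<bullet> (Qbar0_core F Q0 *v w) \<le> d \<bullet> (Q0 *v d)"
    by (simp add: sym_pos_def_matrix_inv(3)[OF Q0] inner_commute)
  have 1: "(LINT t|lebesgue_on {0..T}. q t \<bullet> (matrix_inv Q *v q t)) = (LINT t|lebesgue_on {0..T}. g t \<bullet> (Q *v g t))"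
    using integral_reflect[where T=T and g="\<lambda>t. g t \<bullet> (Q *v g t)"]
    by (simp add: q_def sym_pos_def_matrix_inv(3)[OF Q] inner_commute)
  have "AE t in lebesgue_on {0..T}. u t = - (R *v \<theta> (T - t))"
    unfolding u_def using U by (rule AE_reflect)
  then have "AE t in lebesgue_on {0..T}. u t \<bullet> (matrix_inv R *v u t) = \<theta> (T - t) \<bullet> (R *v \<theta> (T - t))"
  proof eventually_elim
    case (elim t)
    have "matrix_inv R *v u t = - \<theta> (T - t)"
      using matrix_vector_mult_scaleR[of "matrix_inv R" "-1" "R *v \<theta> (T - t)"]
      by (simp add: elim sym_pos_def_matrix_inv(3)[OF R])
    then show ?case by (simp add: elim inner_commute)
  qed
  then have "(LINT t|lebesgue_on {0..T}. u t \<bullet> (matrix_inv R *v u t)) = (LINT t|lebesgue_on {0..T}. \<theta> (T - t) \<bullet> (R *v \<theta> (T - t)))"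
  proof (rule integral_cong_AE[rotated 2])
    show "(\<lambda>t. u t \<bullet> (matrix_inv R *v u t)) \<in> borel_measurable (lebesgue_on {0..T})"
      by (rule borel_measurable_integrable[OF L2_inner_integrable[OF uL L2_matrix[OF uL]]])
    show "(\<lambda>t. \<theta> (T - t) \<bullet> (R *v \<theta> (T - t))) \<in> borel_measurable (lebesgue_on {0..T})"
      by (rule borel_measurable_integrable[OF L2_inner_integrable[OF L2_reflect[OF \<theta>L] L2_matrix[OF L2_reflect[OF \<theta>L]]]])
  qed
  then have 2: "(LINT t|lebesgue_on {0..T}. u t \<bullet> (matrix_inv R *v u t)) = (LINT t|lebesgue_on {0..T}. \<theta> t \<bullet> (R *v \<theta> t))"
    using integral_reflect[where T=T and g="\<lambda>t. \<theta> t \<bullet> (R *v \<theta> t)"] by simp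
  have "(LINT t|lebesgue_on {0..T}. q t \<bullet> (matrix_inv Q *v q t) + u t \<bullet> (matrix_inv R *v u t)) =
      (LINT t|lebesgue_on {0..T}. q t \<bullet> (matrix_inv Q *v q t)) + (LINT t|lebesgue_on {0..T}. u t \<bullet> (matrix_inv R *v u t))"
    by (intro Bochner_Integration.integral_add L2_inner_integrable L2_matrix qL uL)
  then have "dual_cost F Q0 Q R q u T \<le> triple_form Q0 Q R T (d, g, \<theta>) (d, g, \<theta>)"
    unfolding dual_cost_def Let_def acq triple_form_def prod.case using 0 1 2 by linarith
  moreover have "is_reflection T U u" by (simp add: is_reflection_def u_def)
  ultimately show thesis using that qu by blast
qed

section \<open>Strong duality and the minimax observer\<close>

text \<open>The value of \<open>F x\<close> at \<open>T\<close> for a trajectory with initial value \<open>c\<close>. The matrix \<open>F\<close> enters only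
  through \<open>dae_traj\<close>.\<close>

definition final_value ::
  "real^'n^'m \<Rightarrow> real \<Rightarrow> real^'m \<Rightarrow> (real \<Rightarrow> real^'n) \<Rightarrow> (real \<Rightarrow> real^'m) \<Rightarrow> real^'m" where
  "final_value A T c x f = c + prim (\<lambda>s. A *v x s + f s) T"

lemma final_value_lincomb:
  assumes 1: "dae_traj E A T c x f" and 2: "dae_traj E A T c' x' f'"
  shows "final_value A T (a *\<^sub>R c + b *\<^sub>R c') (\<lambda>t. a *\<^sub>R x t + b *\<^sub>R x' t) (\<lambda>t. a *\<^sub>R f t + b *\<^sub>R f' t) =
    a *\<^sub>R final_value A T c x f + b *\<^sub>R final_value A T c' x' f'"
proof -
  have "(\<lambda>s. A *v (a *\<^sub>R x s + b *\<^sub>R x' s) + (a *\<^sub>R f s + b *\<^sub>R f' s))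
      = (\<lambda>s. a *\<^sub>R (A *v x s + f s) + b *\<^sub>R (A *v x' s + f' s))"
    by (simp add: fun_eq_iff matrix_vector_right_distrib matrix_vector_mult_scaleR scaleR_add_right)
  then show ?thesis
    using prim_lincomb[OF dae_trajD(3)[OF 1] dae_trajD(3)[OF 2] order_refl, of a b]
    by (simp add: final_value_def scaleR_add_right)
qed

lemma dae_traj_0: "dae_traj E A T 0 (\<lambda>t. 0) (\<lambda>t. 0)"
  by (simp add: dae_traj_def L2_0 prim_def)

lemma obs_error_le_iff:
  assumes Q: "sym_pos_def Q" and R: "sym_pos_def R" and T: "0 < T"
  shows "obs_error F A H Q0 Q R U l T \<le> ereal C \<longleftrightarrow>
    (\<forall>c x f y \<eta>. dae_traj F A T c x f \<longrightarrow> y \<in> L2 {0..T} \<longrightarrow> \<eta> \<in> L2 {0..T} \<longrightarrow>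
      (AE t in lebesgue_on {0..T}. y t = H *v x t + \<eta> t) \<longrightarrow>
      triple_form Q0 Q R T (c, f, \<eta>) (c, f, \<eta>) \<le> 1 \<longrightarrow>
      (l \<bullet> final_value A T c x f - obs U T y)\<^sup>2 \<le> C)" (is "?L \<longleftrightarrow> ?R")
proof -
  have ac: "ac_version {0..T} (\<lambda>t. F *v x t) T = final_value A T c x f" if "dae_traj F A T c x f" for c x f
    unfolding final_value_def by (rule dae_traj_ac_version(2)[OF that T]) (use T in simp)
  have "?L \<longleftrightarrow> (\<forall>x f y \<eta>. (x, f, y, \<eta>) \<in> EE F A H Q0 Q R T \<longrightarrow>
      (l \<bullet> ac_version {0..T} (\<lambda>t. F *v x t) T - obs U T y)\<^sup>2 \<le> C)"
    unfolding obs_error_def SUP_le_iff Ball_def split_paired_All prod.case ereal_less_eq ..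
  also have "\<dots> \<longleftrightarrow> ?R"
  proof
    assume *: "\<forall>x f y \<eta>. (x, f, y, \<eta>) \<in> EE F A H Q0 Q R T \<longrightarrow>
      (l \<bullet> ac_version {0..T} (\<lambda>t. F *v x t) T - obs U T y)\<^sup>2 \<le> C"
    show ?R
    proof (intro allI impI)
      fix c x f y \<eta>
      assume a: "dae_traj F A T c x f" "y \<in> L2 {0..T}" "\<eta> \<in> L2 {0..T}"
        "AE t in lebesgue_on {0..T}. y t = H *v x t + \<eta> t" "triple_form Q0 Q R T (c, f, \<eta>) (c, f, \<eta>) \<le> 1"
      then have "(x, f, y, \<eta>) \<in> EE F A H Q0 Q R T" unfolding EE_iff[OF Q R T] by blast
      with * show "(l \<bullet> final_value A T c x f - obs U T y)\<^sup>2 \<le> C" using ac[OF a(1)] by metis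
    qed
  next
    assume *: ?R
    show "\<forall>x f y \<eta>. (x, f, y, \<eta>) \<in> EE F A H Q0 Q R T \<longrightarrow>
      (l \<bullet> ac_version {0..T} (\<lambda>t. F *v x t) T - obs U T y)\<^sup>2 \<le> C"
    proof (intro allI impI)
      fix x f y \<eta> assume "(x, f, y, \<eta>) \<in> EE F A H Q0 Q R T"
      then obtain c where "dae_traj F A T c x f" "y \<in> L2 {0..T}" "\<eta> \<in> L2 {0..T}"
        "AE t in lebesgue_on {0..T}. y t = H *v x t + \<eta> t" "triple_form Q0 Q R T (c, f, \<eta>) (c, f, \<eta>) \<le> 1"
        unfolding EE_iff[OF Q R T] by blast
      then show "(l \<bullet> ac_version {0..T} (\<lambda>t. F *v x t) T - obs U T y)\<^sup>2 \<le> C"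
        using * ac[of c x f] by simp
    qed
  qed
  finally show ?thesis .
qed

lemma obs_error_nonneg:
  assumes Q: "sym_pos_def Q" and R: "sym_pos_def R" and T: "0 < T"
  shows "0 \<le> obs_error F A H Q0 Q R U l T"
proof -
  have "\<not> obs_error F A H Q0 Q R U l T \<le> ereal C" if "C < 0" for C
  proof
    assume "obs_error F A H Q0 Q R U l T \<le> ereal C"
    note bound = this[unfolded obs_error_le_iff[OF Q R T], rule_format]
    have "(l \<bullet> final_value A T 0 (\<lambda>t. 0) (\<lambda>t. 0) - obs U T (\<lambda>t. 0))\<^sup>2 \<le> C"
      by (rule bound[OF dae_traj_0 L2_0 L2_0]) (simp_all add: triple_form_def)
    with that show False using zero_le_power2 by (metis not_le order_trans)
  qed
  note nle = this
  show ?thesis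
  proof (rule ccontr)
    assume "\<not> 0 \<le> obs_error F A H Q0 Q R U l T"
    then obtain C where "obs_error F A H Q0 Q R U l T < ereal C" "ereal C < 0"
      using ereal_dense2 not_le by metis
    then show False using nle[of C] by simp
  qed
qed

text \<open>Strong duality for a fixed \<open>U\<close>. A finite error makes the error functional bounded. Its Riesz
  representative \<open>(d, g, \<theta>)\<close> satisfies \<open>U = - R \<theta>\<close>, because the noise may be chosen freely, and
  then yields a dual solution for \<open>U\<close>.\<close>

lemma strong_duality:
  fixes F A :: "real^'n^'m" and H :: "real^'n^'p"
  assumes Q0: "sym_pos_def Q0" and Q: "sym_pos_def Q" and R: "sym_pos_def R" and T: "0 < T"
    and UL: "U \<in> L2 {0..T}" and C: "obs_error F A H Q0 Q R U l T \<le> ereal C"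
  obtains q u where "(q, u) \<in> dual_set F A H l T" "is_reflection T U u" "dual_cost F Q0 Q R q u T \<le> C"
proof -
  interpret complete_form "triples T" triple_lc "triple_form Q0 Q R T"
    by (rule complete_form_triples[OF Q0 Q R])
  define err where "err = (\<lambda>c x f \<eta>. l \<bullet> final_value A T c x f - (LINT t|lebesgue_on {0..T}. (H *v x t + \<eta> t) \<bullet> U t))"
  define G where "G = {((c, f, \<eta>), err c x f \<eta>) | c x f \<eta>. dae_traj F A T c x f \<and> \<eta> \<in> L2 {0..T}}"
  have GI: "((c, f, \<eta>), err c x f \<eta>) \<in> G" if "dae_traj F A T c x f" "\<eta> \<in> L2 {0..T}" for c x f \<eta>
    using that unfolding G_def by blast
  have GV: "v \<in> triples T" if "(v, e) \<in> G" for v e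
    using that unfolding G_def triples_def by (auto dest: dae_trajD(2))
  have yint: "integrable (lebesgue_on {0..T}) (\<lambda>t. (H *v x t + \<eta> t) \<bullet> U t)"
    if "dae_traj F A T c x f" "\<eta> \<in> L2 {0..T}" for c x f \<eta>
    by (rule L2_inner_integrable[OF L2_add[OF L2_matrix[OF dae_trajD(1)[OF that(1)]] that(2)] UL])
  have lin: "(triple_lc a v b w, a * e + b * e') \<in> G" if ve: "(v, e) \<in> G" and we: "(w, e') \<in> G" for v e w e' a b
  proof -
    obtain c x f \<eta> where 1: "v = (c, f, \<eta>)" "e = err c x f \<eta>" "dae_traj F A T c x f" "\<eta> \<in> L2 {0..T}"
      using ve unfolding G_def by blast
    obtain c' x' f' \<eta>' where 2: "w = (c', f', \<eta>')" "e' = err c' x' f' \<eta>'" "dae_traj F A T c' x' f'" "\<eta>' \<in> L2 {0..T}"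
      using we unfolding G_def by blast
    have "(H *v (a *\<^sub>R x t + b *\<^sub>R x' t) + (a *\<^sub>R \<eta> t + b *\<^sub>R \<eta>' t)) \<bullet> U t
        = a * ((H *v x t + \<eta> t) \<bullet> U t) + b * ((H *v x' t + \<eta>' t) \<bullet> U t)" for t
      by (simp add: matrix_vector_right_distrib matrix_vector_mult_scaleR inner_add_left algebra_simps)
    then have "err (a *\<^sub>R c + b *\<^sub>R c') (\<lambda>t. a *\<^sub>R x t + b *\<^sub>R x' t) (\<lambda>t. a *\<^sub>R f t + b *\<^sub>R f' t)
        (\<lambda>t. a *\<^sub>R \<eta> t + b *\<^sub>R \<eta>' t) = a * e + b * e'"
      unfolding err_def final_value_lincomb[OF 1(3) 2(3)] 1(2) 2(2)
      using yint[OF 1(3,4)] yint[OF 2(3,4)] by (simp add: inner_add_right right_diff_distrib)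
    then show ?thesis
      using GI[OF dae_traj_lincomb[OF 1(3) 2(3), of a b] L2_lincomb[OF 1(4) 2(4), of a b]]
      by (simp add: 1(1) 2(1) triple_lc_def)
  qed
  have unit: "e\<^sup>2 \<le> C" if ve: "(v, e) \<in> G" and v1: "triple_form Q0 Q R T v v \<le> 1" for v e
  proof -
    obtain c x f \<eta> where 1: "v = (c, f, \<eta>)" "e = err c x f \<eta>" "dae_traj F A T c x f" "\<eta> \<in> L2 {0..T}"
      using ve unfolding G_def by blast
    have "(l \<bullet> final_value A T c x f - obs U T (\<lambda>t. H *v x t + \<eta> t))\<^sup>2 \<le> C"
      using C 1 v1 L2_add[OF L2_matrix[OF dae_trajD(1)[OF 1(3)], of H] 1(4)]
      unfolding obs_error_le_iff[OF Q R T] by auto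
    then show ?thesis by (simp add: 1(2) err_def obs_def)
  qed
  have bd: "e\<^sup>2 \<le> C * triple_form Q0 Q R T v v" if "(v, e) \<in> G" for v e
    by (rule form_bound_from_unit_ball[OF that GV lin unit])
  have C0: "0 \<le> C" using obs_error_nonneg[OF Q R T, of F A H Q0 U l] C by (metis ereal_less_eq(5) order_trans)
  have ne: "G \<noteq> {}" using GI[OF dae_traj_0 L2_0] by blast
  have "\<exists>z\<in>triples T. (\<forall>v e. (v, e) \<in> G \<longrightarrow> e = triple_form Q0 Q R T z v) \<and>
      (\<forall>C'\<ge>0. (\<forall>v e. (v, e) \<in> G \<longrightarrow> e\<^sup>2 \<le> C' * triple_form Q0 Q R T v v) \<longrightarrow> triple_form Q0 Q R T z z \<le> C')"
    by (rule riesz_representation[where C = C]) (fact ne GV lin bd C0)+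
  then obtain z where z: "z \<in> triples T" and rep: "\<And>v e. (v, e) \<in> G \<Longrightarrow> e = triple_form Q0 Q R T z v"
    and min: "\<And>C'. 0 \<le> C' \<Longrightarrow> (\<And>v e. (v, e) \<in> G \<Longrightarrow> e\<^sup>2 \<le> C' * triple_form Q0 Q R T v v) \<Longrightarrow> triple_form Q0 Q R T z z \<le> C'"
    by blast
  obtain d g \<theta> where dg: "z = (d, g, \<theta>)" by (cases z)
  have \<theta>L: "\<theta> \<in> L2 {0..T}" using z by (auto simp: dg triples_def)
  have noise: "(LINT t|lebesgue_on {0..T}. (U t + R *v \<theta> t) \<bullet> \<eta> t) = 0" if \<eta>: "\<eta> \<in> L2 {0..T}" for \<eta>
  proof -
    have "- (LINT t|lebesgue_on {0..T}. \<eta> t \<bullet> U t) = (LINT t|lebesgue_on {0..T}. \<theta> t \<bullet> (R *v \<eta> t))"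
      using rep[OF GI[OF dae_traj_0 \<eta>]] by (simp add: err_def final_value_def prim_def dg triple_form_def)
    moreover have "(LINT t|lebesgue_on {0..T}. (U t + R *v \<theta> t) \<bullet> \<eta> t) =
        (LINT t|lebesgue_on {0..T}. \<eta> t \<bullet> U t) + (LINT t|lebesgue_on {0..T}. \<eta> t \<bullet> (R *v \<theta> t))"
      using L2_inner_integrable[OF \<eta> UL] L2_inner_integrable[OF \<eta> L2_matrix[OF \<theta>L, of R]]
      by (simp add: inner_add_right inner_commute[of _ "\<eta> _"])
    ultimately show ?thesis using weighted_integral_commute[OF R, of _ \<theta> \<eta>] by simp
  qed
  have UR: "(\<lambda>t. U t + R *v \<theta> t) \<in> L2 {0..T}" by (rule L2_add[OF UL L2_matrix[OF \<theta>L]])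
  have "AE t in lebesgue_on {0..T}. (U t + R *v \<theta> t) \<bullet> (U t + R *v \<theta> t) = 0"
    using noise[OF UR] integral_nonneg_eq_0_iff_AE[OF L2_inner_integrable[OF UR UR]] by simp
  then have U: "AE t in lebesgue_on {0..T}. U t = - (R *v \<theta> t)"
    by (rule lebesgue_on_mono) (simp add: eq_neg_iff_add_eq_0)
  have "l \<bullet> (c + prim (\<lambda>s. A *v x s + f s) T) - (LINT t|lebesgue_on {0..T}. (H *v x t) \<bullet> U t) =
      d \<bullet> (Q0 *v c) + (LINT t|lebesgue_on {0..T}. g t \<bullet> (Q *v f t))" if "dae_traj F A T c x f" for c x f
    using rep[OF GI[OF that L2_0]] by (simp add: err_def final_value_def dg triple_form_def)
  then obtain q u where "(q, u) \<in> dual_set F A H l T" "is_reflection T U u"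
    "dual_cost F Q0 Q R q u T \<le> triple_form Q0 Q R T (d, g, \<theta>) (d, g, \<theta>)"
    using dual_cost_of_representation[OF Q0 Q R T z[unfolded dg] UL U] by blast
  moreover have "triple_form Q0 Q R T (d, g, \<theta>) (d, g, \<theta>) \<le> C" using min[OF C0 bd] by (simp add: dg)
  ultimately show thesis using that by (meson order_trans)
qed

text \<open>A dual solution that is optimal for all \<open>U\<close> at once comes from the trajectories with output
  \<open>y = 0\<close>, that is \<open>\<eta> = - H x\<close>, on which the error does not depend on \<open>U\<close>.\<close>

lemma optimal_dual_solution:
  fixes F A :: "real^'n^'m" and H :: "real^'n^'p"
  assumes Q0: "sym_pos_def Q0" and Q: "sym_pos_def Q" and R: "sym_pos_def R" and T: "0 < T"
    and fin: "obs_error F A H Q0 Q R U0 l T \<le> ereal C0"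
  obtains q u where "(q, u) \<in> dual_set F A H l T"
    "\<And>U C. obs_error F A H Q0 Q R U l T \<le> ereal C \<Longrightarrow> dual_cost F Q0 Q R q u T \<le> C"
proof -
  interpret complete_form "triples T" triple_lc "triple_form Q0 Q R T"
    by (rule complete_form_triples[OF Q0 Q R])
  define G where "G = {((c, f, \<lambda>t. - (H *v x t)), l \<bullet> final_value A T c x f) | c x f. dae_traj F A T c x f}"
  have GI: "((c, f, \<lambda>t. - (H *v x t)), l \<bullet> final_value A T c x f) \<in> G" if "dae_traj F A T c x f" for c x f
    using that unfolding G_def by blast
  have HL: "(\<lambda>t. - (H *v x t)) \<in> L2 {0..T}" if "dae_traj F A T c x f" for c x f
    using L2_diff[OF L2_0 L2_matrix[OF dae_trajD(1)[OF that], of H]] by simp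
  have GV: "v \<in> triples T" if "(v, e) \<in> G" for v e
    using that HL unfolding G_def triples_def by (auto dest: dae_trajD(2))
  have lin: "(triple_lc a v b w, a * e + b * e') \<in> G" if ve: "(v, e) \<in> G" and we: "(w, e') \<in> G" for v e w e' a b
  proof -
    obtain c x f where 1: "v = (c, f, \<lambda>t. - (H *v x t))" "e = l \<bullet> final_value A T c x f" "dae_traj F A T c x f"
      using ve unfolding G_def by blast
    obtain c' x' f' where 2: "w = (c', f', \<lambda>t. - (H *v x' t))" "e' = l \<bullet> final_value A T c' x' f'" "dae_traj F A T c' x' f'"
      using we unfolding G_def by blast
    have eq: "(\<lambda>t. - (H *v (a *\<^sub>R x t + b *\<^sub>R x' t))) = (\<lambda>t. a *\<^sub>R (- (H *v x t)) + b *\<^sub>R (- (H *v x' t)))"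
      by (simp add: fun_eq_iff matrix_vector_right_distrib matrix_vector_mult_scaleR)
    show ?thesis
      using GI[OF dae_traj_lincomb[OF 1(3) 2(3), of a b]] unfolding final_value_lincomb[OF 1(3) 2(3)] eq
      by (simp only: 1(1,2) 2(1,2) triple_lc_def prod.case inner_add_right inner_scaleR_right)
  qed
  have bound: "e\<^sup>2 \<le> C * triple_form Q0 Q R T v v"
    if C: "obs_error F A H Q0 Q R U l T \<le> ereal C" and ve: "(v, e) \<in> G" for U C v e
  proof (rule form_bound_from_unit_ball[OF ve GV lin])
    fix v e assume "(v, e) \<in> G" and unit: "triple_form Q0 Q R T v v \<le> 1"
    then obtain c x f where 1: "v = (c, f, \<lambda>t. - (H *v x t))" "e = l \<bullet> final_value A T c x f" "dae_traj F A T c x f"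
      unfolding G_def by blast
    have "(l \<bullet> final_value A T c x f - obs U T (\<lambda>t. 0))\<^sup>2 \<le> C"
      by (rule C[unfolded obs_error_le_iff[OF Q R T], rule_format, OF 1(3) L2_0 HL[OF 1(3)] _ unit[unfolded 1(1)]]) simp
    then show "e\<^sup>2 \<le> C" by (simp add: 1(2) obs_def)
  qed
  have nn: "0 \<le> C" if "obs_error F A H Q0 Q R U l T \<le> ereal C" for U C
    using obs_error_nonneg[OF Q R T, of F A H Q0 U l] that by (metis ereal_less_eq(5) order_trans)
  have ne: "G \<noteq> {}" using GI[OF dae_traj_0] by blast
  have "\<exists>z\<in>triples T. (\<forall>v e. (v, e) \<in> G \<longrightarrow> e = triple_form Q0 Q R T z v) \<and>
      (\<forall>C'\<ge>0. (\<forall>v e. (v, e) \<in> G \<longrightarrow> e\<^sup>2 \<le> C' * triple_form Q0 Q R T v v) \<longrightarrow> triple_form Q0 Q R T z z \<le> C')"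
    by (rule riesz_representation[where C = C0]) (fact ne GV lin bound[OF fin] nn[OF fin])+
  then obtain z where z: "z \<in> triples T" and rep: "\<And>v e. (v, e) \<in> G \<Longrightarrow> e = triple_form Q0 Q R T z v"
    and min: "\<And>C'. 0 \<le> C' \<Longrightarrow> (\<And>v e. (v, e) \<in> G \<Longrightarrow> e\<^sup>2 \<le> C' * triple_form Q0 Q R T v v) \<Longrightarrow> triple_form Q0 Q R T z z \<le> C'"
    by blast
  obtain d g \<theta> where dg: "z = (d, g, \<theta>)" by (cases z)
  have \<theta>L: "\<theta> \<in> L2 {0..T}" using z by (auto simp: dg triples_def)
  define U where "U = (\<lambda>t. - (R *v \<theta> t))"
  have UL: "U \<in> L2 {0..T}" unfolding U_def using L2_diff[OF L2_0 L2_matrix[OF \<theta>L, of R]] by simp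
  have "l \<bullet> (c + prim (\<lambda>s. A *v x s + f s) T) - (LINT t|lebesgue_on {0..T}. (H *v x t) \<bullet> U t) =
      d \<bullet> (Q0 *v c) + (LINT t|lebesgue_on {0..T}. g t \<bullet> (Q *v f t))" if "dae_traj F A T c x f" for c x f
  proof -
    have "(LINT t|lebesgue_on {0..T}. \<theta> t \<bullet> (R *v (- (H *v x t)))) = (LINT t|lebesgue_on {0..T}. (H *v x t) \<bullet> U t)"
      using weighted_integral_commute[OF R, of _ \<theta> "\<lambda>t. - (H *v x t)"] by (simp add: U_def)
    then show ?thesis using rep[OF GI[OF that]] by (simp add: final_value_def dg triple_form_def)
  qed
  moreover have "AE t in lebesgue_on {0..T}. U t = - (R *v \<theta> t)" by (simp add: U_def)
  ultimately obtain q u where "(q, u) \<in> dual_set F A H l T"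
    "dual_cost F Q0 Q R q u T \<le> triple_form Q0 Q R T (d, g, \<theta>) (d, g, \<theta>)"
    using dual_cost_of_representation[OF Q0 Q R T z[unfolded dg] UL] by blast
  moreover have "triple_form Q0 Q R T (d, g, \<theta>) (d, g, \<theta>) \<le> C" if "obs_error F A H Q0 Q R U l T \<le> ereal C" for U C
    using min[OF nn[OF that] bound[OF that]] by (simp add: dg)
  ultimately show thesis using that by (meson order_trans)
qed

lemma obs_error_le_dual_cost:
  assumes "sym_pos_def Q0" "sym_pos_def Q" "sym_pos_def R" "0 < T" "U \<in> L2 {0..T}"
    and "(q, u) \<in> dual_set F A H l T" "is_reflection T U u"
  shows "obs_error F A H Q0 Q R U l T \<le> ereal (dual_cost F Q0 Q R q u T)"
  unfolding obs_error_def
proof (rule SUP_least)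
  fix p assume "p \<in> EE F A H Q0 Q R T"
  then show "(case p of (x, f, y, \<eta>) \<Rightarrow> ereal ((l \<bullet> ac_version {0..T} (\<lambda>t. F *v x t) T - obs U T y)\<^sup>2))
      \<le> ereal (dual_cost F Q0 Q R q u T)"
    by (cases p) (simp add: weak_duality[OF assms])
qed

lemma impulse_observable_iff:
  assumes "0 < T"
  shows "impulse_observable F A H l \<longleftrightarrow> dual_set F A H l T \<noteq> {}"
proof
  assume "impulse_observable F A H l"
  then obtain \<tau> q u where \<tau>: "0 < \<tau>" "(q, u) \<in> dual_set F A H l \<tau>"
    unfolding impulse_observable_def by auto
  then have "transpose F *v l \<in> consistent (transpose F) (transpose A) (- transpose H) \<tau>"
    unfolding consistent_def dual_set_iff[OF \<tau>(1)] by blast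
  then have "transpose F *v l \<in> consistent (transpose F) (transpose A) (- transpose H) T"
    by (rule consistent_all_horizons[OF _ \<tau>(1)])
  then obtain q' u' where "(q', u') \<in> dual_set F A H l T"
    unfolding consistent_def dual_set_iff[OF assms] by blast
  then show "dual_set F A H l T \<noteq> {}" by blast
next
  assume "dual_set F A H l T \<noteq> {}"
  then show "impulse_observable F A H l" unfolding impulse_observable_def using assms by blast
qed

theorem theorem1:
  fixes F A :: "real^'n^'m" and H :: "real^'n^'p"
    and Q0 Q :: "real^'m^'m" and R :: "real^'p^'p"
    and l :: "real^'m" and t1 :: real
  assumes "sym_pos_def Q0" and "sym_pos_def Q" and "sym_pos_def R" and "0 < t1"
  shows
    "(impulse_observable F A H l
        \<longleftrightarrow> (\<exists>U\<in>L2 {0..t1}. obs_error F A H Q0 Q R U l t1 < \<infinity>))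
     \<and> ((\<exists>U\<in>L2 {0..t1}. obs_error F A H Q0 Q R U l t1 < \<infinity>)
        \<longleftrightarrow> (\<exists>V q u. minimax_observer F A H Q0 Q R l t1 V \<and>
              dual_optimal F A H Q0 Q R l t1 q u \<and>
              is_reflection t1 u V \<and>
              obs_error F A H Q0 Q R V l t1 = ereal (dual_cost F Q0 Q R q u t1)))
     \<and> (\<forall>U\<in>L2 {0..t1}.
          obs_error F A H Q0 Q R U l t1 =
            (INF (q, u)\<in>{(q, u)\<in>dual_set F A H l t1. is_reflection t1 U u}.
               ereal (dual_cost F Q0 Q R q u t1))
          \<and> ({(q, u)\<in>dual_set F A H l t1. is_reflection t1 U u} \<noteq> {}
             \<longleftrightarrow> obs_error F A H Q0 Q R U l t1 < \<infinity>))"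
proof -
  note pd = assms(1-3)
  let ?\<sigma> = "\<lambda>U. obs_error F A H Q0 Q R U l t1"
  let ?J = "\<lambda>q u. dual_cost F Q0 Q R q u t1"
  let ?D = "dual_set F A H l t1"
  have weak: "?\<sigma> U \<le> ereal (?J q u)" if "U \<in> L2 {0..t1}" "(q, u) \<in> ?D" "is_reflection t1 U u" for U q u
    using obs_error_le_dual_cost[OF assms(1-4) that] .
  have real: "\<exists>C. ?\<sigma> U = ereal C" if "?\<sigma> U < \<infinity>" for U
    using that obs_error_nonneg[OF assms(2-4), of F A H Q0 U l] by (cases "?\<sigma> U") auto
  have reflect: "(\<lambda>t. u (t1 - t)) \<in> L2 {0..t1}" "is_reflection t1 (\<lambda>t. u (t1 - t)) u" "is_reflection t1 u (\<lambda>t. u (t1 - t))"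
    if "(q, u) \<in> ?D" for q u
    using that L2_reflect[of u t1] unfolding dual_set_iff[OF assms(4)] by (auto simp: is_reflection_def)
  have moreover_part: "?\<sigma> U = (INF (q, u)\<in>{(q, u)\<in>?D. is_reflection t1 U u}. ereal (?J q u)) \<and>
      ({(q, u)\<in>?D. is_reflection t1 U u} \<noteq> {} \<longleftrightarrow> ?\<sigma> U < \<infinity>)" if U: "U \<in> L2 {0..t1}" for U
  proof -
    let ?DU = "{(q, u)\<in>?D. is_reflection t1 U u}"
    have le: "?\<sigma> U \<le> (INF (q, u)\<in>?DU. ereal (?J q u))"
    proof (rule INF_greatest)
      fix p assume "p \<in> ?DU"
      then obtain q u where "p = (q, u)" "(q, u) \<in> ?D" "is_reflection t1 U u" by blast
      then show "?\<sigma> U \<le> (case p of (q, u) \<Rightarrow> ereal (?J q u))" using weak[OF U, of q u] by simp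
    qed
    have strong: "\<exists>q u. (q, u) \<in> ?DU \<and> ereal (?J q u) \<le> ?\<sigma> U" if fin: "?\<sigma> U < \<infinity>"
    proof -
      obtain C where C: "?\<sigma> U = ereal C" using real[OF fin] ..
      then have leC: "?\<sigma> U \<le> ereal C" by simp
      obtain q u where "(q, u) \<in> ?D" "is_reflection t1 U u" "?J q u \<le> C"
        by (rule strong_duality[OF assms(1-4) U leC])
      then show ?thesis by (intro exI[of _ q] exI[of _ u]) (simp add: C)
    qed
    have ge: "(INF (q, u)\<in>?DU. ereal (?J q u)) \<le> ?\<sigma> U"
    proof (cases "?\<sigma> U < \<infinity>")
      case True
      obtain q u where qu: "(q, u) \<in> ?DU" "ereal (?J q u) \<le> ?\<sigma> U"
        using strong[OF True] by (elim exE conjE)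
      from INF_lower[OF qu(1), of "\<lambda>(q, u). ereal (?J q u)"]
      have "(INF (q, u)\<in>?DU. ereal (?J q u)) \<le> ereal (?J q u)" by (simp only: prod.case)
      then show ?thesis using qu(2) by (rule order_trans)
    qed simp
    have ne: "?DU \<noteq> {} \<longleftrightarrow> ?\<sigma> U < \<infinity>"
    proof
      assume "?DU \<noteq> {}"
      then obtain q u where "(q, u) \<in> ?D" "is_reflection t1 U u" by blast
      then have "?\<sigma> U \<le> ereal (?J q u)" by (rule weak[OF U])
      then show "?\<sigma> U < \<infinity>" by (rule le_less_trans) simp
    next
      assume "?\<sigma> U < \<infinity>"
      from strong[OF this] show "?DU \<noteq> {}" by (elim exE conjE) (rule notI, simp only: empty_iff)
    qed
    show ?thesis using antisym[OF le ge] ne by (rule conjI)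
  qed
  have first_part: "impulse_observable F A H l \<longleftrightarrow> (\<exists>U\<in>L2 {0..t1}. ?\<sigma> U < \<infinity>)"
  proof
    assume "impulse_observable F A H l"
    then obtain q u where qu: "(q, u) \<in> ?D" unfolding impulse_observable_iff[OF assms(4)] by auto
    have "?\<sigma> (\<lambda>t. u (t1 - t)) \<le> ereal (?J q u)" by (rule weak[OF reflect(1)[OF qu] qu reflect(2)[OF qu]])
    then have "?\<sigma> (\<lambda>t. u (t1 - t)) < \<infinity>" by (rule le_less_trans) simp
    then show "\<exists>U\<in>L2 {0..t1}. ?\<sigma> U < \<infinity>" using reflect(1)[OF qu] by blast
  next
    assume "\<exists>U\<in>L2 {0..t1}. ?\<sigma> U < \<infinity>"
    then obtain U where "U \<in> L2 {0..t1}" "?\<sigma> U < \<infinity>" ..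
    then have "{(q, u)\<in>?D. is_reflection t1 U u} \<noteq> {}" using moreover_part[of U] by simp
    then have "?D \<noteq> {}" by auto
    then show "impulse_observable F A H l" unfolding impulse_observable_iff[OF assms(4)] .
  qed
  have second_part: "\<exists>V q u. minimax_observer F A H Q0 Q R l t1 V \<and> dual_optimal F A H Q0 Q R l t1 q u \<and>
      is_reflection t1 u V \<and> ?\<sigma> V = ereal (?J q u)" if fin: "\<exists>U\<in>L2 {0..t1}. ?\<sigma> U < \<infinity>"
  proof -
    obtain U0 where "?\<sigma> U0 < \<infinity>" using fin by (elim bexE)
    from real[OF this] obtain C0 where "?\<sigma> U0 = ereal C0" ..
    then have leC: "?\<sigma> U0 \<le> ereal C0" by simp
    obtain q u where qu: "(q, u) \<in> ?D" and opt: "\<And>U C. ?\<sigma> U \<le> ereal C \<Longrightarrow> ?J q u \<le> C"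
      by (rule optimal_dual_solution[OF assms(1-4) leC]) (rule that, assumption, assumption)
    have lower: "ereal (?J q u) \<le> ?\<sigma> U" for U
    proof (cases "?\<sigma> U < \<infinity>")
      case True
      from real[OF this] obtain C where C: "?\<sigma> U = ereal C" ..
      then show ?thesis using opt[of U C] by simp
    qed simp
    define V where "V = (\<lambda>t. u (t1 - t))"
    note V = reflect[OF qu, folded V_def]
    have VJ: "?\<sigma> V = ereal (?J q u)" using weak[OF V(1) qu V(2)] lower[of V] by (rule antisym)
    have "?\<sigma> V = (INF U\<in>L2 {0..t1}. ?\<sigma> U)"
    proof (rule antisym)
      show "?\<sigma> V \<le> (INF U\<in>L2 {0..t1}. ?\<sigma> U)" unfolding VJ by (rule INF_greatest[OF lower])
      show "(INF U\<in>L2 {0..t1}. ?\<sigma> U) \<le> ?\<sigma> V" by (rule INF_lower[OF V(1)])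
    qed
    moreover have "?\<sigma> V < \<infinity>" unfolding VJ by simp
    ultimately have 1: "minimax_observer F A H Q0 Q R l t1 V"
      unfolding minimax_observer_def using V(1) by blast
    have least: "ereal (?J q u) \<le> ereal (?J q' u')" if "(q', u') \<in> ?D" for q' u'
      using lower weak[OF reflect(1)[OF that] that reflect(2)[OF that]] by (rule order_trans)
    have "ereal (?J q u) = (INF (q', u')\<in>?D. ereal (?J q' u'))"
    proof (rule antisym)
      show "ereal (?J q u) \<le> (INF (q', u')\<in>?D. ereal (?J q' u'))"
      proof (rule INF_greatest)
        fix p assume "p \<in> ?D"
        then show "ereal (?J q u) \<le> (case p of (q', u') \<Rightarrow> ereal (?J q' u'))"
          using least[of "fst p" "snd p"] by (cases p) simp
      qed
      show "(INF (q', u')\<in>?D. ereal (?J q' u')) \<le> ereal (?J q u)"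
        using INF_lower[OF qu, of "\<lambda>(q', u'). ereal (?J q' u')"] by simp
    qed
    then have 2: "dual_optimal F A H Q0 Q R l t1 q u" using qu by (simp add: dual_optimal_def)
    show ?thesis using 1 2 V(3) VJ by (intro exI conjI)
  qed
  show ?thesis
  proof (intro conjI ballI)
    show "impulse_observable F A H l \<longleftrightarrow> (\<exists>U\<in>L2 {0..t1}. ?\<sigma> U < \<infinity>)" by (rule first_part)
    show "(\<exists>U\<in>L2 {0..t1}. ?\<sigma> U < \<infinity>) \<longleftrightarrow> (\<exists>V q u. minimax_observer F A H Q0 Q R l t1 V \<and>
        dual_optimal F A H Q0 Q R l t1 q u \<and> is_reflection t1 u V \<and> ?\<sigma> V = ereal (?J q u))"
    proof
      assume "\<exists>V q u. minimax_observer F A H Q0 Q R l t1 V \<and>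
        dual_optimal F A H Q0 Q R l t1 q u \<and> is_reflection t1 u V \<and> ?\<sigma> V = ereal (?J q u)"
      then obtain V where "minimax_observer F A H Q0 Q R l t1 V" by (elim exE conjE)
      then show "\<exists>U\<in>L2 {0..t1}. ?\<sigma> U < \<infinity>" unfolding minimax_observer_def by (elim conjE) (rule bexI)
    qed (rule second_part)
    fix U :: "real \<Rightarrow> real^'p" assume "U \<in> L2 {0..t1}"
    note UL = moreover_part[OF this]
    show "?\<sigma> U = (INF (q, u)\<in>{(q, u)\<in>?D. is_reflection t1 U u}. ereal (?J q u))" using UL by (rule conjunct1)
    show "{(q, u)\<in>?D. is_reflection t1 U u} \<noteq> {} \<longleftrightarrow> ?\<sigma> U < \<infinity>" using UL by (rule conjunct2)
  qed
qed

end
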